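(* Let $\mathscr{J}$ be a system of arities in a symmetric monoidal closed category $\mathscr{V}$ such that $\mathscr{V}_0$ has pullbacks, and let $\mathscr{C}$ be a $\mathscr{J}$-admissible $\mathscr{V}$-category. Let $(\mathscr{T},\mathscr{U},D)$ be a right-commutant bifold algebra in $\mathscr{C}$ whose left face $(\mathscr{T},D_\ell)$ is commutative. Then (1) there is a unique morphism $M:(\mathscr{T},D_\ell)\to(\mathscr{U},D_r)$ in $\mathrm{Alg}(C)$, where $C=|D|$; (2) the morphism of $\mathscr{J}$-theories $M:\mathscr{T}\to\mathscr{U}$ is central; and (3) there is a $(\mathscr{T},\mathscr{U})$-algebra $\langle M,1_{\mathscr{U}}\rangle:\mathscr{T}\otimes\mathscr{U}\to\mathscr{U}$ with left and right faces $M$ and $1_{\mathscr{U}}$, respectively.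
   Context: Base setting. $\mathscr{V}$ is a symmetric monoidal closed category with unit object $I$ and underlying ordinary category $\mathscr{V}_0$. By universe enlargement, $\mathscr{V}$ is a full subcategory of a symmetric monoidal closed category $\mathscr{V}'$ that is complete and cocomplete relative to a universe in which everything considered is small, with $\mathscr{V}\hookrightarrow\mathscr{V}'$ preserving all limits that exist in $\mathscr{V}$; $\mathscr{V}$-functor categories exist as $\mathscr{V}'$-categories. A system of arities is a fully faithful symmetric strong monoidal $\mathscr{V}$-functor $\mathscr{J}\to\mathscr{V}$, written as the inclusion of a full sub-$\mathscr{V}$-category containing $I$ and closed under $\otimes$ ($\mathscr{J}$ need not be small). A $\mathscr{J}$-cotensor in a $\mathscr{V}$-category is a cotensor $[J,C]$ with $J\in\mathrm{ob}\,\mathscr{J}$; $\mathscr{V}$-categories with $\mathscr{J}$-cotensors are equipped with designated ones, with $[I,C]=C$ (and identity counit). A $\mathscr{J}$-theory is a $\mathscr{V}$-category $\mathscr{T}$ equipped with an identity-on-objects $\mathscr{V}$-functor $\tau:\mathscr{J}^{\mathrm{op}}\to\mathscr{T}$ that preserves $\mathscr{J}$-cotensors; equivalently, $\mathrm{ob}\,\mathscr{T}=\mathrm{ob}\,\mathscr{J}$ and each object $J$ is equipped with a morphism $J\to\mathscr{T}(J,I)$ exhibiting $J$ as a cotensor $[J,I]$ in $\mathscr{T}$, which for $J=I$ is the identity on $I$ (these being the designated $\mathscr{J}$-cotensors of $I$ in $\mathscr{T}$; it follows that $\mathscr{T}$ has all $\mathscr{J}$-cotensors). A morphism of $\mathscr{J}$-theories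 is a $\mathscr{V}$-functor commuting with the structure $\mathscr{V}$-functors $\tau$. For a $\mathscr{V}$-category $\mathscr{X}$ with $\mathscr{J}$-cotensors, a $\mathscr{T}$-algebra in $\mathscr{X}$ is a $\mathscr{V}$-functor $A:\mathscr{T}\to\mathscr{X}$ preserving $\mathscr{J}$-cotensors; its carrier is $|A|=A(I)$. $\mathscr{T}\text{-}\mathrm{Alg}(\mathscr{X})$ is the full sub-$\mathscr{V}'$-category of $[\mathscr{T},\mathscr{X}]$ on the $\mathscr{T}$-algebras; for a morphism $f$ in it, $|f|=f_I$. $\mathscr{C}$ is $\mathscr{J}$-admissible if it has $\mathscr{J}$-cotensors and for every $\mathscr{J}$-theory $\mathscr{T}$ the ends defining the hom-objects of $\mathscr{T}\text{-}\mathrm{Alg}(\mathscr{C})$ exist in $\mathscr{V}$ (so it is a $\mathscr{V}$-category). $\mathscr{J}$-cotensors in $\mathscr{T}\text{-}\mathrm{Alg}(\mathscr{X})$ are pointwise, with designated ones chosen so that evaluation at $I$ sends them to the designated ones in $\mathscr{X}$. Algebras and commutants. Let $\mathscr{X}$ be a $\mathscr{V}$-category with $\mathscr{J}$-cotensors (such as $\mathscr{C}$ or a $\mathscr{J}$-theory). An algebra in $\mathscr{X}$ is a pair $(\mathscr{T},A)$ (also written $A$) with $\mathscr{T}$ a $\mathscr{J}$-theory and $A$ a $\mathscr{T}$-algebra in $\mathscr{X}$. For an object $X$ of $\mathscr{X}$, $\mathrm{Alg}(X)$ is the category of algebras with carrier $X$, where a morphism $(M,f):(\mathscr{T},A)\to(\mathscr{U},B)$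 consists of a morphism of $\mathscr{J}$-theories $M:\mathscr{T}\to\mathscr{U}$ and an isomorphism $f:A\to BM$ of $\mathscr{T}$-algebras with $|f|=1_X$; since $f$ is determined by $M$, such a morphism is denoted by $M$. The commutant of $(\mathscr{T},A)$ is $A^\perp=(\mathscr{T}^\perp_A,A^\perp)$, where $\mathscr{T}^\perp_A$ is the $\mathscr{J}$-theory (enriched in $\mathscr{V}'$ in general, in $\mathscr{V}$ if $\mathscr{X}$ is $\mathscr{J}$-admissible) with $\mathscr{T}^\perp_A(J,K)=\mathscr{T}\text{-}\mathrm{Alg}(\mathscr{X})([J,A],[K,A])$ ($J,K\in\mathrm{ob}\,\mathscr{J}$), with composition and identities as in $\mathscr{T}\text{-}\mathrm{Alg}(\mathscr{X})$ and structure morphisms the cotensor counits, and $A^\perp:\mathscr{T}^\perp_A\to\mathscr{X}$ is the algebra on $|A|$ given by $J\mapsto[J,|A|]$ and on homs by evaluation at $I$. Given algebras $A,B$ on the same object $X$, $A$ commutes with $B$ if there is a (necessarily unique) morphism $B\to A^\perp$ in $\mathrm{Alg}(X)$. $A$ is commutative if it commutes with itself. A morphism of $\mathscr{J}$-theories $M:\mathscr{T}\to\mathscr{S}$ is in particular an algebra $(\mathscr{T},M)$ in $\mathscr{S}$ with carrier $I$; morphisms $M:\mathscr{T}\to\mathscr{S}$ and $N:\mathscr{U}\to\mathscr{S}$ commute if $N$ factors through $M^\perp:\mathscr{T}^\perp_M\to\mathscr{S}$ by a morphism of $\mathscr{J}$-theories (equivalently, if $M$ and $N$ commute as algebras). $M:\mathscr{T}\to\mathscr{U}$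 is central if it commutes with $1_{\mathscr{U}}:\mathscr{U}\to\mathscr{U}$. Bifold algebras. For $\mathscr{J}$-theories $\mathscr{T},\mathscr{U}$, a $(\mathscr{T},\mathscr{U})$-algebra in $\mathscr{X}$ is a $\mathscr{V}$-functor $D:\mathscr{T}\otimes\mathscr{U}\to\mathscr{X}$ preserving $\mathscr{J}$-cotensors in each variable separately. A bifold algebra is a triple $(\mathscr{T},\mathscr{U},D)$ with $D$ such; its carrier is $|D|=D(I,I)$. Its left face is $D_\ell=D(-,I)$ (a $\mathscr{T}$-algebra), its right face is $D_r=D(I,-)$ (a $\mathscr{U}$-algebra). A bifold algebra $D$ in $\mathscr{C}$ is right-commutant if $D_r\cong D_\ell^\perp$ in $\mathrm{Alg}(C)$, where $C=|D|$. *)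

theory Defs
  imports Main
begin

section \<open>Categories, limits, symmetric monoidal closed categories\<close>

record ('o, 'a) category =
  Obj :: "'o set"
  Arr :: "'a set"
  Dom :: "'a \<Rightarrow> 'o"
  Cod :: "'a \<Rightarrow> 'o"
  Ident :: "'o \<Rightarrow> 'a"
  Comp :: "'a \<Rightarrow> 'a \<Rightarrow> 'a"  (infixl "\<cdot>\<index>" 65)

definition hom :: "('o, 'a, 'm) category_scheme \<Rightarrow> 'o \<Rightarrow> 'o \<Rightarrow> 'a set" where
  "hom C x y = {f \<in> Arr C. Dom C f = x \<and> Cod C f = y}"

locale category =
  fixes C :: "('o, 'a, 'm) category_scheme" (structure)
  assumes dom_cod: "f \<in> Arr C \<Longrightarrow> Dom C f \<in> Obj C \<and> Cod C f \<in> Obj C"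
    and ident: "x \<in> Obj C \<Longrightarrow> Ident C x \<in> hom C x x"
    and comp: "\<lbrakk>f \<in> hom C x y; g \<in> hom C y z\<rbrakk> \<Longrightarrow> g \<cdot> f \<in> hom C x z"
    and comp_assoc:
      "\<lbrakk>f \<in> hom C w x; g \<in> hom C x y; h \<in> hom C y z\<rbrakk> \<Longrightarrow> h \<cdot> g \<cdot> f = h \<cdot> (g \<cdot> f)"
    and ident_left: "f \<in> hom C x y \<Longrightarrow> Ident C y \<cdot> f = f"
    and ident_right: "f \<in> hom C x y \<Longrightarrow> f \<cdot> Ident C x = f"

definition is_inverse :: "('o, 'a, 'm) category_scheme \<Rightarrow> 'a \<Rightarrow> 'a \<Rightarrow> bool" where
  "is_inverse C f g \<longleftrightarrow> f \<in> Arr C \<and> g \<in> hom C (Cod C f) (Dom C f) \<and>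
     Comp C g f = Ident C (Dom C f) \<and> Comp C f g = Ident C (Cod C f)"

definition iso :: "('o, 'a, 'm) category_scheme \<Rightarrow> 'a \<Rightarrow> bool" where
  "iso C f \<longleftrightarrow> (\<exists>g. is_inverse C f g)"

definition inverse_arr :: "('o, 'a, 'm) category_scheme \<Rightarrow> 'a \<Rightarrow> 'a" where
  "inverse_arr C f = (THE g. is_inverse C f g)"

definition full_subcategory ::
    "('o, 'a, 'm) category_scheme \<Rightarrow> 'o set \<Rightarrow> ('o, 'a, 'm) category_scheme" where
  "full_subcategory C S = C\<lparr>Obj := S, Arr := {f \<in> Arr C. Dom C f \<in> S \<and> Cod C f \<in> S}\<rparr>"

definition opposite :: "('o, 'a, 'm) category_scheme \<Rightarrow> ('o, 'a, 'm) category_scheme" where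
  "opposite C = C\<lparr>Dom := Cod C, Cod := Dom C, Comp := (\<lambda>g f. Comp C f g)\<rparr>"

definition has_pullbacks :: "('o, 'a, 'm) category_scheme \<Rightarrow> bool" where
  "has_pullbacks C \<longleftrightarrow>
     (\<forall>x y z. \<forall>f \<in> hom C x z. \<forall>g \<in> hom C y z.
        \<exists>p. \<exists>p\<^sub>1 \<in> hom C p x. \<exists>p\<^sub>2 \<in> hom C p y.
          Comp C f p\<^sub>1 = Comp C g p\<^sub>2 \<and>
          (\<forall>w. \<forall>q\<^sub>1 \<in> hom C w x. \<forall>q\<^sub>2 \<in> hom C w y. Comp C f q\<^sub>1 = Comp C g q\<^sub>2 \<longrightarrow>
             (\<exists>!h. h \<in> hom C w p \<and> Comp C p\<^sub>1 h = q\<^sub>1 \<and> Comp C p\<^sub>2 h = q\<^sub>2)))"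

text \<open>Diagrams are indexed by directed graphs whose nodes and edges are elements of a type
  \<open>'s\<close>; limits of these are the same as limits of functors out of small categories, where
  \<open>small\<close> means of size at most that of the (infinite) type \<open>'s\<close>.\<close>

record ('s, 'o, 'a) diagram =
  nodes :: "'s set"
  edges :: "'s set"
  src :: "'s \<Rightarrow> 's"
  tgt :: "'s \<Rightarrow> 's"
  dobj :: "'s \<Rightarrow> 'o"
  darr :: "'s \<Rightarrow> 'a"

definition is_diagram :: "('o, 'a, 'm) category_scheme \<Rightarrow> ('s, 'o, 'a) diagram \<Rightarrow> bool" where
  "is_diagram C D \<longleftrightarrow> (\<forall>i \<in> nodes D. dobj D i \<in> Obj C) \<and>
     (\<forall>e \<in> edges D. src D e \<in> nodes D \<and> tgt D e \<in> nodes D \<and>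
        darr D e \<in> hom C (dobj D (src D e)) (dobj D (tgt D e)))"

definition is_cone ::
    "('o, 'a, 'm) category_scheme \<Rightarrow> ('s, 'o, 'a) diagram \<Rightarrow> 'o \<Rightarrow> ('s \<Rightarrow> 'a) \<Rightarrow> bool" where
  "is_cone C D x p \<longleftrightarrow> x \<in> Obj C \<and> (\<forall>i \<in> nodes D. p i \<in> hom C x (dobj D i)) \<and>
     (\<forall>e \<in> edges D. Comp C (darr D e) (p (src D e)) = p (tgt D e))"

definition is_limit ::
    "('o, 'a, 'm) category_scheme \<Rightarrow> ('s, 'o, 'a) diagram \<Rightarrow> 'o \<Rightarrow> ('s \<Rightarrow> 'a) \<Rightarrow> bool" where
  "is_limit C D x p \<longleftrightarrow> is_cone C D x p \<and>
     (\<forall>y q. is_cone C D y q \<longrightarrow>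
        (\<exists>!h. h \<in> hom C y x \<and> (\<forall>i \<in> nodes D. Comp C (p i) h = q i)))"

definition complete :: "('o, 'a, 'm) category_scheme \<Rightarrow> 's itself \<Rightarrow> bool" where
  "complete C \<kappa> \<longleftrightarrow>
     (\<forall>D :: ('s, 'o, 'a) diagram. is_diagram C D \<longrightarrow> (\<exists>x p. is_limit C D x p))"

definition cocomplete :: "('o, 'a, 'm) category_scheme \<Rightarrow> 's itself \<Rightarrow> bool" where
  "cocomplete C \<kappa> \<longleftrightarrow> complete (opposite C) \<kappa>"

definition subcategory_preserves_limits ::
    "('o, 'a, 'm) category_scheme \<Rightarrow> 'o set \<Rightarrow> 's itself \<Rightarrow> bool" where
  "subcategory_preserves_limits C S \<kappa> \<longleftrightarrow>
     (\<forall>(D :: ('s, 'o, 'a) diagram) x p. is_diagram (full_subcategory C S) D \<longrightarrow>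
        is_limit (full_subcategory C S) D x p \<longrightarrow> is_limit C D x p)"

text \<open>\<open>Ev b c\<close> is the evaluation \<open>[b,c] \<otimes> b \<rightarrow> c\<close>; \<open>\<otimes>\<close> is the tensor product on objects,
  \<open>\<odot>\<close> on arrows.\<close>

record ('o, 'a) smc_category = "('o, 'a) category" +
  Unit :: 'o
  Tens :: "'o \<Rightarrow> 'o \<Rightarrow> 'o"  (infixr "\<otimes>\<index>" 75)
  TensA :: "'a \<Rightarrow> 'a \<Rightarrow> 'a"  (infixr "\<odot>\<index>" 75)
  Assoc :: "'o \<Rightarrow> 'o \<Rightarrow> 'o \<Rightarrow> 'a"
  Lun :: "'o \<Rightarrow> 'a"
  Run :: "'o \<Rightarrow> 'a"
  Swap :: "'o \<Rightarrow> 'o \<Rightarrow> 'a"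
  IHom :: "'o \<Rightarrow> 'o \<Rightarrow> 'o"
  Ev :: "'o \<Rightarrow> 'o \<Rightarrow> 'a"

locale smc_category = category V
  for V :: "('o, 'a, 'm) smc_category_scheme" (structure) +
  assumes unit: "Unit V \<in> Obj V"
    and tens: "\<lbrakk>a \<in> Obj V; b \<in> Obj V\<rbrakk> \<Longrightarrow> a \<otimes> b \<in> Obj V"
    and tens_arr: "\<lbrakk>f \<in> hom V a b; g \<in> hom V c d\<rbrakk> \<Longrightarrow> f \<odot> g \<in> hom V (a \<otimes> c) (b \<otimes> d)"
    and tens_ident: "\<lbrakk>a \<in> Obj V; b \<in> Obj V\<rbrakk> \<Longrightarrow> Ident V a \<odot> Ident V b = Ident V (a \<otimes> b)"
    and tens_comp: "\<lbrakk>f \<in> hom V a b; g \<in> hom V b c; f' \<in> hom V a' b'; g' \<in> hom V b' c'\<rbrakk>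
      \<Longrightarrow> (g \<cdot> f) \<odot> (g' \<cdot> f') = (g \<odot> g') \<cdot> (f \<odot> f')"
    and assoc: "\<lbrakk>a \<in> Obj V; b \<in> Obj V; c \<in> Obj V\<rbrakk>
      \<Longrightarrow> Assoc V a b c \<in> hom V ((a \<otimes> b) \<otimes> c) (a \<otimes> (b \<otimes> c)) \<and> iso V (Assoc V a b c)"
    and assoc_natural: "\<lbrakk>f \<in> hom V a a'; g \<in> hom V b b'; h \<in> hom V c c'\<rbrakk>
      \<Longrightarrow> Assoc V a' b' c' \<cdot> ((f \<odot> g) \<odot> h) = (f \<odot> (g \<odot> h)) \<cdot> Assoc V a b c"
    and lun: "a \<in> Obj V \<Longrightarrow> Lun V a \<in> hom V (Unit V \<otimes> a) a \<and> iso V (Lun V a)"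
    and lun_natural: "f \<in> hom V a b \<Longrightarrow> Lun V b \<cdot> (Ident V (Unit V) \<odot> f) = f \<cdot> Lun V a"
    and run: "a \<in> Obj V \<Longrightarrow> Run V a \<in> hom V (a \<otimes> Unit V) a \<and> iso V (Run V a)"
    and run_natural: "f \<in> hom V a b \<Longrightarrow> Run V b \<cdot> (f \<odot> Ident V (Unit V)) = f \<cdot> Run V a"
    and swap: "\<lbrakk>a \<in> Obj V; b \<in> Obj V\<rbrakk> \<Longrightarrow> Swap V a b \<in> hom V (a \<otimes> b) (b \<otimes> a)"
    and swap_natural: "\<lbrakk>f \<in> hom V a a'; g \<in> hom V b b'\<rbrakk>
      \<Longrightarrow> Swap V a' b' \<cdot> (f \<odot> g) = (g \<odot> f) \<cdot> Swap V a b"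
    and swap_swap: "\<lbrakk>a \<in> Obj V; b \<in> Obj V\<rbrakk> \<Longrightarrow> Swap V b a \<cdot> Swap V a b = Ident V (a \<otimes> b)"
    and pentagon: "\<lbrakk>a \<in> Obj V; b \<in> Obj V; c \<in> Obj V; d \<in> Obj V\<rbrakk>
      \<Longrightarrow> (Ident V a \<odot> Assoc V b c d) \<cdot> Assoc V a (b \<otimes> c) d \<cdot> (Assoc V a b c \<odot> Ident V d)
          = Assoc V a b (c \<otimes> d) \<cdot> Assoc V (a \<otimes> b) c d"
    and triangle: "\<lbrakk>a \<in> Obj V; b \<in> Obj V\<rbrakk>
      \<Longrightarrow> (Ident V a \<odot> Lun V b) \<cdot> Assoc V a (Unit V) b = Run V a \<odot> Ident V b"
    and hexagon: "\<lbrakk>a \<in> Obj V; b \<in> Obj V; c \<in> Obj V\<rbrakk>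
      \<Longrightarrow> Assoc V b c a \<cdot> Swap V a (b \<otimes> c) \<cdot> Assoc V a b c
          = (Ident V b \<odot> Swap V a c) \<cdot> Assoc V b a c \<cdot> (Swap V a b \<odot> Ident V c)"
    and ihom: "\<lbrakk>b \<in> Obj V; c \<in> Obj V\<rbrakk>
      \<Longrightarrow> IHom V b c \<in> Obj V \<and> Ev V b c \<in> hom V (IHom V b c \<otimes> b) c"
    and closed: "\<lbrakk>a \<in> Obj V; b \<in> Obj V; c \<in> Obj V; f \<in> hom V (a \<otimes> b) c\<rbrakk>
      \<Longrightarrow> \<exists>!g. g \<in> hom V a (IHom V b c) \<and> Ev V b c \<cdot> (g \<odot> Ident V b) = f"


section \<open>The base of enrichment and the system of arity objects\<close>

text \<open>The record carries the enlarged base \<open>\<V>'\<close>; the category \<open>\<V>\<close> is its full subcategory on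
  \<open>Vob\<close>, with the symmetric monoidal closed structure inherited from \<open>\<V>'\<close>. Hence \<open>\<V>\<close>-categories
  are \<open>\<V>'\<close>-categories whose hom-objects are in \<open>Vob\<close>. The arity system \<open>\<J>\<close> is the full
  sub-\<open>\<V>\<close>-category of \<open>\<V>\<close> on \<open>Job\<close>.\<close>

record ('o, 'a) base = "('o, 'a) smc_category" +
  Vob :: "'o set"
  Job :: "'o set"

locale universe_enlargement = smc_category V
  for V :: "('o, 'a, 'm) base_scheme" (structure) +
  fixes \<kappa> :: "'s itself"
  assumes Vob: "Vob V \<subseteq> Obj V"
    and Vob_unit: "Unit V \<in> Vob V"
    and Vob_tens: "\<lbrakk>a \<in> Vob V; b \<in> Vob V\<rbrakk> \<Longrightarrow> a \<otimes> b \<in> Vob V"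
    and Vob_ihom: "\<lbrakk>a \<in> Vob V; b \<in> Vob V\<rbrakk> \<Longrightarrow> IHom V a b \<in> Vob V"
    and infinite_size: "infinite (UNIV :: 's set)"
    and complete: "complete V \<kappa>"
    and cocomplete: "cocomplete V \<kappa>"
    and preserves_limits: "subcategory_preserves_limits V (Vob V) \<kappa>"

text \<open>Only the set of objects of \<open>\<J>\<close> has to be small relative to the universe: all the
  ends that are formed are indexed by \<open>\<J>\<close>-theories, whose objects are those of \<open>\<J>\<close>.\<close>

locale system_of_arities = universe_enlargement V \<kappa>
  for V :: "('o, 'a, 'm) base_scheme" (structure) and \<kappa> :: "'s itself" +
  assumes Job: "Job V \<subseteq> Vob V"
    and Job_unit: "Unit V \<in> Job V"
    and Job_tens: "\<lbrakk>J \<in> Job V; K \<in> Job V\<rbrakk> \<Longrightarrow> J \<otimes> K \<in> Job V"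
    and Job_small: "\<exists>e :: 'o \<Rightarrow> 's. inj_on e (Job V)"


section \<open>Enriched categories\<close>

text \<open>Composition is \<open>EComp A x y z : A(y,z) \<otimes> A(x,y) \<rightarrow> A(x,z)\<close>.\<close>

record ('x, 'o, 'a) vcat =
  EOb :: "'x set"
  EHom :: "'x \<Rightarrow> 'x \<Rightarrow> 'o"
  EComp :: "'x \<Rightarrow> 'x \<Rightarrow> 'x \<Rightarrow> 'a"
  EId :: "'x \<Rightarrow> 'a"

text \<open>A \<open>\<V>'\<close>-category together with chosen objects \<open>Cot J x = [J,x]\<close> and counits
  \<open>Ctu J x : J \<rightarrow> X([J,x],x)\<close>.\<close>

record ('x, 'o, 'a) cvcat = "('x, 'o, 'a) vcat" +
  Cot :: "'o \<Rightarrow> 'x \<Rightarrow> 'x"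
  Ctu :: "'o \<Rightarrow> 'x \<Rightarrow> 'a"

text \<open>\<open>Tau J K : [K,J] \<rightarrow> T(J,K)\<close> is the action on homs of the identity-on-objects functor
  \<open>\<tau> : \<J>\<^sup>o\<^sup>p \<rightarrow> T\<close>.\<close>

record ('o, 'a) vtheory = "('o, 'o, 'a) vcat" +
  Tau :: "'o \<Rightarrow> 'o \<Rightarrow> 'a"

record ('x, 'y, 'a) vfun =
  FO :: "'x \<Rightarrow> 'y"
  FH :: "'x \<Rightarrow> 'x \<Rightarrow> 'a"

text \<open>Functors are determined only on the objects of their domain.\<close>

definition functor_eq ::
    "('x, 'o, 'a, 'n) vcat_scheme \<Rightarrow> ('x, 'y, 'a) vfun \<Rightarrow> ('x, 'y, 'a) vfun \<Rightarrow> bool" where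
  "functor_eq A F G \<longleftrightarrow> (\<forall>x \<in> EOb A. FO F x = FO G x) \<and>
     (\<forall>x \<in> EOb A. \<forall>y \<in> EOb A. FH F x y = FH G x y)"

context
  fixes V :: "('o, 'a, 'm) base_scheme" (structure)
begin

definition curry_arr :: "'o \<Rightarrow> 'o \<Rightarrow> 'o \<Rightarrow> 'a \<Rightarrow> 'a" where
  "curry_arr a b c f = (THE g. g \<in> hom V a (IHom V b c) \<and> Ev V b c \<cdot> (g \<odot> Ident V b) = f)"

definition enriched_category :: "('x, 'o, 'a, 'n) vcat_scheme \<Rightarrow> bool" where
  "enriched_category A \<longleftrightarrow>
     (\<forall>x \<in> EOb A. \<forall>y \<in> EOb A. EHom A x y \<in> Obj V) \<and>
     (\<forall>x \<in> EOb A. \<forall>y \<in> EOb A. \<forall>z \<in> EOb A.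
        EComp A x y z \<in> hom V (EHom A y z \<otimes> EHom A x y) (EHom A x z)) \<and>
     (\<forall>x \<in> EOb A. EId A x \<in> hom V (Unit V) (EHom A x x)) \<and>
     (\<forall>w \<in> EOb A. \<forall>x \<in> EOb A. \<forall>y \<in> EOb A. \<forall>z \<in> EOb A.
        EComp A w x z \<cdot> (EComp A x y z \<odot> Ident V (EHom A w x)) =
        EComp A w y z \<cdot> (Ident V (EHom A y z) \<odot> EComp A w x y) \<cdot>
          Assoc V (EHom A y z) (EHom A x y) (EHom A w x)) \<and>
     (\<forall>x \<in> EOb A. \<forall>y \<in> EOb A.
        EComp A x y y \<cdot> (EId A y \<odot> Ident V (EHom A x y)) = Lun V (EHom A x y) \<and>
        EComp A x x y \<cdot> (Ident V (EHom A x y) \<odot> EId A x) = Run V (EHom A x y))"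

definition homs_in_V :: "('x, 'o, 'a, 'n) vcat_scheme \<Rightarrow> bool" where
  "homs_in_V A \<longleftrightarrow> (\<forall>x \<in> EOb A. \<forall>y \<in> EOb A. EHom A x y \<in> Vob V)"

definition V_category :: "('x, 'o, 'a, 'n) vcat_scheme \<Rightarrow> bool" where
  "V_category A \<longleftrightarrow> enriched_category A \<and> homs_in_V A"

definition vfunctor ::
    "('x, 'o, 'a, 'n) vcat_scheme \<Rightarrow> ('y, 'o, 'a, 'k) vcat_scheme \<Rightarrow> ('x, 'y, 'a) vfun \<Rightarrow> bool" where
  "vfunctor A B F \<longleftrightarrow>
     (\<forall>x \<in> EOb A. FO F x \<in> EOb B) \<and>
     (\<forall>x \<in> EOb A. \<forall>y \<in> EOb A. FH F x y \<in> hom V (EHom A x y) (EHom B (FO F x) (FO F y))) \<and>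
     (\<forall>x \<in> EOb A. \<forall>y \<in> EOb A. \<forall>z \<in> EOb A.
        FH F x z \<cdot> EComp A x y z =
        EComp B (FO F x) (FO F y) (FO F z) \<cdot> (FH F y z \<odot> FH F x y)) \<and>
     (\<forall>x \<in> EOb A. FH F x x \<cdot> EId A x = EId B (FO F x))"

definition id_vfun :: "('x, 'o, 'a, 'n) vcat_scheme \<Rightarrow> ('x, 'x, 'a) vfun" where
  "id_vfun A = \<lparr>FO = (\<lambda>x. x), FH = (\<lambda>x y. Ident V (EHom A x y))\<rparr>"

definition comp_vfun ::
    "('y, 'z, 'a) vfun \<Rightarrow> ('x, 'y, 'a) vfun \<Rightarrow> ('x, 'z, 'a) vfun" where
  "comp_vfun G F = \<lparr>FO = (\<lambda>x. FO G (FO F x)),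
     FH = (\<lambda>x y. FH G (FO F x) (FO F y) \<cdot> FH F x y)\<rparr>"

text \<open>The middle-four interchange \<open>(a \<otimes> b) \<otimes> (c \<otimes> d) \<rightarrow> (a \<otimes> c) \<otimes> (b \<otimes> d)\<close>.\<close>

definition middle_four :: "'o \<Rightarrow> 'o \<Rightarrow> 'o \<Rightarrow> 'o \<Rightarrow> 'a" where
  "middle_four a b c d =
     inverse_arr V (Assoc V a c (b \<otimes> d)) \<cdot>
     (Ident V a \<odot> (Assoc V c b d \<cdot> (Swap V b c \<odot> Ident V d) \<cdot> inverse_arr V (Assoc V b c d))) \<cdot>
     Assoc V a b (c \<otimes> d)"

definition tensor_vcat ::
    "('x, 'o, 'a, 'n) vcat_scheme \<Rightarrow> ('y, 'o, 'a, 'k) vcat_scheme \<Rightarrow> ('x \<times> 'y, 'o, 'a) vcat" where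
  "tensor_vcat A B =
     \<lparr>EOb = EOb A \<times> EOb B,
      EHom = (\<lambda>(x, x') (y, y'). EHom A x y \<otimes> EHom B x' y'),
      EComp = (\<lambda>(x, x') (y, y') (z, z').
        (EComp A x y z \<odot> EComp B x' y' z') \<cdot>
        middle_four (EHom A y z) (EHom B y' z') (EHom A x y) (EHom B x' y')),
      EId = (\<lambda>(x, x'). (EId A x \<odot> EId B x') \<cdot> inverse_arr V (Lun V (Unit V)))\<rparr>"

text \<open>The partial functors \<open>D(-,y)\<close> and \<open>D(x,-)\<close> of a functor \<open>D\<close> on \<open>A \<otimes> B\<close>.\<close>

definition partial_left ::
    "('x, 'o, 'a, 'n) vcat_scheme \<Rightarrow> ('y, 'o, 'a, 'k) vcat_scheme \<Rightarrow>
     ('x \<times> 'y, 'z, 'a) vfun \<Rightarrow> 'y \<Rightarrow> ('x, 'z, 'a) vfun" where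
  "partial_left A B D y =
     \<lparr>FO = (\<lambda>x. FO D (x, y)),
      FH = (\<lambda>x x'. FH D (x, y) (x', y) \<cdot> (Ident V (EHom A x x') \<odot> EId B y) \<cdot>
        inverse_arr V (Run V (EHom A x x')))\<rparr>"

definition partial_right ::
    "('x, 'o, 'a, 'n) vcat_scheme \<Rightarrow> ('y, 'o, 'a, 'k) vcat_scheme \<Rightarrow>
     ('x \<times> 'y, 'z, 'a) vfun \<Rightarrow> 'x \<Rightarrow> ('y, 'z, 'a) vfun" where
  "partial_right A B D x =
     \<lparr>FO = (\<lambda>y. FO D (x, y)),
      FH = (\<lambda>y y'. FH D (x, y) (x, y') \<cdot> (EId A x \<odot> Ident V (EHom B y y')) \<cdot>
        inverse_arr V (Lun V (EHom B y y')))\<rparr>"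


section \<open>Natural transformations and ends\<close>

text \<open>A \<open>\<V>\<close>-natural family \<open>\<alpha>\<^sub>x : W \<rightarrow> B(Fx,Gx)\<close>; for \<open>W = I\<close> this is a \<open>\<V>\<close>-natural
  transformation \<open>F \<rightarrow> G\<close>.\<close>

definition vnatural ::
    "('x, 'o, 'a, 'n) vcat_scheme \<Rightarrow> ('y, 'o, 'a, 'k) vcat_scheme \<Rightarrow>
     ('x, 'y, 'a) vfun \<Rightarrow> ('x, 'y, 'a) vfun \<Rightarrow> 'o \<Rightarrow> ('x \<Rightarrow> 'a) \<Rightarrow> bool" where
  "vnatural A B F G W \<alpha> \<longleftrightarrow> W \<in> Obj V \<and>
     (\<forall>x \<in> EOb A. \<alpha> x \<in> hom V W (EHom B (FO F x) (FO G x))) \<and>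
     (\<forall>x \<in> EOb A. \<forall>y \<in> EOb A.
        EComp B (FO F x) (FO F y) (FO G y) \<cdot> (\<alpha> y \<odot> FH F x y) =
        EComp B (FO F x) (FO G x) (FO G y) \<cdot> (FH G x y \<odot> \<alpha> x) \<cdot> Swap V W (EHom A x y))"

definition vertical_comp ::
    "('y, 'o, 'a, 'k) vcat_scheme \<Rightarrow> 'y \<Rightarrow> 'y \<Rightarrow> 'y \<Rightarrow> 'a \<Rightarrow> 'a \<Rightarrow> 'a" where
  "vertical_comp B x y z g f = EComp B x y z \<cdot> (g \<odot> f) \<cdot> inverse_arr V (Lun V (Unit V))"

definition natural_iso ::
    "('x, 'o, 'a, 'n) vcat_scheme \<Rightarrow> ('y, 'o, 'a, 'k) vcat_scheme \<Rightarrow>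
     ('x, 'y, 'a) vfun \<Rightarrow> ('x, 'y, 'a) vfun \<Rightarrow> ('x \<Rightarrow> 'a) \<Rightarrow> bool" where
  "natural_iso A B F G f \<longleftrightarrow> vnatural A B F G (Unit V) f \<and>
     (\<exists>g. vnatural A B G F (Unit V) g \<and>
        (\<forall>x \<in> EOb A.
           vertical_comp B (FO F x) (FO G x) (FO F x) (g x) (f x) = EId B (FO F x) \<and>
           vertical_comp B (FO G x) (FO F x) (FO G x) (f x) (g x) = EId B (FO G x)))"

text \<open>\<open>(E, \<pi>)\<close> is an end of \<open>B(F-,G-)\<close> in the full subcategory of \<open>\<V>'\<close> on \<open>Q\<close>; it is used for
  \<open>Q = Vob\<close> (ends in \<open>\<V>\<close>) and \<open>Q = Obj\<close> (ends in \<open>\<V>'\<close>).\<close>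

definition is_hom_end ::
    "'o set \<Rightarrow> ('x, 'o, 'a, 'n) vcat_scheme \<Rightarrow> ('y, 'o, 'a, 'k) vcat_scheme \<Rightarrow>
     ('x, 'y, 'a) vfun \<Rightarrow> ('x, 'y, 'a) vfun \<Rightarrow> 'o \<times> ('x \<Rightarrow> 'a) \<Rightarrow> bool" where
  "is_hom_end Q A B F G = (\<lambda>(E, \<pi>). E \<in> Q \<and> vnatural A B F G E \<pi> \<and>
     (\<forall>W \<in> Q. \<forall>\<alpha>. vnatural A B F G W \<alpha> \<longrightarrow>
        (\<exists>!h. h \<in> hom V W E \<and> (\<forall>x \<in> EOb A. \<pi> x \<cdot> h = \<alpha> x))))"

text \<open>A choice of the end, taken in \<open>\<V>\<close> whenever it exists there, so that the resulting
  hom-object belongs to \<open>Vob\<close> in that case. The inclusion of \<open>\<V>\<close> preserves limits, so that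
  an end in \<open>\<V>\<close> is also one in \<open>\<V>'\<close>.\<close>

definition hom_end ::
    "('x, 'o, 'a, 'n) vcat_scheme \<Rightarrow> ('y, 'o, 'a, 'k) vcat_scheme \<Rightarrow>
     ('x, 'y, 'a) vfun \<Rightarrow> ('x, 'y, 'a) vfun \<Rightarrow> 'o \<times> ('x \<Rightarrow> 'a)" where
  "hom_end A B F G =
     (if \<exists>e. is_hom_end (Vob V) A B F G e then SOME e. is_hom_end (Vob V) A B F G e
      else SOME e. is_hom_end (Obj V) A B F G e)"

definition nat_obj ::
    "('x, 'o, 'a, 'n) vcat_scheme \<Rightarrow> ('y, 'o, 'a, 'k) vcat_scheme \<Rightarrow>
     ('x, 'y, 'a) vfun \<Rightarrow> ('x, 'y, 'a) vfun \<Rightarrow> 'o" where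
  "nat_obj A B F G = fst (hom_end A B F G)"

definition nat_proj ::
    "('x, 'o, 'a, 'n) vcat_scheme \<Rightarrow> ('y, 'o, 'a, 'k) vcat_scheme \<Rightarrow>
     ('x, 'y, 'a) vfun \<Rightarrow> ('x, 'y, 'a) vfun \<Rightarrow> 'x \<Rightarrow> 'a" where
  "nat_proj A B F G = snd (hom_end A B F G)"

definition nat_lift ::
    "('x, 'o, 'a, 'n) vcat_scheme \<Rightarrow> ('y, 'o, 'a, 'k) vcat_scheme \<Rightarrow>
     ('x, 'y, 'a) vfun \<Rightarrow> ('x, 'y, 'a) vfun \<Rightarrow> 'o \<Rightarrow> ('x \<Rightarrow> 'a) \<Rightarrow> 'a" where
  "nat_lift A B F G W \<alpha> =
     (THE h. h \<in> hom V W (nat_obj A B F G) \<and> (\<forall>x \<in> EOb A. nat_proj A B F G x \<cdot> h = \<alpha> x))"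


section \<open>Cotensors\<close>

text \<open>\<open>k : J \<rightarrow> X(c,x)\<close> exhibits \<open>c\<close> as a cotensor \<open>[J,x]\<close>: the induced morphisms
  \<open>X(y,c) \<rightarrow> [J, X(y,x)]\<close> are isomorphisms.\<close>

definition is_cotensor ::
    "('x, 'o, 'a, 'n) vcat_scheme \<Rightarrow> 'o \<Rightarrow> 'x \<Rightarrow> 'x \<Rightarrow> 'a \<Rightarrow> bool" where
  "is_cotensor X J x c k \<longleftrightarrow> J \<in> Obj V \<and> x \<in> EOb X \<and> c \<in> EOb X \<and> k \<in> hom V J (EHom X c x) \<and>
     (\<forall>y \<in> EOb X. iso V (curry_arr (EHom X y c) J (EHom X y x)
        (EComp X y c x \<cdot> (k \<odot> Ident V (EHom X y c)) \<cdot> Swap V (EHom X y c) J)))"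

definition preserves_cotensors ::
    "('x, 'o, 'a, 'n) vcat_scheme \<Rightarrow> ('y, 'o, 'a, 'k) vcat_scheme \<Rightarrow> ('x, 'y, 'a) vfun \<Rightarrow> bool" where
  "preserves_cotensors A B F \<longleftrightarrow>
     (\<forall>J \<in> Job V. \<forall>x c k. is_cotensor A J x c k \<longrightarrow>
        is_cotensor B J (FO F x) (FO F c) (FH F c x \<cdot> k))"

definition has_designated_cotensors :: "('x, 'o, 'a, 'n) cvcat_scheme \<Rightarrow> bool" where
  "has_designated_cotensors X \<longleftrightarrow>
     (\<forall>J \<in> Job V. \<forall>x \<in> EOb X. is_cotensor X J x (Cot X J x) (Ctu X J x)) \<and>
     (\<forall>x \<in> EOb X. Cot X (Unit V) x = x \<and> Ctu X (Unit V) x = EId X x)"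

text \<open>The morphism \<open>W \<rightarrow> X(y,c)\<close> induced by \<open>\<phi> : J \<otimes> W \<rightarrow> X(y,x)\<close>, where \<open>k\<close> exhibits \<open>c\<close>
  as a cotensor \<open>[J,x]\<close>.\<close>

definition cot_lift ::
    "('x, 'o, 'a, 'n) vcat_scheme \<Rightarrow> 'x \<Rightarrow> 'x \<Rightarrow> 'a \<Rightarrow> 'x \<Rightarrow> 'o \<Rightarrow> 'a \<Rightarrow> 'a" where
  "cot_lift X x c k y W \<phi> =
     (THE h. h \<in> hom V W (EHom X y c) \<and> EComp X y c x \<cdot> (k \<odot> h) = \<phi>)"

text \<open>The action \<open>X(x,y) \<rightarrow> X([J,x],[J,y])\<close> on homs of the functor \<open>[J,-]\<close>.\<close>

definition cot_map :: "('x, 'o, 'a, 'n) cvcat_scheme \<Rightarrow> 'o \<Rightarrow> 'x \<Rightarrow> 'x \<Rightarrow> 'a" where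
  "cot_map X J x y =
     cot_lift X y (Cot X J y) (Ctu X J y) (Cot X J x) (EHom X x y)
       (EComp X (Cot X J x) x y \<cdot> (Ident V (EHom X x y) \<odot> Ctu X J x) \<cdot> Swap V J (EHom X x y))"

definition cot_vfun ::
    "('y, 'o, 'a, 'n) cvcat_scheme \<Rightarrow> 'o \<Rightarrow> ('x, 'y, 'a) vfun \<Rightarrow> ('x, 'y, 'a) vfun" where
  "cot_vfun X J A =
     \<lparr>FO = (\<lambda>x. Cot X J (FO A x)), FH = (\<lambda>x y. cot_map X J (FO A x) (FO A y) \<cdot> FH A x y)\<rparr>"


section \<open>Theories and their algebras\<close>

definition Jop :: "('o, 'o, 'a) vcat" where
  "Jop =
     \<lparr>EOb = Job V,
      EHom = (\<lambda>J K. IHom V K J),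
      EComp = (\<lambda>J K L. curry_arr (IHom V L K \<otimes> IHom V K J) L J
        (Ev V K J \<cdot> (Ident V (IHom V K J) \<odot> Ev V L K) \<cdot> Assoc V (IHom V K J) (IHom V L K) L \<cdot>
         (Swap V (IHom V L K) (IHom V K J) \<odot> Ident V L))),
      EId = (\<lambda>J. curry_arr (Unit V) J J (Lun V J))\<rparr>"

text \<open>A \<open>\<J>\<close>-theory enriched in \<open>\<V>'\<close>, respectively in \<open>\<V>\<close>.\<close>

definition theory_enlarged :: "('o, 'a) vtheory \<Rightarrow> bool" where
  "theory_enlarged T \<longleftrightarrow> enriched_category T \<and> EOb T = Job V \<and>
     vfunctor Jop T \<lparr>FO = (\<lambda>J. J), FH = Tau T\<rparr> \<and>
     preserves_cotensors Jop T \<lparr>FO = (\<lambda>J. J), FH = Tau T\<rparr>"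

definition J_theory :: "('o, 'a) vtheory \<Rightarrow> bool" where
  "J_theory T \<longleftrightarrow> theory_enlarged T \<and> homs_in_V T"

definition theory_morphism ::
    "('o, 'a) vtheory \<Rightarrow> ('o, 'a) vtheory \<Rightarrow> ('o, 'o, 'a) vfun \<Rightarrow> bool" where
  "theory_morphism T U M \<longleftrightarrow> vfunctor T U M \<and>
     functor_eq Jop (comp_vfun M \<lparr>FO = (\<lambda>J. J), FH = Tau T\<rparr>) \<lparr>FO = (\<lambda>J. J), FH = Tau U\<rparr>"

text \<open>A theory as a category with designated cotensors. That of \<open>I\<close> is \<open>[J,I] = J\<close>, with counit
  \<open>J \<cong> [I,J] \<rightarrow> T(J,I)\<close> obtained from \<open>\<tau>\<close>, and \<open>[I,K] = K\<close>; for all the others we take the image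
  under \<open>\<tau>\<close> of the cotensor \<open>[J,K] = J \<otimes> K\<close> in \<open>\<J>\<^sup>o\<^sup>p\<close>, with counit \<open>J \<rightarrow> [K, J \<otimes> K]\<close>.\<close>

definition structure_arr :: "('o, 'a) vtheory \<Rightarrow> 'o \<Rightarrow> 'a" where
  "structure_arr T J = Tau T J (Unit V) \<cdot> curry_arr J (Unit V) J (Run V J)"

definition theory_cvcat :: "('o, 'a) vtheory \<Rightarrow> ('o, 'o, 'a) cvcat" where
  "theory_cvcat T =
     \<lparr>EOb = EOb T, EHom = EHom T, EComp = EComp T, EId = EId T,
      Cot = (\<lambda>J K. if J = Unit V then K else if K = Unit V then J else J \<otimes> K),
      Ctu = (\<lambda>J K. if J = Unit V then EId T K else if K = Unit V then structure_arr T J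
        else Tau T (J \<otimes> K) K \<cdot> curry_arr J K (J \<otimes> K) (Ident V (J \<otimes> K)))\<rparr>"

text \<open>Conversely, a category with objects \<open>\<J>\<close> and structure morphisms \<open>g\<^sub>J : J \<rightarrow> T(J,I)\<close> which
  exhibit \<open>J\<close> as \<open>[J,I]\<close> determines \<open>\<tau>\<close>: its component \<open>[K,J] \<rightarrow> T(J,K)\<close> is induced by
  \<open>K \<otimes> [K,J] \<rightarrow> J \<rightarrow> T(J,I)\<close>.\<close>

definition theory_of_structure :: "('o, 'o, 'a) vcat \<Rightarrow> ('o \<Rightarrow> 'a) \<Rightarrow> ('o, 'a) vtheory" where
  "theory_of_structure T g =
     \<lparr>EOb = EOb T, EHom = EHom T, EComp = EComp T, EId = EId T,
      Tau = (\<lambda>J K. cot_lift T (Unit V) K (g K) J (IHom V K J)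
        (g J \<cdot> Ev V K J \<cdot> Swap V K (IHom V K J)))\<rparr>"

definition algebra ::
    "('x, 'o, 'a, 'n) vcat_scheme \<Rightarrow> ('y, 'o, 'a, 'k) vcat_scheme \<Rightarrow> ('x, 'y, 'a) vfun \<Rightarrow> bool" where
  "algebra T X A \<longleftrightarrow> vfunctor T X A \<and> preserves_cotensors T X A"

definition alg_vcat ::
    "('x, 'o, 'a, 'n) vcat_scheme \<Rightarrow> ('y, 'o, 'a, 'k) vcat_scheme \<Rightarrow>
     (('x, 'y, 'a) vfun, 'o, 'a) vcat" where
  "alg_vcat T X =
     \<lparr>EOb = {A. algebra T X A},
      EHom = nat_obj T X,
      EComp = (\<lambda>A B C. nat_lift T X A C (nat_obj T X B C \<otimes> nat_obj T X A B)
        (\<lambda>L. EComp X (FO A L) (FO B L) (FO C L) \<cdot> (nat_proj T X B C L \<odot> nat_proj T X A B L))),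
      EId = (\<lambda>A. nat_lift T X A A (Unit V) (\<lambda>L. EId X (FO A L)))\<rparr>"

definition admissible :: "('x, 'o, 'a, 'n) cvcat_scheme \<Rightarrow> bool" where
  "admissible C \<longleftrightarrow> has_designated_cotensors C \<and>
     (\<forall>T A B. J_theory T \<longrightarrow> algebra T C A \<longrightarrow> algebra T C B \<longrightarrow>
        (\<exists>e. is_hom_end (Vob V) T C A B e))"

text \<open>Morphisms \<open>(T,A) \<rightarrow> (U,B)\<close> in \<open>Alg(c)\<close>, for an object \<open>c\<close> of \<open>X\<close>. The invertible
  \<open>f : A \<rightarrow> BM\<close> with \<open>f\<^sub>I = 1\<close> is determined by \<open>M\<close>.\<close>

definition Alg_object ::
    "('y, 'o, 'a, 'n) vcat_scheme \<Rightarrow> 'y \<Rightarrow> ('o, 'a) vtheory \<Rightarrow> ('o, 'y, 'a) vfun \<Rightarrow> bool" where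
  "Alg_object X c T A \<longleftrightarrow> theory_enlarged T \<and> algebra T X A \<and> FO A (Unit V) = c"

definition Alg_morphism ::
    "('y, 'o, 'a, 'n) vcat_scheme \<Rightarrow> 'y \<Rightarrow> ('o, 'a) vtheory \<Rightarrow> ('o, 'y, 'a) vfun \<Rightarrow>
     ('o, 'a) vtheory \<Rightarrow> ('o, 'y, 'a) vfun \<Rightarrow> ('o, 'o, 'a) vfun \<Rightarrow> bool" where
  "Alg_morphism X c T A U B M \<longleftrightarrow> Alg_object X c T A \<and> Alg_object X c U B \<and>
     theory_morphism T U M \<and>
     (\<exists>f. natural_iso T X A (comp_vfun B M) f \<and> f (Unit V) = EId X c)"

definition Alg_isomorphic ::
    "('y, 'o, 'a, 'n) vcat_scheme \<Rightarrow> 'y \<Rightarrow> ('o, 'a) vtheory \<Rightarrow> ('o, 'y, 'a) vfun \<Rightarrow>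
     ('o, 'a) vtheory \<Rightarrow> ('o, 'y, 'a) vfun \<Rightarrow> bool" where
  "Alg_isomorphic X c T A U B \<longleftrightarrow>
     (\<exists>M N. Alg_morphism X c T A U B M \<and> Alg_morphism X c U B T A N \<and>
        functor_eq T (comp_vfun N M) (id_vfun T) \<and> functor_eq U (comp_vfun M N) (id_vfun U))"


section \<open>Commutants and bifold algebras\<close>

definition commutant_theory ::
    "('o, 'a) vtheory \<Rightarrow> ('y, 'o, 'a, 'n) cvcat_scheme \<Rightarrow> ('o, 'y, 'a) vfun \<Rightarrow> ('o, 'a) vtheory" where
  "commutant_theory T X A = theory_of_structure
     \<lparr>EOb = Job V,
      EHom = (\<lambda>J K. EHom (alg_vcat T X) (cot_vfun X J A) (cot_vfun X K A)),
      EComp = (\<lambda>J K L. EComp (alg_vcat T X) (cot_vfun X J A) (cot_vfun X K A) (cot_vfun X L A)),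
      EId = (\<lambda>J. EId (alg_vcat T X) (cot_vfun X J A))\<rparr>
     (\<lambda>J. nat_lift T X (cot_vfun X J A) (cot_vfun X (Unit V) A) J (\<lambda>L. Ctu X J (FO A L)))"

definition commutant ::
    "('o, 'a) vtheory \<Rightarrow> ('y, 'o, 'a, 'n) cvcat_scheme \<Rightarrow> ('o, 'y, 'a) vfun \<Rightarrow> ('o, 'y, 'a) vfun" where
  "commutant T X A =
     \<lparr>FO = (\<lambda>J. Cot X J (FO A (Unit V))),
      FH = (\<lambda>J K. nat_proj T X (cot_vfun X J A) (cot_vfun X K A) (Unit V))\<rparr>"

definition commutes ::
    "('y, 'o, 'a, 'n) cvcat_scheme \<Rightarrow> 'y \<Rightarrow> ('o, 'a) vtheory \<Rightarrow> ('o, 'y, 'a) vfun \<Rightarrow>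
     ('o, 'a) vtheory \<Rightarrow> ('o, 'y, 'a) vfun \<Rightarrow> bool" where
  "commutes X c T A U B \<longleftrightarrow>
     (\<exists>M. Alg_morphism X c U B (commutant_theory T X A) (commutant T X A) M)"

definition commutative ::
    "('y, 'o, 'a, 'n) cvcat_scheme \<Rightarrow> ('o, 'a) vtheory \<Rightarrow> ('o, 'y, 'a) vfun \<Rightarrow> bool" where
  "commutative X T A \<longleftrightarrow> commutes X (FO A (Unit V)) T A T A"

definition theory_morphisms_commute ::
    "('o, 'a) vtheory \<Rightarrow> ('o, 'a) vtheory \<Rightarrow> ('o, 'a) vtheory \<Rightarrow>
     ('o, 'o, 'a) vfun \<Rightarrow> ('o, 'o, 'a) vfun \<Rightarrow> bool" where
  "theory_morphisms_commute T U S M N \<longleftrightarrow> theory_morphism T S M \<and> theory_morphism U S N \<and>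
     (\<exists>P. theory_morphism U (commutant_theory T (theory_cvcat S) M) P \<and>
        functor_eq U (comp_vfun (commutant T (theory_cvcat S) M) P) N)"

definition central :: "('o, 'a) vtheory \<Rightarrow> ('o, 'a) vtheory \<Rightarrow> ('o, 'o, 'a) vfun \<Rightarrow> bool" where
  "central T U M \<longleftrightarrow> theory_morphisms_commute T U U M (id_vfun U)"

definition bifold_algebra ::
    "('o, 'a) vtheory \<Rightarrow> ('o, 'a) vtheory \<Rightarrow> ('y, 'o, 'a, 'n) vcat_scheme \<Rightarrow>
     ('o \<times> 'o, 'y, 'a) vfun \<Rightarrow> bool" where
  "bifold_algebra T U X D \<longleftrightarrow> vfunctor (tensor_vcat T U) X D \<and>
     (\<forall>K \<in> EOb U. preserves_cotensors T X (partial_left T U D K)) \<and>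
     (\<forall>J \<in> EOb T. preserves_cotensors U X (partial_right T U D J))"

definition carrier :: "('o \<times> 'o, 'y, 'a) vfun \<Rightarrow> 'y" where
  "carrier D = FO D (Unit V, Unit V)"

definition left_face ::
    "('o, 'a) vtheory \<Rightarrow> ('o, 'a) vtheory \<Rightarrow> ('o \<times> 'o, 'y, 'a) vfun \<Rightarrow> ('o, 'y, 'a) vfun" where
  "left_face T U D = partial_left T U D (Unit V)"

definition right_face ::
    "('o, 'a) vtheory \<Rightarrow> ('o, 'a) vtheory \<Rightarrow> ('o \<times> 'o, 'y, 'a) vfun \<Rightarrow> ('o, 'y, 'a) vfun" where
  "right_face T U D = partial_right T U D (Unit V)"

definition right_commutant ::
    "('o, 'a) vtheory \<Rightarrow> ('o, 'a) vtheory \<Rightarrow> ('y, 'o, 'a, 'n) cvcat_scheme \<Rightarrow>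
     ('o \<times> 'o, 'y, 'a) vfun \<Rightarrow> bool" where
  "right_commutant T U X D \<longleftrightarrow>
     Alg_isomorphic X (carrier D) U (right_face T U D)
       (commutant_theory T X (left_face T U D)) (commutant T X (left_face T U D))"

end

end

theory Submission
  imports Defs
begin

text \<open>
  Evaluation at \<open>I\<close> is monic on natural families between algebras, because each \<open>L\<close> is a cotensor
  \<open>[L,I]\<close> in a theory. So \<open>B = D\<^sub>r\<close>, being isomorphic to the commutant of \<open>A = D\<^sub>l\<close>, is faithful. A
  morphism \<open>M\<close> in \<open>Alg(C)\<close> carries an isomorphism \<open>A \<cong> BM\<close> that is determined by its component at \<open>I\<close>;
  hence \<open>M\<close> is unique, and it exists as the composite of \<open>T \<rightarrow> A\<^sup>\<bottom> \<cong> U\<close>.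

  By right-commutation an arrow \<open>u : J \<rightarrow> K\<close> of \<open>U\<close> induces a natural family \<open>[J,A] \<rightarrow> [K,A]\<close>. In \<open>U\<close> it
  induces arrows \<open>[J,L] \<rightarrow> [K,L]\<close>, determined by the projections \<open>L \<rightarrow> I\<close>. Transporting along \<open>A \<cong> BM\<close>
  identifies the image of the second under \<open>B\<close> with the first, so by faithfulness the second is
  natural in \<open>L\<close> with respect to \<open>M\<close>. By monicity of the evaluation at \<open>I\<close> this makes \<open>U(J,K)\<close> the object of
  natural transformations \<open>[J,M] \<rightarrow> [K,M]\<close>, which is centrality, and
  \<open>(L,J) \<mapsto> [J,ML]\<close> becomes the bifold algebra \<open>\<langle>M,1\<rangle>\<close>.
\<close>

section \<open>Coherence in symmetric monoidal categories\<close>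

text \<open>The base is not concrete, so elements with domain \<open>I\<close> do not suffice to
  test equations between arrows out of hom-objects. Calculations therefore run on elements with
  arbitrary domain, and every comparison of composites leaves a coherence isomorphism on the domain;
  hence the opening section on associators, units and symmetry.

  The chosen ends are universal only against objects of \<open>Vob\<close>. Faithfulness of
  \<open>B\<close> is thus restricted to domains in \<open>Vob\<close>; naturality in
  \<open>U\<close> is first proved for the universal elements \<open>gen\<close>, whose domains are
  hom-objects, and then carried to all elements by precomposition.

  The action of arrows of \<open>U\<close> is built in two stages: arrows
  \<open>J \<rightarrow> I\<close> act first, and an arrow \<open>J \<rightarrow> K\<close> is
  treated as a \<open>K\<close>-indexed family of these, since \<open>K = [K,I]\<close>.
  Compatibility of this action with composition in \<open>U\<close> is a consequence of naturality
  with respect to \<open>M\<close>, applied to the projections \<open>L \<rightarrow> I\<close>,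
  because \<open>M\<close> carries the projections of \<open>T\<close> to those of
  \<open>U\<close>.\<close>

lemma (in category) in_hom: "f \<in> Arr C \<Longrightarrow> f \<in> hom C (Dom C f) (Cod C f)"
  by (simp add: hom_def)

context category
begin

lemma Dom_Cod_Obj [simp]: "f \<in> Arr C \<Longrightarrow> Dom C f \<in> Obj C" "f \<in> Arr C \<Longrightarrow> Cod C f \<in> Obj C"
  using dom_cod by blast+

lemma Ident_simps [simp]:
  "x \<in> Obj C \<Longrightarrow> Ident C x \<in> Arr C" "x \<in> Obj C \<Longrightarrow> Dom C (Ident C x) = x"
  "x \<in> Obj C \<Longrightarrow> Cod C (Ident C x) = x"
  using ident[of x] by (simp_all add: hom_def)

lemma Comp_simps [simp]:
  assumes "f \<in> Arr C" "g \<in> Arr C" "Cod C f = Dom C g"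
  shows "g \<cdot> f \<in> Arr C" "Dom C (g \<cdot> f) = Dom C f" "Cod C (g \<cdot> f) = Cod C g"
  using comp[of f "Dom C f" "Cod C f" g "Cod C g"] assms by (simp_all add: hom_def)

text \<open>Typing conditions are stated through \<open>Dom\<close> and \<open>Cod\<close> instead
  of \<open>hom\<close>, so that the simplifier can discharge them. Composites are normalized to the
  right; for this reason several later facts also come in a form that is followed by a further
  arrow.\<close>

lemma Comp_assoc [simp]:
  "\<lbrakk>f \<in> Arr C; g \<in> Arr C; h \<in> Arr C; Cod C f = Dom C g; Cod C g = Dom C h\<rbrakk>
    \<Longrightarrow> h \<cdot> g \<cdot> f = h \<cdot> (g \<cdot> f)"
  using comp_assoc[of f _ _ g _ h] by (simp add: hom_def)

lemma Ident_left [simp]: "f \<in> Arr C \<Longrightarrow> Cod C f = x \<Longrightarrow> Ident C x \<cdot> f = f"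
  using ident_left[of f] by (simp add: hom_def)

lemma Ident_right [simp]: "f \<in> Arr C \<Longrightarrow> Dom C f = x \<Longrightarrow> f \<cdot> Ident C x = f"
  using ident_right[of f] by (simp add: hom_def)

lemma inverse_arr_eq:
  assumes "is_inverse C f g"
  shows "inverse_arr C f = g"
  unfolding inverse_arr_def
proof (rule the_equality)
  fix h assume h: "is_inverse C f h"
  have t: "f \<in> Arr C" "g \<in> Arr C" "h \<in> Arr C" "Dom C g = Cod C f" "Cod C g = Dom C f"
    "Dom C h = Cod C f" "Cod C h = Dom C f" "h \<cdot> f = Ident C (Dom C f)" "f \<cdot> g = Ident C (Cod C f)"
    using h assms by (auto simp: is_inverse_def hom_def)
  have "h = h \<cdot> (f \<cdot> g)" using t by (simp del: Comp_assoc)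
  also have "\<dots> = (h \<cdot> f) \<cdot> g" using t(1-7) by simp
  also have "\<dots> = g" using t by (simp del: Comp_assoc)
  finally show "h = g" .
qed (fact assms)

lemma inverse_arr_simps:
  assumes "iso C f" 
  shows "inverse_arr C f \<in> Arr C" "Dom C (inverse_arr C f) = Cod C f"
    "Cod C (inverse_arr C f) = Dom C f"
    "inverse_arr C f \<cdot> f = Ident C (Dom C f)" "f \<cdot> inverse_arr C f = Ident C (Cod C f)"
proof -
  have f: "f \<in> Arr C" using assms by (auto simp: iso_def is_inverse_def)
  have "is_inverse C f (inverse_arr C f)"
    using assms inverse_arr_eq by (metis iso_def)
  then show "inverse_arr C f \<in> Arr C" "Dom C (inverse_arr C f) = Cod C f"
    "Cod C (inverse_arr C f) = Dom C f"
    "inverse_arr C f \<cdot> f = Ident C (Dom C f)" "f \<cdot> inverse_arr C f = Ident C (Cod C f)"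
    by (auto simp: is_inverse_def hom_def)
qed

lemma iso_cancel_left:
  assumes "iso C g" "f \<in> Arr C" "f' \<in> Arr C" "Cod C f = Dom C g" "Cod C f' = Dom C g" "g \<cdot> f = g \<cdot> f'"
  shows "f = f'"
proof -
  have g: "g \<in> Arr C" using assms by (auto simp: iso_def is_inverse_def)
  note i = inverse_arr_simps[OF assms(1)]
  have "(inverse_arr C g \<cdot> g) \<cdot> f = (inverse_arr C g \<cdot> g) \<cdot> f'"
    using assms g i(1-3) by simp
  then show ?thesis using assms i by simp
qed

lemma iso_cancel_right:
  assumes "iso C g" "f \<in> Arr C" "f' \<in> Arr C" "Dom C f = Cod C g" "Dom C f' = Cod C g" "f \<cdot> g = f' \<cdot> g"
  shows "f = f'"
proof -
  have g: "g \<in> Arr C" using assms by (auto simp: iso_def is_inverse_def)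
  note i = inverse_arr_simps[OF assms(1)]
  have "f \<cdot> (g \<cdot> inverse_arr C g) = f' \<cdot> (g \<cdot> inverse_arr C g)"
    using assms g i(1-3) Comp_assoc by metis
  then show ?thesis using assms i by simp
qed

end

section \<open>Symmetric monoidal closed categories and their coherence laws\<close>

context smc_category
begin

lemma Unit_Obj [simp]: "Unit V \<in> Obj V" by (rule unit)

lemma Tens_Obj [simp]: "a \<in> Obj V \<Longrightarrow> b \<in> Obj V \<Longrightarrow> a \<otimes> b \<in> Obj V" by (rule tens)

lemma TensA_simps [simp]:
  assumes "f \<in> Arr V" "g \<in> Arr V"
  shows "f \<odot> g \<in> Arr V" "Dom V (f \<odot> g) = Dom V f \<otimes> Dom V g" "Cod V (f \<odot> g) = Cod V f \<otimes> Cod V g"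
  using tens_arr[OF in_hom in_hom, of f g] assms by (simp_all add: hom_def)

lemma Ident_tens [simp]: "a \<in> Obj V \<Longrightarrow> b \<in> Obj V \<Longrightarrow> Ident V a \<odot> Ident V b = Ident V (a \<otimes> b)"
  by (rule tens_ident)

lemma interchange [simp]:
  assumes "f \<in> Arr V" "g \<in> Arr V" "f' \<in> Arr V" "g' \<in> Arr V" "Cod V f = Dom V g" "Cod V f' = Dom V g'"
  shows "(g \<odot> g') \<cdot> (f \<odot> f') = (g \<cdot> f) \<odot> (g' \<cdot> f')"
  using tens_comp[of f "Dom V f" "Dom V g" g "Cod V g" f' "Dom V f'" "Dom V g'" g' "Cod V g'"] assms
  by (simp add: hom_def)

text \<open>In a right-nested composite the two tensors are separated by the bracket around the tail
  \<open>h\<close>, where \<open>interchange\<close> itself does not match.\<close>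

lemma interchange_left [simp]:
  assumes "f \<in> Arr V" "g \<in> Arr V" "f' \<in> Arr V" "g' \<in> Arr V" "Cod V f = Dom V g" "Cod V f' = Dom V g'"
    "h \<in> Arr V" "Cod V h = Dom V f \<otimes> Dom V f'"
  shows "(g \<odot> g') \<cdot> ((f \<odot> f') \<cdot> h) = ((g \<cdot> f) \<odot> (g' \<cdot> f')) \<cdot> h"
  using Comp_assoc[of h "f \<odot> f'" "g \<odot> g'"] assms by simp

abbreviation "Assoc' a b c \<equiv> inverse_arr V (Assoc V a b c)"
abbreviation "Lun' a \<equiv> inverse_arr V (Lun V a)"
abbreviation "Run' a \<equiv> inverse_arr V (Run V a)"

lemma Assoc_simps [simp]:
  assumes "a \<in> Obj V" "b \<in> Obj V" "c \<in> Obj V"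
  shows "Assoc V a b c \<in> Arr V" "Dom V (Assoc V a b c) = (a \<otimes> b) \<otimes> c"
    "Cod V (Assoc V a b c) = a \<otimes> (b \<otimes> c)" "iso V (Assoc V a b c)"
    "Assoc' a b c \<in> Arr V" "Dom V (Assoc' a b c) = a \<otimes> (b \<otimes> c)"
    "Cod V (Assoc' a b c) = (a \<otimes> b) \<otimes> c"
    "Assoc' a b c \<cdot> Assoc V a b c = Ident V ((a \<otimes> b) \<otimes> c)"
    "Assoc V a b c \<cdot> Assoc' a b c = Ident V (a \<otimes> (b \<otimes> c))"
  using assoc[OF assms] inverse_arr_simps[of "Assoc V a b c"] by (auto simp: hom_def)

lemma Lun_simps [simp]:
  assumes "a \<in> Obj V"
  shows "Lun V a \<in> Arr V" "Dom V (Lun V a) = Unit V \<otimes> a" "Cod V (Lun V a) = a" "iso V (Lun V a)"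
    "Lun' a \<in> Arr V" "Dom V (Lun' a) = a" "Cod V (Lun' a) = Unit V \<otimes> a"
    "Lun' a \<cdot> Lun V a = Ident V (Unit V \<otimes> a)" "Lun V a \<cdot> Lun' a = Ident V a"
  using lun[OF assms] inverse_arr_simps[of "Lun V a"] by (auto simp: hom_def)

lemma Run_simps [simp]:
  assumes "a \<in> Obj V"
  shows "Run V a \<in> Arr V" "Dom V (Run V a) = a \<otimes> Unit V" "Cod V (Run V a) = a" "iso V (Run V a)"
    "Run' a \<in> Arr V" "Dom V (Run' a) = a" "Cod V (Run' a) = a \<otimes> Unit V"
    "Run' a \<cdot> Run V a = Ident V (a \<otimes> Unit V)" "Run V a \<cdot> Run' a = Ident V a"
  using run[OF assms] inverse_arr_simps[of "Run V a"] by (auto simp: hom_def)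

lemma Swap_simps [simp]:
  assumes "a \<in> Obj V" "b \<in> Obj V"
  shows "Swap V a b \<in> Arr V" "Dom V (Swap V a b) = a \<otimes> b" "Cod V (Swap V a b) = b \<otimes> a"
    "Swap V b a \<cdot> Swap V a b = Ident V (a \<otimes> b)" "iso V (Swap V a b)"
  using swap[OF assms] swap[OF assms(2,1)] swap_swap[OF assms] swap_swap[OF assms(2,1)]
  by (auto simp: hom_def iso_def is_inverse_def intro!: exI[of _ "Swap V b a"])

lemma IHom_simps [simp]:
  assumes "b \<in> Obj V" "c \<in> Obj V"
  shows "IHom V b c \<in> Obj V" "Ev V b c \<in> Arr V" "Dom V (Ev V b c) = IHom V b c \<otimes> b"
    "Cod V (Ev V b c) = c"
  using ihom[OF assms] by (auto simp: hom_def)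

lemma structure_cancel [simp]:
  assumes "f \<in> Arr V"
  shows "a \<in> Obj V \<Longrightarrow> b \<in> Obj V \<Longrightarrow> c \<in> Obj V \<Longrightarrow> Cod V f = (a \<otimes> b) \<otimes> c
      \<Longrightarrow> Assoc' a b c \<cdot> (Assoc V a b c \<cdot> f) = f"
    "a \<in> Obj V \<Longrightarrow> b \<in> Obj V \<Longrightarrow> c \<in> Obj V \<Longrightarrow> Cod V f = a \<otimes> (b \<otimes> c)
      \<Longrightarrow> Assoc V a b c \<cdot> (Assoc' a b c \<cdot> f) = f"
    "a \<in> Obj V \<Longrightarrow> b \<in> Obj V \<Longrightarrow> Cod V f = a \<otimes> b \<Longrightarrow> Swap V b a \<cdot> (Swap V a b \<cdot> f) = f"
    "a \<in> Obj V \<Longrightarrow> Cod V f = Unit V \<otimes> a \<Longrightarrow> Lun' a \<cdot> (Lun V a \<cdot> f) = f"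
    "a \<in> Obj V \<Longrightarrow> Cod V f = a \<Longrightarrow> Lun V a \<cdot> (Lun' a \<cdot> f) = f"
    "a \<in> Obj V \<Longrightarrow> Cod V f = a \<otimes> Unit V \<Longrightarrow> Run' a \<cdot> (Run V a \<cdot> f) = f"
    "a \<in> Obj V \<Longrightarrow> Cod V f = a \<Longrightarrow> Run V a \<cdot> (Run' a \<cdot> f) = f"
  using Comp_assoc[of f "Assoc V a b c" "Assoc' a b c"] Comp_assoc[of f "Assoc' a b c" "Assoc V a b c"]
    Comp_assoc[of f "Swap V a b" "Swap V b a"]
    Comp_assoc[of f "Lun V a" "Lun' a"] Comp_assoc[of f "Lun' a" "Lun V a"]
    Comp_assoc[of f "Run V a" "Run' a"] Comp_assoc[of f "Run' a" "Run V a"] assms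
  by simp_all

lemma Assoc_nat:
  assumes "f \<in> Arr V" "g \<in> Arr V" "h \<in> Arr V" "a = Cod V f" "b = Cod V g" "c = Cod V h"
  shows "Assoc V a b c \<cdot> ((f \<odot> g) \<odot> h) = (f \<odot> (g \<odot> h)) \<cdot> Assoc V (Dom V f) (Dom V g) (Dom V h)"
  using assoc_natural[OF assms(1-3)[THEN in_hom]] assms(4-6) by simp

lemma Lun_nat: "f \<in> Arr V \<Longrightarrow> b = Cod V f \<Longrightarrow> Lun V b \<cdot> (Ident V (Unit V) \<odot> f) = f \<cdot> Lun V (Dom V f)"
  using lun_natural[OF in_hom, of f] by simp

lemma Run_nat: "f \<in> Arr V \<Longrightarrow> b = Cod V f \<Longrightarrow> Run V b \<cdot> (f \<odot> Ident V (Unit V)) = f \<cdot> Run V (Dom V f)"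
  using run_natural[OF in_hom, of f] by simp

lemma Swap_nat:
  "f \<in> Arr V \<Longrightarrow> g \<in> Arr V \<Longrightarrow> a = Cod V f \<Longrightarrow> b = Cod V g
    \<Longrightarrow> Swap V a b \<cdot> (f \<odot> g) = (g \<odot> f) \<cdot> Swap V (Dom V f) (Dom V g)"
  using swap_natural[OF in_hom in_hom, of f g] by simp

text \<open>\<open>I \<otimes> -\<close> is naturally isomorphic to the identity by
  \<open>Lun\<close>. The coherence proofs below establish an equation after tensoring with
  \<open>I\<close> and then cancel.\<close>

lemma Unit_left_faithful:
  assumes "f \<in> Arr V" "g \<in> Arr V" "Dom V f = Dom V g" "Cod V f = Cod V g"
    "Ident V (Unit V) \<odot> f = Ident V (Unit V) \<odot> g"
  shows "f = g"
proof -
  have "f \<cdot> Lun V (Dom V g) = g \<cdot> Lun V (Dom V g)"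
    using Lun_nat[of f "Cod V f"] Lun_nat[of g "Cod V g"] assms by simp
  then show ?thesis by (rule iso_cancel_right[rotated -1]) (simp_all add: assms)
qed

lemma Unit_right_faithful:
  assumes "f \<in> Arr V" "g \<in> Arr V" "Dom V f = Dom V g" "Cod V f = Cod V g"
    "f \<odot> Ident V (Unit V) = g \<odot> Ident V (Unit V)"
  shows "f = g"
proof -
  have "f \<cdot> Run V (Dom V g) = g \<cdot> Run V (Dom V g)"
    using Run_nat[of f "Cod V f"] Run_nat[of g "Cod V g"] assms by simp
  then show ?thesis by (rule iso_cancel_right[rotated -1]) (simp_all add: assms)
qed

lemma isoI:
  "\<lbrakk>f \<in> Arr V; g \<in> Arr V; Dom V g = Cod V f; Cod V g = Dom V f; g \<cdot> f = Ident V (Dom V f);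
    f \<cdot> g = Ident V (Cod V f)\<rbrakk> \<Longrightarrow> iso V f"
  unfolding iso_def is_inverse_def hom_def by blast

lemma iso_Arr: "iso V f \<Longrightarrow> f \<in> Arr V"
  unfolding iso_def is_inverse_def by blast

text \<open>Replaces rewriting with \<open>g \<cdot> f = k\<close> inside a right-nested composite,
  where \<open>g \<cdot> f\<close> is not a subterm.\<close>

lemma comp_extend:
  "\<lbrakk>g \<cdot> f = k; f \<in> Arr V; g \<in> Arr V; h \<in> Arr V; Cod V f = Dom V g; Cod V h = Dom V f\<rbrakk>
    \<Longrightarrow> g \<cdot> (f \<cdot> h) = k \<cdot> h"
  using Comp_assoc[of h f g] by simp

lemma Assoc_nat_extend:
  assumes "f \<in> Arr V" "g \<in> Arr V" "h \<in> Arr V" "a = Cod V f" "b = Cod V g" "c = Cod V h"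
    "p \<in> Arr V" "Cod V p = (Dom V f \<otimes> Dom V g) \<otimes> Dom V h"
  shows "Assoc V a b c \<cdot> (((f \<odot> g) \<odot> h) \<cdot> p)
    = (f \<odot> (g \<odot> h)) \<cdot> (Assoc V (Dom V f) (Dom V g) (Dom V h) \<cdot> p)"
  using comp_extend[OF Assoc_nat[OF assms(1-6)], of p] assms by simp

lemma iso_tens:
  assumes "iso V f" "iso V g"
  shows "iso V (f \<odot> g)"
  using iso_Arr[OF assms(1)] iso_Arr[OF assms(2)] inverse_arr_simps[OF assms(1)] inverse_arr_simps[OF assms(2)]
  by (intro isoI[of _ "inverse_arr V f \<odot> inverse_arr V g"]) simp_all

lemma iso_Ident: "a \<in> Obj V \<Longrightarrow> iso V (Ident V a)"
  by (rule isoI[of _ "Ident V a"]) simp_all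

lemma iso_comp:
  assumes "iso V f" "iso V g" "Cod V f = Dom V g"
  shows "iso V (g \<cdot> f)"
proof -
  have fg: "f \<in> Arr V" "g \<in> Arr V" using assms by (simp_all add: iso_Arr)
  note i = inverse_arr_simps[OF assms(1)] inverse_arr_simps[OF assms(2)]
  have "inverse_arr V g \<cdot> (g \<cdot> f) = f"
    using Comp_assoc[of f g "inverse_arr V g"] fg i assms(3) by simp
  moreover have "f \<cdot> (inverse_arr V f \<cdot> inverse_arr V g) = inverse_arr V g"
    using Comp_assoc[of "inverse_arr V g" "inverse_arr V f" f] fg i assms(3) by simp
  ultimately show ?thesis using fg i assms(3)
    by (intro isoI[of _ "inverse_arr V f \<cdot> inverse_arr V g"]) simp_all
qed

text \<open>Kelly's argument: the pentagon at \<open>I, I, a, b\<close> and two triangles identify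
  both sides after tensoring with \<open>I\<close> and composing with an isomorphism, and
  \<open>I \<otimes> -\<close> is faithful.\<close>

lemma Lun_tens:
  assumes [simp]: "a \<in> Obj V" "b \<in> Obj V"
  shows "Lun V (a \<otimes> b) \<cdot> Assoc V (Unit V) a b = Lun V a \<odot> Ident V b"
proof -
  let ?I = "Unit V" and ?id = "Ident V"
  let ?X = "Assoc V ?I (?I \<otimes> a) b \<cdot> (Assoc V ?I ?I a \<odot> ?id b)"
  have "(?id ?I \<odot> (Lun V (a \<otimes> b) \<cdot> Assoc V ?I a b)) \<cdot> ?X
      = (?id ?I \<odot> Lun V (a \<otimes> b)) \<cdot> (Assoc V ?I ?I (a \<otimes> b) \<cdot> Assoc V (?I \<otimes> ?I) a b)"
    using pentagon[of ?I ?I a b] interchange_left[of "?id ?I" "?id ?I" "Assoc V ?I a b" "Lun V (a \<otimes> b)" ?X]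
    by simp
  also have "\<dots> = (Run V ?I \<odot> ?id (a \<otimes> b)) \<cdot> Assoc V (?I \<otimes> ?I) a b"
    using triangle[of ?I "a \<otimes> b"] Comp_assoc[of "Assoc V (?I \<otimes> ?I) a b" "Assoc V ?I ?I (a \<otimes> b)" "?id ?I \<odot> Lun V (a \<otimes> b)"]
    by simp
  also have "\<dots> = Assoc V ?I a b \<cdot> ((Run V ?I \<odot> ?id a) \<odot> ?id b)"
    by (simp add: Assoc_nat)
  also have "\<dots> = Assoc V ?I a b \<cdot> (((?id ?I \<odot> Lun V a) \<odot> ?id b) \<cdot> (Assoc V ?I ?I a \<odot> ?id b))"
    using triangle[of ?I a] by simp
  also have "\<dots> = (Assoc V ?I a b \<cdot> ((?id ?I \<odot> Lun V a) \<odot> ?id b)) \<cdot> (Assoc V ?I ?I a \<odot> ?id b)"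
    by simp
  also have "\<dots> = (?id ?I \<odot> (Lun V a \<odot> ?id b)) \<cdot> ?X"
    by (simp add: Assoc_nat)
  finally have "?id ?I \<odot> (Lun V (a \<otimes> b) \<cdot> Assoc V ?I a b) = ?id ?I \<odot> (Lun V a \<odot> ?id b)"
    by (rule iso_cancel_right[rotated -1]) (simp_all add: iso_comp iso_tens iso_Ident)
  then show ?thesis by (rule Unit_left_faithful[rotated -1]) simp_all
qed

text \<open>The pentagon at \<open>a, b, I, I\<close> and two triangles identify both sides after
  tensoring with \<open>I\<close> on the right and composing with the associator.\<close>

lemma Run_tens:
  assumes [simp]: "a \<in> Obj V" "b \<in> Obj V"
  shows "(Ident V a \<odot> Run V b) \<cdot> Assoc V a b (Unit V) = Run V (a \<otimes> b)"
proof -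
  let ?I = "Unit V" and ?id = "Ident V"
  let ?p = "Assoc V a b ?I \<odot> ?id ?I"
  have "Assoc V a b ?I \<cdot> (((?id a \<odot> Run V b) \<odot> ?id ?I) \<cdot> ?p)
      = (?id a \<odot> (Run V b \<odot> ?id ?I)) \<cdot> (Assoc V a (b \<otimes> ?I) ?I \<cdot> ?p)"
    by (subst Assoc_nat_extend) simp_all
  also have "\<dots> = (?id a \<odot> ((?id b \<odot> Lun V ?I) \<cdot> Assoc V b ?I ?I)) \<cdot> (Assoc V a (b \<otimes> ?I) ?I \<cdot> ?p)"
    by (subst triangle) simp_all
  also have "\<dots> = (?id a \<odot> (?id b \<odot> Lun V ?I)) \<cdot> ((?id a \<odot> Assoc V b ?I ?I) \<cdot> (Assoc V a (b \<otimes> ?I) ?I \<cdot> ?p))"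
    by (subst interchange_left) simp_all
  also have "\<dots> = (?id a \<odot> (?id b \<odot> Lun V ?I)) \<cdot> (Assoc V a b (?I \<otimes> ?I) \<cdot> Assoc V (a \<otimes> b) ?I ?I)"
    using pentagon[of a b ?I ?I] by simp
  also have "\<dots> = Assoc V a b ?I \<cdot> (((?id a \<odot> ?id b) \<odot> Lun V ?I) \<cdot> Assoc V (a \<otimes> b) ?I ?I)"
    by (subst Assoc_nat_extend) simp_all
  also have "\<dots> = Assoc V a b ?I \<cdot> (Run V (a \<otimes> b) \<odot> ?id ?I)"
    using triangle[of "a \<otimes> b" ?I] by simp
  finally have "((?id a \<odot> Run V b) \<odot> ?id ?I) \<cdot> ?p = Run V (a \<otimes> b) \<odot> ?id ?I"
    by (rule iso_cancel_left[rotated -1]) simp_all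
  then have "((?id a \<odot> Run V b) \<cdot> Assoc V a b ?I) \<odot> ?id ?I = Run V (a \<otimes> b) \<odot> ?id ?I"
    by simp
  then show ?thesis by (rule Unit_right_faithful[rotated -1]) simp_all
qed

text \<open>Naturality of \<open>Lun\<close> at its own component gives
  \<open>I \<otimes> Lun I = Lun (I \<otimes> I)\<close>; \<open>Lun_tens\<close> and the triangle
  then compare the two arrows after tensoring with \<open>I\<close>.\<close>

lemma Lun_Unit: "Lun V (Unit V) = Run V (Unit V)"
proof -
  let ?I = "Unit V" and ?id = "Ident V"
  have "Lun V ?I \<cdot> (?id ?I \<odot> Lun V ?I) = Lun V ?I \<cdot> Lun V (?I \<otimes> ?I)"
    by (simp add: Lun_nat)
  then have "?id ?I \<odot> Lun V ?I = Lun V (?I \<otimes> ?I)"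
    by (rule iso_cancel_left[rotated -1]) simp_all
  then have "Lun V ?I \<odot> ?id ?I = Run V ?I \<odot> ?id ?I"
    using Lun_tens[of ?I ?I] triangle[of ?I ?I] by simp
  then show ?thesis by (rule Unit_right_faithful[rotated -1]) simp_all
qed

text \<open>The hexagon at \<open>a, I, I\<close> contains \<open>Swap a I\<close> twice. One
  occurrence is cancelled together with the extra factor \<open>I\<close>, and the other one remains
  in the claim.\<close>

lemma Lun_Swap:
  assumes [simp]: "a \<in> Obj V"
  shows "Lun V a \<cdot> Swap V a (Unit V) = Run V a"
proof -
  let ?I = "Unit V" and ?id = "Ident V"
  have "Swap V a ?I \<cdot> (Run V a \<odot> ?id ?I) = Swap V a ?I \<cdot> ((?id a \<odot> Lun V ?I) \<cdot> Assoc V a ?I ?I)"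
    using triangle[of a ?I] by simp
  also have "\<dots> = (Swap V a ?I \<cdot> (?id a \<odot> Lun V ?I)) \<cdot> Assoc V a ?I ?I"
    by simp
  also have "\<dots> = (Lun V (?I \<otimes> a) \<cdot> Assoc V ?I ?I a) \<cdot> (Swap V a (?I \<otimes> ?I) \<cdot> Assoc V a ?I ?I)"
    by (simp add: Swap_nat Lun_tens del: Comp_assoc) simp
  also have "\<dots> = Lun V (?I \<otimes> a) \<cdot> (Assoc V ?I ?I a \<cdot> (Swap V a (?I \<otimes> ?I) \<cdot> Assoc V a ?I ?I))"
    by simp
  also have "\<dots> = Lun V (?I \<otimes> a) \<cdot> ((?id ?I \<odot> Swap V a ?I) \<cdot> (Assoc V ?I a ?I \<cdot> (Swap V a ?I \<odot> ?id ?I)))"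
    using hexagon[of a ?I ?I] by simp
  also have "\<dots> = (Lun V (?I \<otimes> a) \<cdot> (?id ?I \<odot> Swap V a ?I)) \<cdot> (Assoc V ?I a ?I \<cdot> (Swap V a ?I \<odot> ?id ?I))"
    by simp
  also have "\<dots> = Swap V a ?I \<cdot> ((Lun V (a \<otimes> ?I) \<cdot> Assoc V ?I a ?I) \<cdot> (Swap V a ?I \<odot> ?id ?I))"
    by (simp add: Lun_nat)
  also have "\<dots> = Swap V a ?I \<cdot> ((Lun V a \<cdot> Swap V a ?I) \<odot> ?id ?I)"
    by (simp add: Lun_tens del: Comp_assoc)
  finally have "Run V a \<odot> ?id ?I = (Lun V a \<cdot> Swap V a ?I) \<odot> ?id ?I"
    by (rule iso_cancel_left[rotated -1]) simp_all
  then show ?thesis by (rule Unit_right_faithful[rotated -1, OF sym]) simp_all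
qed

lemma Run_Swap: "a \<in> Obj V \<Longrightarrow> Run V a \<cdot> Swap V (Unit V) a = Lun V a"
  by (simp flip: Lun_Swap)

lemma Swap_Lun':
  assumes [simp]: "a \<in> Obj V"
  shows "Swap V (Unit V) a \<cdot> Lun' a = Run' a"
proof (rule iso_cancel_left[of "Run V a"])
  show "Run V a \<cdot> (Swap V (Unit V) a \<cdot> Lun' a) = Run V a \<cdot> Run' a"
    by (subst comp_extend[OF Run_Swap]) simp_all
qed simp_all

lemma Assoc_Lun':
  assumes [simp]: "a \<in> Obj V" "b \<in> Obj V"
  shows "Assoc V (Unit V) a b \<cdot> (Lun' a \<odot> Ident V b) = Lun' (a \<otimes> b)"
proof (rule iso_cancel_left[of "Lun V (a \<otimes> b)"])
  show "Lun V (a \<otimes> b) \<cdot> (Assoc V (Unit V) a b \<cdot> (Lun' a \<odot> Ident V b)) = Lun V (a \<otimes> b) \<cdot> Lun' (a \<otimes> b)"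
    using Comp_assoc[of "Lun' a \<odot> Ident V b" "Assoc V (Unit V) a b" "Lun V (a \<otimes> b)"]
    by (simp add: Lun_tens)
qed simp_all

lemma Assoc_Run':
  assumes [simp]: "a \<in> Obj V" "b \<in> Obj V"
  shows "Assoc V a b (Unit V) \<cdot> Run' (a \<otimes> b) = Ident V a \<odot> Run' b"
proof (rule iso_cancel_left[of "Ident V a \<odot> Run V b"])
  show "(Ident V a \<odot> Run V b) \<cdot> (Assoc V a b (Unit V) \<cdot> Run' (a \<otimes> b)) = (Ident V a \<odot> Run V b) \<cdot> (Ident V a \<odot> Run' b)"
    using Comp_assoc[of "Run' (a \<otimes> b)" "Assoc V a b (Unit V)" "Ident V a \<odot> Run V b"]
    by (simp add: Run_tens)
qed (simp_all add: iso_tens iso_Ident)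

lemma Assoc_Run'_Lun':
  assumes [simp]: "a \<in> Obj V" "b \<in> Obj V"
  shows "Assoc V a (Unit V) b \<cdot> (Run' a \<odot> Ident V b) = Ident V a \<odot> Lun' b"
proof (rule iso_cancel_left[of "Ident V a \<odot> Lun V b"])
  show "(Ident V a \<odot> Lun V b) \<cdot> (Assoc V a (Unit V) b \<cdot> (Run' a \<odot> Ident V b)) = (Ident V a \<odot> Lun V b) \<cdot> (Ident V a \<odot> Lun' b)"
    using triangle[of a b] Comp_assoc[of "Run' a \<odot> Ident V b" "Assoc V a (Unit V) b" "Ident V a \<odot> Lun V b"]
    by simp
qed (simp_all add: iso_tens iso_Ident)

text \<open>This is the inner factor of \<open>middle_four\<close>. It is the domain change caused
  by exchanging the first two of three composed elements in right-nested form.\<close>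

definition exch :: "'o \<Rightarrow> 'o \<Rightarrow> 'o \<Rightarrow> 'a" where
  "exch a b c = Assoc V b a c \<cdot> ((Swap V a b \<odot> Ident V c) \<cdot> Assoc' a b c)"

lemma exch_simps [simp]:
  assumes "a \<in> Obj V" "b \<in> Obj V" "c \<in> Obj V"
  shows "exch a b c \<in> Arr V" "Dom V (exch a b c) = a \<otimes> (b \<otimes> c)" "Cod V (exch a b c) = b \<otimes> (a \<otimes> c)"
    "exch b a c \<cdot> exch a b c = Ident V (a \<otimes> (b \<otimes> c))" "iso V (exch a b c)"
proof -
  have 1: "exch a b c \<in> Arr V" "Dom V (exch a b c) = a \<otimes> (b \<otimes> c)" "Cod V (exch a b c) = b \<otimes> (a \<otimes> c)"
    "exch b a c \<cdot> exch a b c = Ident V (a \<otimes> (b \<otimes> c))"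
    if "a \<in> Obj V" "b \<in> Obj V" "c \<in> Obj V" for a b c
    using that by (simp_all add: exch_def)
  show "exch a b c \<in> Arr V" "Dom V (exch a b c) = a \<otimes> (b \<otimes> c)" "Cod V (exch a b c) = b \<otimes> (a \<otimes> c)"
    "exch b a c \<cdot> exch a b c = Ident V (a \<otimes> (b \<otimes> c))"
    using assms by (simp_all add: 1)
  show "iso V (exch a b c)"
    using assms by (intro isoI[of _ "exch b a c"]) (simp_all add: 1)
qed

text \<open>The hexagon, solved for the symmetry past a product: \<open>a\<close> passes
  \<open>b\<close> and then \<open>c\<close>. Two consecutive exchanges of elements thereby combine
  into one.\<close>

lemma Swap_tens_right:
  assumes [simp]: "a \<in> Obj V" "b \<in> Obj V" "c \<in> Obj V"
  shows "Assoc' b c a \<cdot> ((Ident V b \<odot> Swap V a c) \<cdot> exch a b c) = Swap V a (b \<otimes> c)"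
proof -
  have "(Ident V b \<odot> Swap V a c) \<cdot> exch a b c
      = ((Ident V b \<odot> Swap V a c) \<cdot> Assoc V b a c \<cdot> (Swap V a b \<odot> Ident V c)) \<cdot> Assoc' a b c"
    by (simp add: exch_def)
  also have "\<dots> = Assoc V b c a \<cdot> Swap V a (b \<otimes> c)"
    by (subst hexagon[symmetric]) simp_all
  finally show ?thesis by simp
qed

lemma exch_cancel [simp]:
  "\<lbrakk>a \<in> Obj V; b \<in> Obj V; c \<in> Obj V; f \<in> Arr V; Cod V f = a \<otimes> (b \<otimes> c)\<rbrakk>
    \<Longrightarrow> exch b a c \<cdot> (exch a b c \<cdot> f) = f"
  using Comp_assoc[of f "exch a b c" "exch b a c"] by simp

text \<open>The mirror hexagon. Since a symmetry is inverse to the opposite one, it reduces to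
  \<open>Swap_tens_right\<close> at \<open>c, a, b\<close>.\<close>

lemma Swap_tens_left:
  assumes [simp]: "a \<in> Obj V" "b \<in> Obj V" "c \<in> Obj V"
  shows "Swap V (a \<otimes> b) c \<cdot> Assoc' a b c = exch a c b \<cdot> (Ident V a \<odot> Swap V b c)"
proof (rule iso_cancel_left[of "Swap V c (a \<otimes> b)"])
  show "Swap V c (a \<otimes> b) \<cdot> (Swap V (a \<otimes> b) c \<cdot> Assoc' a b c)
    = Swap V c (a \<otimes> b) \<cdot> (exch a c b \<cdot> (Ident V a \<odot> Swap V b c))"
    by (subst Swap_tens_right[of c a b, symmetric]) simp_all
qed simp_all

end

section \<open>Generalized elements\<close>

text \<open>A generalized element of \<open>X(x,y)\<close> with domain \<open>W\<close> is an arrow \<open>W \<rightarrow> X(x,y)\<close>, bundled with \<open>x\<close>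
  and \<open>y\<close>; \<open>W\<close> is its \<open>dm\<close>. Composing elements with domains \<open>W\<close> and \<open>W'\<close> gives one with domain \<open>W \<otimes> W'\<close>,
  so the associativity law holds up to precomposition \<open>\<lhd>\<close> with the associator. Elements with
  domain \<open>I\<close> act without a change of domain, by \<open>lact\<close> on the left and by \<open>ract\<close> on the right.\<close>

datatype ('x, 'a) elem = Elem (esrc: 'x) (etgt: 'x) (earr: 'a)

context system_of_arities
begin

abbreviation dm :: "('x, 'a) elem \<Rightarrow> 'o" where
  "dm a \<equiv> Dom V (earr a)"

lemma Job_Obj [simp]: "J \<in> Job V \<Longrightarrow> J \<in> Obj V"
  using Job Vob by blast

definition gel :: "('x, 'o, 'a, 'n) vcat_scheme \<Rightarrow> ('x, 'a) elem \<Rightarrow> bool" where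
  "gel X a \<longleftrightarrow> esrc a \<in> EOb X \<and> etgt a \<in> EOb X \<and> earr a \<in> Arr V \<and>
     Cod V (earr a) = EHom X (esrc a) (etgt a)"

definition cmp :: "('x, 'a) elem \<Rightarrow> ('x, 'o, 'a, 'n) vcat_scheme \<Rightarrow> ('x, 'a) elem \<Rightarrow> ('x, 'a) elem"
    ("(_ \<star>[_] _)" [66, 0, 65] 65) where
  "a \<star>[X] b = Elem (esrc b) (etgt a) (EComp X (esrc b) (esrc a) (etgt a) \<cdot> (earr a \<odot> earr b))"

definition pre :: "('x, 'a) elem \<Rightarrow> 'a \<Rightarrow> ('x, 'a) elem"  (infixl "\<lhd>" 70) where
  "a \<lhd> p = Elem (esrc a) (etgt a) (earr a \<cdot> p)"

definition app :: "('x, 'y, 'a) vfun \<Rightarrow> ('x, 'a) elem \<Rightarrow> ('y, 'a) elem" where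
  "app F a = Elem (FO F (esrc a)) (FO F (etgt a)) (FH F (esrc a) (etgt a) \<cdot> earr a)"

definition idel :: "('x, 'o, 'a, 'n) vcat_scheme \<Rightarrow> 'x \<Rightarrow> ('x, 'a) elem" where
  "idel X x = Elem x x (EId X x)"

text \<open>The universal element of \<open>X(x,y)\<close>. By \<open>gel_eq_gen\<close> every
  element arises from it by precomposition, so by Yoneda an equation that is natural in the domain
  may be tested on it.\<close>

definition gen :: "('x, 'o, 'a, 'n) vcat_scheme \<Rightarrow> 'x \<Rightarrow> 'x \<Rightarrow> ('x, 'a) elem" where
  "gen X x y = Elem x y (Ident V (EHom X x y))"

definition lact :: "('x, 'o, 'a, 'n) vcat_scheme \<Rightarrow> ('x, 'a) elem \<Rightarrow> ('x, 'a) elem \<Rightarrow> ('x, 'a) elem" where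
  "lact X j a = (j \<star>[X] a) \<lhd> Lun' (dm a)"

definition ract :: "('x, 'o, 'a, 'n) vcat_scheme \<Rightarrow> ('x, 'a) elem \<Rightarrow> ('x, 'a) elem \<Rightarrow> ('x, 'a) elem" where
  "ract X a j = (a \<star>[X] j) \<lhd> Run' (dm a)"

lemma gelD:
  "gel X a \<Longrightarrow> esrc a \<in> EOb X" "gel X a \<Longrightarrow> etgt a \<in> EOb X" "gel X a \<Longrightarrow> earr a \<in> Arr V"
  "gel X a \<Longrightarrow> Cod V (earr a) = EHom X (esrc a) (etgt a)"
  by (simp_all add: gel_def)

lemma gel_dm: "gel X a \<Longrightarrow> dm a \<in> Obj V"
  by (simp add: gel_def)

lemma gel_hom: "gel X a \<Longrightarrow> earr a \<in> hom V (dm a) (EHom X (esrc a) (etgt a))"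
  by (simp add: gel_def hom_def)

lemma elem_simps [simp]:
  "esrc (a \<star>[X] b) = esrc b" "etgt (a \<star>[X] b) = etgt a"
  "esrc (a \<lhd> p) = esrc a" "etgt (a \<lhd> p) = etgt a"
  "esrc (app F a) = FO F (esrc a)" "etgt (app F a) = FO F (etgt a)"
  "esrc (idel X x) = x" "etgt (idel X x) = x" "earr (idel X x) = EId X x"
  "esrc (gen X x y) = x" "etgt (gen X x y) = y" "earr (gen X x y) = Ident V (EHom X x y)"
  "esrc (lact X a b) = esrc b" "etgt (lact X a b) = etgt a"
  "esrc (ract X a b) = esrc b" "etgt (ract X a b) = etgt a"
  by (simp_all add: cmp_def pre_def app_def idel_def gen_def lact_def ract_def)

end

section \<open>Calculus of elements in one enriched category\<close>

locale enriched = system_of_arities V \<kappa>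
  for V :: "('o, 'a, 'm) base_scheme" (structure) and \<kappa> :: "'s itself" +
  fixes X :: "('x, 'o, 'a, 'n) vcat_scheme"
  assumes X: "enriched_category V X"
begin

lemmas dm_Obj [simp] = gel_dm[of X]

lemma EHom_Obj [simp]: "x \<in> EOb X \<Longrightarrow> y \<in> EOb X \<Longrightarrow> EHom X x y \<in> Obj V"
  using X by (simp add: enriched_category_def)

lemma EComp_simps [simp]:
  assumes "x \<in> EOb X" "y \<in> EOb X" "z \<in> EOb X"
  shows "EComp X x y z \<in> Arr V" "Dom V (EComp X x y z) = EHom X y z \<otimes> EHom X x y"
    "Cod V (EComp X x y z) = EHom X x z"
  using X assms by (simp_all add: enriched_category_def hom_def)

lemma EId_simps [simp]:
  assumes "x \<in> EOb X"
  shows "EId X x \<in> Arr V" "Dom V (EId X x) = Unit V" "Cod V (EId X x) = EHom X x x"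
  using X assms by (simp_all add: enriched_category_def hom_def)

lemma EComp_assoc:
  assumes "w \<in> EOb X" "x \<in> EOb X" "y \<in> EOb X" "z \<in> EOb X"
  shows "EComp X w x z \<cdot> (EComp X x y z \<odot> Ident V (EHom X w x)) =
        EComp X w y z \<cdot> ((Ident V (EHom X y z) \<odot> EComp X w x y) \<cdot>
          Assoc V (EHom X y z) (EHom X x y) (EHom X w x))"
proof -
  have "EComp X w x z \<cdot> (EComp X x y z \<odot> Ident V (EHom X w x)) =
        EComp X w y z \<cdot> (Ident V (EHom X y z) \<odot> EComp X w x y) \<cdot>
          Assoc V (EHom X y z) (EHom X x y) (EHom X w x)"
    using X assms unfolding enriched_category_def by blast
  then show ?thesis using assms by simp
qed

lemma EComp_unit:
  assumes "x \<in> EOb X" "y \<in> EOb X"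
  shows "EComp X x y y \<cdot> (EId X y \<odot> Ident V (EHom X x y)) = Lun V (EHom X x y)"
    "EComp X x x y \<cdot> (Ident V (EHom X x y) \<odot> EId X x) = Run V (EHom X x y)"
  using X assms unfolding enriched_category_def by blast+

lemma gel_cmp [simp]: "gel X a \<Longrightarrow> gel X b \<Longrightarrow> esrc a = etgt b \<Longrightarrow> gel X (a \<star>[X] b)"
  by (simp add: cmp_def gel_def)

lemma dm_cmp [simp]: "gel X a \<Longrightarrow> gel X b \<Longrightarrow> esrc a = etgt b \<Longrightarrow> dm (a \<star>[X] b) = dm a \<otimes> dm b"
  by (simp add: cmp_def gel_def)

lemma gel_idel [simp]: "x \<in> EOb X \<Longrightarrow> gel X (idel X x)"
  by (simp add: gel_def)

lemma gel_gen [simp]: "x \<in> EOb X \<Longrightarrow> y \<in> EOb X \<Longrightarrow> gel X (gen X x y)"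
  by (simp add: gel_def)

lemma gel_pre [simp]: "gel X a \<Longrightarrow> p \<in> Arr V \<Longrightarrow> Cod V p = dm a \<Longrightarrow> gel X (a \<lhd> p)"
  by (simp add: gel_def pre_def)

lemma dm_pre [simp]: "gel X a \<Longrightarrow> p \<in> Arr V \<Longrightarrow> Cod V p = dm a \<Longrightarrow> dm (a \<lhd> p) = Dom V p"
  by (simp add: gel_def pre_def)

lemma pre_pre [simp]:
  "gel X a \<Longrightarrow> p \<in> Arr V \<Longrightarrow> Cod V p = dm a \<Longrightarrow> q \<in> Arr V \<Longrightarrow> Cod V q = Dom V p
    \<Longrightarrow> a \<lhd> p \<lhd> q = a \<lhd> (p \<cdot> q)"
  by (simp add: pre_def gel_def)

lemma pre_Ident [simp]: "gel X a \<Longrightarrow> dm a = w \<Longrightarrow> a \<lhd> Ident V w = a"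
  by (cases a) (auto simp add: pre_def gel_def)

lemma gel_eq_gen: "gel X a \<Longrightarrow> a = gen X (esrc a) (etgt a) \<lhd> earr a"
  by (cases a) (simp add: pre_def gen_def gel_def)

lemma cmp_pre_left:
  assumes "gel X a" "gel X b" "esrc a = etgt b" "p \<in> Arr V" "Cod V p = dm a"
  shows "(a \<lhd> p) \<star>[X] b = (a \<star>[X] b) \<lhd> (p \<odot> Ident V (dm b))"
  using assms by (simp add: cmp_def pre_def gel_def)

lemma cmp_pre_right:
  assumes "gel X a" "gel X b" "esrc a = etgt b" "p \<in> Arr V" "Cod V p = dm b"
  shows "a \<star>[X] (b \<lhd> p) = (a \<star>[X] b) \<lhd> (Ident V (dm a) \<odot> p)"
  using assms by (simp add: cmp_def pre_def gel_def)

lemma cmp_assoc: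
  assumes "gel X a" "gel X b" "gel X c" "esrc a = etgt b" "esrc b = etgt c"
  shows "(a \<star>[X] b) \<star>[X] c = (a \<star>[X] (b \<star>[X] c)) \<lhd> Assoc V (dm a) (dm b) (dm c)"
proof -
  obtain y z f where a: "a = Elem y z f" by (cases a)
  obtain x g where b: "b = Elem x y g" using assms a by (cases b) auto
  obtain w h where c: "c = Elem w x h" using assms b by (cases c) auto
  have t [simp]: "w \<in> EOb X" "x \<in> EOb X" "y \<in> EOb X" "z \<in> EOb X" "f \<in> Arr V" "g \<in> Arr V" "h \<in> Arr V"
    "Cod V f = EHom X y z" "Cod V g = EHom X x y" "Cod V h = EHom X w x"
    using assms by (auto simp: a b c gel_def)
  have "EComp X w x z \<cdot> ((EComp X x y z \<cdot> (f \<odot> g)) \<odot> h)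
      = EComp X w x z \<cdot> ((EComp X x y z \<odot> Ident V (EHom X w x)) \<cdot> ((f \<odot> g) \<odot> h))"
    by simp
  also have "\<dots> = (EComp X w y z \<cdot> ((Ident V (EHom X y z) \<odot> EComp X w x y) \<cdot>
          Assoc V (EHom X y z) (EHom X x y) (EHom X w x))) \<cdot> ((f \<odot> g) \<odot> h)"
    by (subst comp_extend[OF EComp_assoc]) simp_all
  also have "\<dots> = EComp X w y z \<cdot> ((Ident V (EHom X y z) \<odot> EComp X w x y) \<cdot>
          ((f \<odot> (g \<odot> h)) \<cdot> Assoc V (Dom V f) (Dom V g) (Dom V h)))"
    by (simp add: Assoc_nat)
  also have "\<dots> = EComp X w y z \<cdot> ((f \<odot> (EComp X w x y \<cdot> (g \<odot> h))) \<cdot> Assoc V (Dom V f) (Dom V g) (Dom V h))"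
    by simp
  finally show ?thesis by (simp add: a b c cmp_def pre_def)
qed

lemma cmp_assoc':
  assumes "gel X a" "gel X b" "gel X c" "esrc a = etgt b" "esrc b = etgt c"
  shows "a \<star>[X] (b \<star>[X] c) = ((a \<star>[X] b) \<star>[X] c) \<lhd> Assoc' (dm a) (dm b) (dm c)"
  using assms by (simp add: cmp_assoc)

lemma cmp_idel_left:
  assumes "gel X a" "x = etgt a"
  shows "idel X x \<star>[X] a = a \<lhd> Lun V (dm a)"
proof -
  obtain w f where a: "a = Elem w x f" using assms by (cases a) auto
  have [simp]: "w \<in> EOb X" "x \<in> EOb X" "f \<in> Arr V" "Cod V f = EHom X w x"
    using assms unfolding a by (simp_all add: gel_def)
  have "EComp X w x x \<cdot> (EId X x \<odot> f)
      = EComp X w x x \<cdot> ((EId X x \<odot> Ident V (EHom X w x)) \<cdot> (Ident V (Unit V) \<odot> f))"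
    by simp
  also have "\<dots> = f \<cdot> Lun V (Dom V f)"
    by (subst comp_extend[OF EComp_unit(1)]) (simp_all add: Lun_nat)
  finally show ?thesis by (simp add: a cmp_def pre_def idel_def)
qed

lemma cmp_idel_right:
  assumes "gel X a" "x = esrc a"
  shows "a \<star>[X] idel X x = a \<lhd> Run V (dm a)"
proof -
  obtain y f where a: "a = Elem x y f" using assms by (cases a) auto
  have [simp]: "y \<in> EOb X" "x \<in> EOb X" "f \<in> Arr V" "Cod V f = EHom X x y"
    using assms unfolding a by (simp_all add: gel_def)
  have "EComp X x x y \<cdot> (f \<odot> EId X x)
      = EComp X x x y \<cdot> ((Ident V (EHom X x y) \<odot> EId X x) \<cdot> (f \<odot> Ident V (Unit V)))"
    by simp
  also have "\<dots> = f \<cdot> Run V (Dom V f)"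
    by (subst comp_extend[OF EComp_unit(2)]) (simp_all add: Run_nat)
  finally show ?thesis by (simp add: a cmp_def pre_def idel_def)
qed

lemma gel_lact [simp]:
  "gel X j \<Longrightarrow> gel X a \<Longrightarrow> esrc j = etgt a \<Longrightarrow> dm j = Unit V \<Longrightarrow> gel X (lact X j a)"
  by (simp add: lact_def)

lemma dm_lact [simp]:
  "gel X j \<Longrightarrow> gel X a \<Longrightarrow> esrc j = etgt a \<Longrightarrow> dm j = Unit V \<Longrightarrow> dm (lact X j a) = dm a"
  by (simp add: lact_def)

lemma gel_ract [simp]:
  "gel X j \<Longrightarrow> gel X a \<Longrightarrow> esrc a = etgt j \<Longrightarrow> dm j = Unit V \<Longrightarrow> gel X (ract X a j)"
  by (simp add: ract_def)

lemma dm_ract [simp]: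
  "gel X j \<Longrightarrow> gel X a \<Longrightarrow> esrc a = etgt j \<Longrightarrow> dm j = Unit V \<Longrightarrow> dm (ract X a j) = dm a"
  by (simp add: ract_def)

text \<open>The unit isomorphism on the domain passes through the associator by
  \<open>Assoc_Lun'\<close>, so that the action of elements with domain \<open>I\<close> associates
  strictly with composition.\<close>

lemma cmp_lact:
  assumes "gel X j" "gel X a" "gel X b" "esrc j = etgt a" "esrc a = etgt b" "dm j = Unit V"
  shows "lact X j a \<star>[X] b = lact X j (a \<star>[X] b)"
  using assms by (simp add: lact_def cmp_pre_left cmp_assoc Assoc_Lun')

lemma cmp_ract:
  assumes "gel X j" "gel X a" "gel X b" "esrc a = etgt b" "esrc b = etgt j" "dm j = Unit V"
  shows "a \<star>[X] ract X b j = ract X (a \<star>[X] b) j"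
  using assms by (simp add: ract_def cmp_pre_right cmp_assoc Assoc_Run')

lemma cmp_ract_lact:
  assumes "gel X j" "gel X a" "gel X b" "esrc a = etgt j" "esrc j = etgt b" "dm j = Unit V"
  shows "ract X a j \<star>[X] b = a \<star>[X] lact X j b"
  using assms by (simp add: ract_def lact_def cmp_pre_left cmp_pre_right cmp_assoc Assoc_Run'_Lun')

lemma lact_pre:
  assumes "gel X j" "gel X a" "esrc j = etgt a" "dm j = Unit V" "p \<in> Arr V" "Cod V p = dm a"
  shows "lact X j (a \<lhd> p) = lact X j a \<lhd> p"
proof -
  have "(Ident V (Unit V) \<odot> p) \<cdot> Lun' (Dom V p) = Lun' (dm a) \<cdot> p"
  proof (rule iso_cancel_left[of "Lun V (dm a)"])
    show "Lun V (dm a) \<cdot> ((Ident V (Unit V) \<odot> p) \<cdot> Lun' (Dom V p)) = Lun V (dm a) \<cdot> (Lun' (dm a) \<cdot> p)"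
      using assms by (subst comp_extend[OF Lun_nat]) (simp_all add: gelD)
  qed (use assms in \<open>simp_all add: gelD\<close>)
  then show ?thesis using assms by (simp add: lact_def cmp_pre_right)
qed

lemma ract_pre:
  assumes "gel X j" "gel X a" "esrc a = etgt j" "dm j = Unit V" "p \<in> Arr V" "Cod V p = dm a"
  shows "ract X (a \<lhd> p) j = ract X a j \<lhd> p"
proof -
  have "(p \<odot> Ident V (Unit V)) \<cdot> Run' (Dom V p) = Run' (dm a) \<cdot> p"
  proof (rule iso_cancel_left[of "Run V (dm a)"])
    show "Run V (dm a) \<cdot> ((p \<odot> Ident V (Unit V)) \<cdot> Run' (Dom V p)) = Run V (dm a) \<cdot> (Run' (dm a) \<cdot> p)"
      using assms by (subst comp_extend[OF Run_nat]) (simp_all add: gelD)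
  qed (use assms in \<open>simp_all add: gelD\<close>)
  then show ?thesis using assms by (simp add: ract_def cmp_pre_left)
qed

lemma lact_idel: "gel X a \<Longrightarrow> x = etgt a \<Longrightarrow> lact X (idel X x) a = a"
  by (simp add: lact_def cmp_idel_left)

lemma ract_idel: "gel X a \<Longrightarrow> x = esrc a \<Longrightarrow> ract X a (idel X x) = a"
  by (simp add: ract_def cmp_idel_right)

lemma lact_lact:
  assumes "gel X i" "gel X j" "gel X a" "esrc j = etgt i" "esrc i = etgt a" "dm j = Unit V" "dm i = Unit V"
  shows "lact X j (lact X i a) = lact X (lact X j i) a"
  unfolding lact_def[of X i a] lact_def[of X "lact X j i"]
  using assms by (simp add: lact_pre cmp_lact)

lemma ract_ract:
  assumes "gel X i" "gel X j" "gel X a" "esrc j = etgt i" "esrc a = etgt j" "dm j = Unit V" "dm i = Unit V"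
  shows "ract X (ract X a j) i = ract X a (lact X j i)"
proof -
  have "ract X (ract X a j) i = (ract X a j \<star>[X] i) \<lhd> Run' (dm a)"
    using assms by (simp add: ract_def[of X "ract X a j"])
  also have "\<dots> = ract X a (lact X j i)"
    using assms by (simp add: cmp_ract_lact ract_def[of X a "lact X j i"])
  finally show ?thesis .
qed

lemma ract_lact:
  assumes "gel X i" "gel X j" "gel X a" "esrc j = etgt a" "esrc a = etgt i" "dm j = Unit V" "dm i = Unit V"
  shows "ract X (lact X j a) i = lact X j (ract X a i)"
proof -
  have "ract X (lact X j a) i = (lact X j a \<star>[X] i) \<lhd> Run' (dm a)"
    using assms by (simp add: ract_def)
  also have "\<dots> = lact X j (ract X a i)"
    using assms by (simp add: cmp_lact lact_pre ract_def)
  finally show ?thesis .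
qed

end

section \<open>Action of enriched functors on elements\<close>

locale enriched_functor = system_of_arities V \<kappa> + X: enriched V \<kappa> X + Y: enriched V \<kappa> Y
  for V :: "('o, 'a, 'm) base_scheme" (structure) and \<kappa> :: "'s itself"
    and X :: "('x, 'o, 'a, 'n) vcat_scheme" and Y :: "('y, 'o, 'a, 'k) vcat_scheme" +
  fixes F :: "('x, 'y, 'a) vfun"
  assumes F: "vfunctor V X Y F"
begin

lemma FO_EOb [simp]: "x \<in> EOb X \<Longrightarrow> FO F x \<in> EOb Y"
  using F by (simp add: vfunctor_def)

lemma FH_simps [simp]:
  assumes "x \<in> EOb X" "y \<in> EOb X"
  shows "FH F x y \<in> Arr V" "Dom V (FH F x y) = EHom X x y" "Cod V (FH F x y) = EHom Y (FO F x) (FO F y)"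
  using F assms by (simp_all add: vfunctor_def hom_def)

lemma gel_app [simp]: "gel X a \<Longrightarrow> gel Y (app F a)"
  by (simp add: gel_def app_def)

lemma dm_app [simp]: "gel X a \<Longrightarrow> dm (app F a) = dm a"
  by (simp add: gel_def app_def)

lemma app_pre:
  "gel X a \<Longrightarrow> p \<in> Arr V \<Longrightarrow> Cod V p = dm a \<Longrightarrow> app F (a \<lhd> p) = app F a \<lhd> p"
  by (simp add: gel_def app_def pre_def)

lemma app_cmp:
  assumes "gel X a" "gel X b" "esrc a = etgt b"
  shows "app F (a \<star>[X] b) = app F a \<star>[Y] app F b"
proof -
  obtain y z f where a: "a = Elem y z f" by (cases a)
  obtain x g where b: "b = Elem x y g" using assms a by (cases b) auto
  have [simp]: "x \<in> EOb X" "y \<in> EOb X" "z \<in> EOb X" "f \<in> Arr V" "g \<in> Arr V"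
    "Cod V f = EHom X y z" "Cod V g = EHom X x y"
    using assms by (auto simp: a b gel_def)
  have "FH F x z \<cdot> EComp X x y z = EComp Y (FO F x) (FO F y) (FO F z) \<cdot> (FH F y z \<odot> FH F x y)"
    using F unfolding vfunctor_def by simp
  from comp_extend[OF this, of "f \<odot> g"]
  have "FH F x z \<cdot> (EComp X x y z \<cdot> (f \<odot> g)) =
      EComp Y (FO F x) (FO F y) (FO F z) \<cdot> ((FH F y z \<cdot> f) \<odot> (FH F x y \<cdot> g))"
    by (simp add:)
  then show ?thesis by (simp add: a b cmp_def app_def)
qed

lemma app_idel: "x \<in> EOb X \<Longrightarrow> app F (idel X x) = idel Y (FO F x)"
  using F by (simp add: app_def idel_def vfunctor_def)

lemma app_lact:
  assumes "gel X j" "gel X a" "esrc j = etgt a" "dm j = Unit V"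
  shows "app F (lact X j a) = lact Y (app F j) (app F a)"
  using assms by (simp add: lact_def app_pre app_cmp)

lemma app_ract:
  assumes "gel X j" "gel X a" "esrc a = etgt j" "dm j = Unit V"
  shows "app F (ract X a j) = ract Y (app F a) (app F j)"
  using assms by (simp add: ract_def app_pre app_cmp)

end

section \<open>Cotensors by generalized elements\<close>

context system_of_arities
begin

lemma curry_arr_simps [simp]:
  assumes "a \<in> Obj V" "b \<in> Obj V" "c \<in> Obj V" "f \<in> Arr V" "Dom V f = a \<otimes> b" "Cod V f = c"
  shows "curry_arr V a b c f \<in> Arr V" "Dom V (curry_arr V a b c f) = a"
    "Cod V (curry_arr V a b c f) = IHom V b c"
    "Ev V b c \<cdot> (curry_arr V a b c f \<odot> Ident V b) = f"
proof -
  have "f \<in> hom V (a \<otimes> b) c" using assms by (simp add: hom_def)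
  from theI'[OF closed[OF assms(1-3) this]]
  show "curry_arr V a b c f \<in> Arr V" "Dom V (curry_arr V a b c f) = a"
    "Cod V (curry_arr V a b c f) = IHom V b c"
    "Ev V b c \<cdot> (curry_arr V a b c f \<odot> Ident V b) = f"
    by (simp_all add: curry_arr_def hom_def)
qed

lemma uncurry_eqD:
  assumes "b \<in> Obj V" "c \<in> Obj V" "g \<in> Arr V" "g' \<in> Arr V" "Cod V g = IHom V b c" "Cod V g' = IHom V b c"
    "Dom V g = Dom V g'" "Ev V b c \<cdot> (g \<odot> Ident V b) = Ev V b c \<cdot> (g' \<odot> Ident V b)"
  shows "g = g'"
proof -
  have a: "Dom V g \<in> Obj V" using assms(3) by simp
  have "Ev V b c \<cdot> (g \<odot> Ident V b) \<in> hom V (Dom V g \<otimes> b) c" using assms(1-7) by (simp add: hom_def)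
  from closed[OF a assms(1,2) this] show ?thesis
    using assms unfolding hom_def by auto
qed

text \<open>Yoneda form of the isomorphism \<open>X(y,c) \<cong> [J, X(y,x)]\<close>: arrows
  \<open>W \<rightarrow> X(y,c)\<close> correspond to arrows
  \<open>J \<otimes> W \<rightarrow> X(y,x)\<close>, for all \<open>W\<close> in the enlarged base.
  It replaces currying by composition of elements; the index \<open>J\<close> is the domain of
  \<open>e\<close>.\<close>

definition cotens :: "('x, 'o, 'a, 'n) vcat_scheme \<Rightarrow> ('x, 'a) elem \<Rightarrow> bool" where
  "cotens X e \<longleftrightarrow> gel X e \<and>
     (\<forall>\<phi> W. W \<in> Obj V \<longrightarrow> gel X \<phi> \<longrightarrow> etgt \<phi> = etgt e \<longrightarrow> dm \<phi> = dm e \<otimes> W \<longrightarrow>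
       (\<exists>!h. gel X h \<and> esrc h = esrc \<phi> \<and> etgt h = esrc e \<and> dm h = W \<and> e \<star>[X] h = \<phi>))"

lemma cotens_gel: "cotens X e \<Longrightarrow> gel X e"
  by (simp add: cotens_def)

lemma cotens_lift:
  assumes "cotens X e" "W \<in> Obj V" "gel X \<phi>" "etgt \<phi> = etgt e" "dm \<phi> = dm e \<otimes> W"
  obtains h where "gel X h" "esrc h = esrc \<phi>" "etgt h = esrc e" "dm h = W" "e \<star>[X] h = \<phi>"
  using assms unfolding cotens_def by metis

end

context enriched
begin

lemma cotens_eqD:
  assumes "cotens X e" "e \<star>[X] h = e \<star>[X] h'" "gel X h" "gel X h'" "etgt h = esrc e" "etgt h' = esrc e"
    "dm h = dm h'"
  shows "h = h'"
proof -
  have e: "gel X e" using assms by (simp add: cotens_def)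
  have "esrc h = esrc h'" using arg_cong[OF assms(2), of esrc] by simp
  moreover have "\<exists>!k. gel X k \<and> esrc k = esrc (e \<star>[X] h) \<and> etgt k = esrc e \<and> dm k = dm h \<and> e \<star>[X] k = e \<star>[X] h"
    using assms(1)[unfolded cotens_def, THEN conjunct2, rule_format, of "dm h" "e \<star>[X] h"] assms(3,5) e
    by simp
  ultimately show ?thesis using assms(2-) by auto
qed

lemma cotensI:
  assumes "gel X e"
    and "\<And>\<phi> W. W \<in> Obj V \<Longrightarrow> gel X \<phi> \<Longrightarrow> etgt \<phi> = etgt e \<Longrightarrow> dm \<phi> = dm e \<otimes> W \<Longrightarrow>
       \<exists>h. gel X h \<and> esrc h = esrc \<phi> \<and> etgt h = esrc e \<and> dm h = W \<and> e \<star>[X] h = \<phi>"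
    and "\<And>h h'. gel X h \<Longrightarrow> gel X h' \<Longrightarrow> esrc h = esrc h' \<Longrightarrow> etgt h = esrc e \<Longrightarrow> etgt h' = esrc e \<Longrightarrow>
       dm h = dm h' \<Longrightarrow> e \<star>[X] h = e \<star>[X] h' \<Longrightarrow> h = h'"
  shows "cotens X e"
  unfolding cotens_def
proof (intro conjI allI impI)
  fix \<phi> W assume a: "W \<in> Obj V" "gel X \<phi>" "etgt \<phi> = etgt e" "dm \<phi> = dm e \<otimes> W"
  show "\<exists>!h. gel X h \<and> esrc h = esrc \<phi> \<and> etgt h = esrc e \<and> dm h = W \<and> e \<star>[X] h = \<phi>"
    by (rule ex_ex1I[OF assms(2)[OF a]]) (rule assms(3); simp)
qed (fact assms(1))

text \<open>By the equation \<open>key\<close>, evaluating the canonical arrow into the internal hom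
  along \<open>h\<close> is the same as composing the element \<open>k\<close> with
  \<open>h\<close>. So an inverse of that arrow yields lifts, and conversely a lift of the
  evaluation is an inverse.\<close>

lemma is_cotensor_iff: "is_cotensor V X J x c k \<longleftrightarrow> cotens X (Elem c x k) \<and> Dom V k = J"
proof (cases "J \<in> Obj V \<and> x \<in> EOb X \<and> c \<in> EOb X \<and> k \<in> hom V J (EHom X c x)")
  case False
  then show ?thesis by (auto simp: is_cotensor_def cotens_def gel_def hom_def)
next
  case True
  then have t [simp]: "J \<in> Obj V" "x \<in> EOb X" "c \<in> EOb X" "k \<in> Arr V" "Dom V k = J" "Cod V k = EHom X c x"
    by (auto simp: hom_def)
  let ?m = "\<lambda>y. EComp X y c x \<cdot> ((k \<odot> Ident V (EHom X y c)) \<cdot> Swap V (EHom X y c) J)"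
  let ?f = "\<lambda>y. curry_arr V (EHom X y c) J (EHom X y x) (?m y)"
  have m [simp]: "?f y \<in> Arr V" "Dom V (?f y) = EHom X y c" "Cod V (?f y) = IHom V J (EHom X y x)"
      "Ev V J (EHom X y x) \<cdot> (?f y \<odot> Ident V J) = ?m y" if "y \<in> EOb X" for y
    using that by simp_all
  have key: "Ev V J (EHom X y x) \<cdot> ((?f y \<cdot> h) \<odot> Ident V J) = EComp X y c x \<cdot> ((k \<odot> h) \<cdot> Swap V (Dom V h) J)"
    if y [simp]: "y \<in> EOb X" and h [simp]: "h \<in> Arr V" "Cod V h = EHom X y c" for y h
  proof -
    have "Ev V J (EHom X y x) \<cdot> ((?f y \<cdot> h) \<odot> Ident V J)
        = Ev V J (EHom X y x) \<cdot> ((?f y \<odot> Ident V J) \<cdot> (h \<odot> Ident V J))"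
      by simp
    also have "\<dots> = ?m y \<cdot> (h \<odot> Ident V J)"
      by (rule comp_extend[OF m(4)]) simp_all
    also have "\<dots> = EComp X y c x \<cdot> ((k \<odot> Ident V (EHom X y c)) \<cdot> ((Ident V J \<odot> h) \<cdot> Swap V (Dom V h) J))"
      by (simp add: Swap_nat del: interchange_left)
    also have "\<dots> = EComp X y c x \<cdot> ((k \<odot> h) \<cdot> Swap V (Dom V h) J)"
      by simp
    finally show ?thesis .
  qed
  have eq: "is_cotensor V X J x c k \<longleftrightarrow> (\<forall>y \<in> EOb X. iso V (?f y))"
    using True by (auto simp: is_cotensor_def)
  show ?thesis
  proof
    assume "is_cotensor V X J x c k"
    then have i: "iso V (?f y)" if "y \<in> EOb X" for y using that eq by blast
    have "cotens X (Elem c x k)"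
    proof (rule cotensI)
      fix \<phi> W assume [simp]: "W \<in> Obj V" and p: "gel X \<phi>" "etgt \<phi> = etgt (Elem c x k)"
        "dm \<phi> = dm (Elem c x k) \<otimes> W"
      obtain y f where \<phi>: "\<phi> = Elem y x f" using p by (cases \<phi>) auto
      have [simp]: "y \<in> EOb X" "f \<in> Arr V" "Dom V f = J \<otimes> W" "Cod V f = EHom X y x"
        using p unfolding \<phi> by (simp_all add: gel_def)
      let ?g = "curry_arr V W J (EHom X y x) (f \<cdot> Swap V W J)"
      note j = inverse_arr_simps[OF i[of y]]
      define h where "h = inverse_arr V (?f y) \<cdot> ?g"
      have h [simp]: "h \<in> Arr V" "Dom V h = W" "Cod V h = EHom X y c"
        unfolding h_def using j(1-3) by simp_all
      have "?f y \<cdot> h = (?f y \<cdot> inverse_arr V (?f y)) \<cdot> ?g"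
        unfolding h_def using j(1-3) by simp
      also have "\<dots> = ?g" by (subst j(5)) simp_all
      finally have "Ev V J (EHom X y x) \<cdot> (?g \<odot> Ident V J) = EComp X y c x \<cdot> ((k \<odot> h) \<cdot> Swap V W J)"
        using key[of y h] by simp
      then have "f \<cdot> Swap V W J = (EComp X y c x \<cdot> (k \<odot> h)) \<cdot> Swap V W J"
        by simp
      then have "f = EComp X y c x \<cdot> (k \<odot> h)"
        by (rule iso_cancel_right[rotated -1]) simp_all
      then show "\<exists>h. gel X h \<and> esrc h = esrc \<phi> \<and> etgt h = esrc (Elem c x k) \<and> dm h = W \<and> Elem c x k \<star>[X] h = \<phi>"
        by (intro exI[of _ "Elem y c h"]) (simp add: gel_def cmp_def \<phi>)
    next
      fix h h' assume a: "gel X h" "gel X h'" "esrc h = esrc h'" "etgt h = esrc (Elem c x k)"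
        "etgt h' = esrc (Elem c x k)" "dm h = dm h'" "Elem c x k \<star>[X] h = Elem c x k \<star>[X] h'"
      obtain y f where h: "h = Elem y c f" using a by (cases h) auto
      obtain f' where h': "h' = Elem y c f'" using a(3,5) h by (cases h') auto
      have [simp]: "y \<in> EOb X" "f \<in> Arr V" "f' \<in> Arr V" "Dom V f = Dom V f'" "Cod V f = EHom X y c" "Cod V f' = EHom X y c"
        using a(1,2,6) unfolding h h' by (simp_all add: gel_def)
      have "EComp X y c x \<cdot> (k \<odot> f) = EComp X y c x \<cdot> (k \<odot> f')"
        using a(7) by (simp add: h h' cmp_def)
      then have "EComp X y c x \<cdot> (k \<odot> f) \<cdot> Swap V (Dom V f') J = EComp X y c x \<cdot> (k \<odot> f') \<cdot> Swap V (Dom V f') J"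
        by simp
      then have "?f y \<cdot> f = ?f y \<cdot> f'"
        by (intro uncurry_eqD[of J "EHom X y x" "?f y \<cdot> f" "?f y \<cdot> f'"]) (simp_all add: key)
      then have "f = f'" by (rule iso_cancel_left[OF i, rotated -1]) simp_all
      then show "h = h'" by (simp add: h h')
    qed (simp add: gel_def)
    then show "cotens X (Elem c x k) \<and> Dom V k = J" by simp
  next
    assume "cotens X (Elem c x k) \<and> Dom V k = J"
    then have ct: "cotens X (Elem c x k)" by simp
    have "iso V (?f y)" if y [simp]: "y \<in> EOb X" for y
    proof -
      let ?H = "IHom V J (EHom X y x)"
      \<comment> \<open>The evaluation, read as an element with domain
        \<open>J \<otimes> [J, X(y,x)]\<close>; its lift along \<open>k\<close> is the required
        inverse.\<close>
      let ?E = "Elem y x (Ev V J (EHom X y x) \<cdot> Swap V J ?H)"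
      obtain h where h: "gel X h" "esrc h = esrc ?E" "etgt h = esrc (Elem c x k)" "dm h = ?H"
          "Elem c x k \<star>[X] h = ?E"
        by (rule cotens_lift[OF ct, of ?H ?E]) (simp_all add: gel_def)
      obtain g where g: "h = Elem y c g" using h by (cases h) auto
      have [simp]: "g \<in> Arr V" "Dom V g = ?H" "Cod V g = EHom X y c"
        using h(1,4) unfolding g by (simp_all add: gel_def)
      have kg: "EComp X y c x \<cdot> (k \<odot> g) = Ev V J (EHom X y x) \<cdot> Swap V J ?H"
        using h(5) by (simp add: g cmp_def)
      have "Ev V J (EHom X y x) \<cdot> ((?f y \<cdot> g) \<odot> Ident V J) = Ev V J (EHom X y x) \<cdot> (Ident V ?H \<odot> Ident V J)"
        using comp_extend[OF kg, of "Swap V ?H J"] by (simp add: key)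
      then have 1: "?f y \<cdot> g = Ident V ?H"
        by (rule uncurry_eqD[rotated -1]) simp_all
      have "EComp X y c x \<cdot> (k \<odot> (g \<cdot> ?f y)) = EComp X y c x \<cdot> ((k \<odot> g) \<cdot> (Ident V J \<odot> ?f y))"
        by simp
      also have "\<dots> = (Ev V J (EHom X y x) \<cdot> Swap V J ?H) \<cdot> (Ident V J \<odot> ?f y)"
        by (rule comp_extend[OF kg]) simp_all
      also have "\<dots> = Ev V J (EHom X y x) \<cdot> ((?f y \<odot> Ident V J) \<cdot> Swap V J (EHom X y c))"
        by (simp add: Swap_nat)
      also have "\<dots> = ?m y \<cdot> Swap V J (EHom X y c)"
        by (rule comp_extend[OF m(4)]) simp_all
      also have "\<dots> = EComp X y c x \<cdot> (k \<odot> Ident V (EHom X y c))"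
        by simp
      finally have "Elem c x k \<star>[X] Elem y c (g \<cdot> ?f y) = Elem c x k \<star>[X] Elem y c (Ident V (EHom X y c))"
        by (simp add: cmp_def)
      then have "Elem y c (g \<cdot> ?f y) = Elem y c (Ident V (EHom X y c))"
        by (rule cotens_eqD[OF ct]) (simp_all add: gel_def)
      then show ?thesis using 1 by (intro isoI[of _ g]) simp_all
    qed
    then show "is_cotensor V X J x c k" using eq by blast
  qed
qed

lemma cotens_idel: "x \<in> EOb X \<Longrightarrow> cotens X (idel X x)"
proof (rule cotensI)
  fix \<phi> W assume a: "x \<in> EOb X" "W \<in> Obj V" "gel X \<phi>" "etgt \<phi> = etgt (idel X x)" "dm \<phi> = dm (idel X x) \<otimes> W"
  then show "\<exists>h. gel X h \<and> esrc h = esrc \<phi> \<and> etgt h = esrc (idel X x) \<and> dm h = W \<and> idel X x \<star>[X] h = \<phi>"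
    by (intro exI[of _ "\<phi> \<lhd> Lun' W"]) (simp add: cmp_idel_left)
next
  fix h h' assume a: "x \<in> EOb X" "gel X h" "gel X h'" "esrc h = esrc h'" "etgt h = esrc (idel X x)" "etgt h' = esrc (idel X x)"
    "dm h = dm h'" "idel X x \<star>[X] h = idel X x \<star>[X] h'"
  then have "h \<lhd> Lun V (dm h') \<lhd> Lun' (dm h') = h' \<lhd> Lun V (dm h') \<lhd> Lun' (dm h')"
    by (simp add: cmp_idel_left del: pre_pre)
  then show "h = h'" using a by simp
qed simp

text \<open>Lifting along \<open>s\<close> and then along \<open>k\<close> realizes
  \<open>[K,[J,x]] = [J \<otimes> K, x]\<close>, where \<open>J\<close> and \<open>K\<close> are the
  domains of \<open>s\<close> and \<open>k\<close>.\<close>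

lemma cotens_cmp:
  assumes s: "cotens X s" and k: "cotens X k" and sk: "esrc s = etgt k"
  shows "cotens X (s \<star>[X] k)"
proof (rule cotensI)
  note [simp] = s[THEN cotens_gel] k[THEN cotens_gel] sk
  show "gel X (s \<star>[X] k)" by simp
  fix \<phi> W assume a: "W \<in> Obj V" "gel X \<phi>" "etgt \<phi> = etgt (s \<star>[X] k)" "dm \<phi> = dm (s \<star>[X] k) \<otimes> W"
  obtain h where h: "gel X h" "esrc h = esrc (\<phi> \<lhd> Assoc' (dm s) (dm k) W)" "etgt h = esrc s" "dm h = dm k \<otimes> W"
      "s \<star>[X] h = \<phi> \<lhd> Assoc' (dm s) (dm k) W"
    by (rule cotens_lift[OF s, of "dm k \<otimes> W" "\<phi> \<lhd> Assoc' (dm s) (dm k) W"]) (use a in simp_all)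
  obtain h' where h': "gel X h'" "esrc h' = esrc h" "etgt h' = esrc k" "dm h' = W" "k \<star>[X] h' = h"
    by (rule cotens_lift[OF k, of W h]) (use a h in simp_all)
  show "\<exists>h. gel X h \<and> esrc h = esrc \<phi> \<and> etgt h = esrc (s \<star>[X] k) \<and> dm h = W \<and> (s \<star>[X] k) \<star>[X] h = \<phi>"
    using a h h' by (intro exI[of _ h']) (simp add: cmp_assoc)
next
  note [simp] = s[THEN cotens_gel] k[THEN cotens_gel] sk
  fix h h' assume a: "gel X h" "gel X h'" "esrc h = esrc h'" "etgt h = esrc (s \<star>[X] k)" "etgt h' = esrc (s \<star>[X] k)"
    "dm h = dm h'" "(s \<star>[X] k) \<star>[X] h = (s \<star>[X] k) \<star>[X] h'"
  from arg_cong[OF a(7), of "\<lambda>e. e \<lhd> Assoc' (dm s) (dm k) (dm h')"]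
  have "s \<star>[X] (k \<star>[X] h) = s \<star>[X] (k \<star>[X] h')"
    using a(1-6) by (simp add: cmp_assoc)
  then have "k \<star>[X] h = k \<star>[X] h'"
    by (rule cotens_eqD[OF s]) (use a(1-6) in simp_all)
  then show "h = h'"
    by (rule cotens_eqD[OF k]) (use a(1-6) in simp_all)
qed

text \<open>A lift along the composite is also one along \<open>k\<close>, because composition with
  the cotensor \<open>s\<close> on the left is injective.\<close>

lemma cotens_cmp_cancel:
  assumes s: "cotens X s" and k: "gel X k" and sk: "esrc s = etgt k" and c: "cotens X (s \<star>[X] k)"
  shows "cotens X k"
proof (rule cotensI)
  note [simp] = s[THEN cotens_gel] k sk
  fix \<phi> W assume a: "W \<in> Obj V" "gel X \<phi>" "etgt \<phi> = etgt k" "dm \<phi> = dm k \<otimes> W"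
  let ?p = "(s \<star>[X] \<phi>) \<lhd> Assoc V (dm s) (dm k) W"
  obtain h where h: "gel X h" "esrc h = esrc ?p" "etgt h = esrc (s \<star>[X] k)" "dm h = W" "(s \<star>[X] k) \<star>[X] h = ?p"
    by (rule cotens_lift[OF c, of W ?p]) (use a in simp_all)
  from arg_cong[OF h(5), of "\<lambda>e. e \<lhd> Assoc' (dm s) (dm k) W"]
  have "s \<star>[X] (k \<star>[X] h) = s \<star>[X] \<phi>"
    using a h(1-4) by (simp add: cmp_assoc)
  then have "k \<star>[X] h = \<phi>" by (rule cotens_eqD[OF s]) (use a h in simp_all)
  then show "\<exists>h. gel X h \<and> esrc h = esrc \<phi> \<and> etgt h = esrc k \<and> dm h = W \<and> k \<star>[X] h = \<phi>"
    using h by (intro exI[of _ h]) simp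
next
  note [simp] = s[THEN cotens_gel] k sk
  fix h h' assume a: "gel X h" "gel X h'" "esrc h = esrc h'" "etgt h = esrc k" "etgt h' = esrc k"
    "dm h = dm h'" "k \<star>[X] h = k \<star>[X] h'"
  then have "(s \<star>[X] k) \<star>[X] h = (s \<star>[X] k) \<star>[X] h'"
    by (simp add: cmp_assoc)
  then show "h = h'" by (rule cotens_eqD[OF c]) (use a in simp_all)
qed (fact k)

definition inverse_el :: "('x, 'a) elem \<Rightarrow> ('x, 'a) elem \<Rightarrow> bool" where
  "inverse_el j i \<longleftrightarrow> gel X j \<and> gel X i \<and> dm j = Unit V \<and> dm i = Unit V \<and> esrc j = etgt i \<and> esrc i = etgt j \<and>
     lact X j i = idel X (etgt j) \<and> lact X i j = idel X (etgt i)"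

lemma lact_inverse_el:
  "inverse_el j i \<Longrightarrow> gel X a \<Longrightarrow> etgt j = etgt a \<Longrightarrow> lact X j (lact X i a) = a"
  "inverse_el j i \<Longrightarrow> gel X a \<Longrightarrow> etgt i = etgt a \<Longrightarrow> lact X i (lact X j a) = a"
  by (simp_all add: inverse_el_def lact_lact lact_idel)

lemma ract_inverse_el:
  "inverse_el j i \<Longrightarrow> gel X a \<Longrightarrow> etgt j = esrc a \<Longrightarrow> ract X (ract X a j) i = a"
  "inverse_el j i \<Longrightarrow> gel X a \<Longrightarrow> etgt i = esrc a \<Longrightarrow> ract X (ract X a i) j = a"
  by (simp_all add: inverse_el_def ract_ract ract_idel)

lemma cotens_ract:
  assumes k: "cotens X k" and j: "inverse_el j i" and kj: "esrc k = etgt j"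
  shows "cotens X (ract X k j)"
proof (rule cotensI)
  have jj [simp]: "gel X j" "gel X i" "dm j = Unit V" "dm i = Unit V" "etgt i = esrc j" "esrc i = etgt j"
    using j by (simp_all add: inverse_el_def)
  note [simp] = k[THEN cotens_gel] kj
  show "gel X (ract X k j)" by simp
  fix \<phi> W assume a: "W \<in> Obj V" "gel X \<phi>" "etgt \<phi> = etgt (ract X k j)" "dm \<phi> = dm (ract X k j) \<otimes> W"
  obtain h where h: "gel X h" "esrc h = esrc \<phi>" "etgt h = esrc k" "dm h = W" "k \<star>[X] h = \<phi>"
    by (rule cotens_lift[OF k, of W \<phi>]) (use a in simp_all)
  have "ract X k j \<star>[X] lact X i h = \<phi>"
    using h by (simp add: cmp_ract_lact lact_inverse_el[OF j])
  then show "\<exists>h. gel X h \<and> esrc h = esrc \<phi> \<and> etgt h = esrc (ract X k j) \<and> dm h = W \<and> ract X k j \<star>[X] h = \<phi>"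
    using h by (intro exI[of _ "lact X i h"]) simp
next
  have jj [simp]: "gel X j" "gel X i" "dm j = Unit V" "dm i = Unit V" "etgt i = esrc j" "esrc i = etgt j"
    using j by (simp_all add: inverse_el_def)
  note [simp] = k[THEN cotens_gel] kj
  fix h h' assume a: "gel X h" "gel X h'" "esrc h = esrc h'" "etgt h = esrc (ract X k j)" "etgt h' = esrc (ract X k j)"
    "dm h = dm h'" "ract X k j \<star>[X] h = ract X k j \<star>[X] h'"
  then have "k \<star>[X] lact X j h = k \<star>[X] lact X j h'"
    by (simp add: cmp_ract_lact)
  then have "lact X j h = lact X j h'"
    by (rule cotens_eqD[OF k]) (use a in simp_all)
  then have "lact X i (lact X j h) = lact X i (lact X j h')" by simp
  then show "h = h'" using a by (simp add: lact_inverse_el[OF j])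
qed

text \<open>Each element is lifted along the other at \<open>W = I\<close>, where
  \<open>ract\<close> absorbs the unit isomorphism; uniqueness of lifts makes the two comparisons
  inverse.\<close>

lemma cotens_unique:
  assumes k: "cotens X k" and k': "cotens X k'" and "etgt k = etgt k'" "dm k = dm k'"
  obtains j i where "inverse_el j i" "etgt j = esrc k" "esrc j = esrc k'" "ract X k j = k'"
proof -
  note [simp] = k[THEN cotens_gel] k'[THEN cotens_gel]
  have lift: "\<exists>j. gel X j \<and> esrc j = esrc b \<and> etgt j = esrc a \<and> dm j = Unit V \<and> ract X a j = b"
    if ab: "cotens X a" "cotens X b" "etgt a = etgt b" "dm a = dm b" for a b
  proof -
    note [simp] = ab(1,2)[THEN cotens_gel]
    obtain j where "gel X j" "esrc j = esrc (b \<lhd> Run V (dm b))" "etgt j = esrc a" "dm j = Unit V"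
        "a \<star>[X] j = b \<lhd> Run V (dm b)"
      by (rule cotens_lift[OF ab(1), of "Unit V" "b \<lhd> Run V (dm b)"]) (use ab in simp_all)
    then show ?thesis using ab by (intro exI[of _ j]) (simp add: ract_def)
  qed
  have id: "j = idel X (esrc a)" if "cotens X a" "gel X j" "dm j = Unit V" "etgt j = esrc a" "esrc j = esrc a" "ract X a j = a"
    for a j
  proof (rule cotens_eqD[OF that(1)])
    note [simp] = that(1)[THEN cotens_gel]
    from arg_cong[OF that(6), of "\<lambda>e. e \<lhd> Run V (dm a)"]
    show "a \<star>[X] j = a \<star>[X] idel X (esrc a)"
      using that by (simp add: ract_def cmp_idel_right)
  qed (use that gelD(1)[OF cotens_gel[OF that(1)]] in simp_all)
  obtain j where j: "gel X j" "esrc j = esrc k'" "etgt j = esrc k" "dm j = Unit V" "ract X k j = k'"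
    using lift[OF k k'] assms by blast
  obtain i where i: "gel X i" "esrc i = esrc k" "etgt i = esrc k'" "dm i = Unit V" "ract X k' i = k"
    using lift[OF k' k] assms by metis
  have "ract X k (lact X j i) = k"
    using ract_ract[of i j k] i j by simp
  then have 1: "lact X j i = idel X (esrc k)" by (intro id[OF k]) (use i j in simp_all)
  have "ract X k' (lact X i j) = k'"
    using ract_ract[of j i k'] i j by simp
  then have 2: "lact X i j = idel X (esrc k')" by (intro id[OF k']) (use i j in simp_all)
  have "inverse_el j i" using i j 1 2 by (simp add: inverse_el_def)
  then show ?thesis using that j by blast
qed

text \<open>Links \<open>cot_lift\<close>, which works on bare arrows, to elements. The components
  enter through separate equations so that the rule matches an unfolded
  \<open>cot_lift\<close>.\<close>

lemma cot_lift_eq: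
  assumes ct: "cotens X k" and "gel X \<phi>" "etgt \<phi> = etgt k" "W \<in> Obj V" "dm \<phi> = dm k \<otimes> W"
    and "y = esrc \<phi>" "x = etgt k" "c = esrc k" "k' = earr k" "f = earr \<phi>"
  defines "h \<equiv> Elem y c (cot_lift V X x c k' y W f)"
  shows "gel X h" "dm h = W" "k \<star>[X] h = \<phi>"
proof -
  obtain h0 where h0: "gel X h0" "esrc h0 = esrc \<phi>" "etgt h0 = esrc k" "dm h0 = W" "k \<star>[X] h0 = \<phi>"
    by (rule cotens_lift[OF ct, of W \<phi>]) (use assms in simp_all)
  have "cot_lift V X x c k' y W f = earr h0"
    unfolding cot_lift_def
  proof (rule the_equality)
    show "earr h0 \<in> hom V W (EHom X y c) \<and> EComp X y c x \<cdot> (k' \<odot> earr h0) = f"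
      using h0 assms(6-10) by (cases \<phi>) (auto simp: gel_def hom_def cmp_def)
    fix g assume g: "g \<in> hom V W (EHom X y c) \<and> EComp X y c x \<cdot> (k' \<odot> g) = f"
    have "Elem y c g = h0"
    proof (rule cotens_eqD[OF ct])
      show "k \<star>[X] Elem y c g = k \<star>[X] h0"
        using g h0(5) assms(3,6-10) by (cases \<phi>) (simp add: cmp_def)
      show "gel X (Elem y c g)" "dm (Elem y c g) = dm h0"
        using g h0 gelD[OF cotens_gel[OF ct]] gelD[OF assms(2)] assms(6-10) by (auto simp: gel_def hom_def)
    qed (use h0 assms in simp_all)
    then show "g = earr h0" by (metis elem.sel(3))
  qed
  then have "h = h0" unfolding h_def using h0(2,3) assms(6,8) by (cases h0) simp
  then show "gel X h" "dm h = W" "k \<star>[X] h = \<phi>" using h0 by simp_all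
qed

end

section \<open>Functors and natural families\<close>

context system_of_arities
begin

lemma preserves_cotensors_iff:
  assumes "enriched_category V X" "enriched_category V Y"
    and F: "vfunctor V X Y F"
  shows "preserves_cotensors V X Y F \<longleftrightarrow> (\<forall>e. cotens X e \<longrightarrow> dm e \<in> Job V \<longrightarrow> cotens Y (app F e))"
proof -
  interpret X: enriched V \<kappa> X by unfold_locales fact
  interpret Y: enriched V \<kappa> Y by unfold_locales fact
  interpret F: enriched_functor V \<kappa> X Y F by unfold_locales fact
  have 1: "cotens Y (Elem (FO F c) (FO F x) (FH F c x \<cdot> k)) \<and> Dom V (FH F c x \<cdot> k) = J
      \<longleftrightarrow> cotens Y (app F (Elem c x k)) \<and> dm (app F (Elem c x k)) = J" for c x k J
    by (simp add: app_def)
  show ?thesis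
    unfolding preserves_cotensors_def X.is_cotensor_iff Y.is_cotensor_iff 1
  proof safe
    fix e assume a: "\<forall>J\<in>Job V. \<forall>x c k. cotens X (Elem c x k) \<and> Dom V k = J \<longrightarrow>
       cotens Y (app F (Elem c x k)) \<and> dm (app F (Elem c x k)) = J" "cotens X e" "dm e \<in> Job V"
    then show "cotens Y (app F e)" by (cases e) auto
  next
    fix J x c k assume a: "\<forall>e. cotens X e \<longrightarrow> dm e \<in> Job V \<longrightarrow> cotens Y (app F e)"
      "cotens X (Elem c x k)" "Dom V k \<in> Job V"
    from a show "cotens Y (app F (Elem c x k))" by simp
    show "dm (app F (Elem c x k)) = Dom V k" using cotens_gel[OF a(2)] by simp
  qed
qed

lemma vfunctorI:
  assumes "enriched_category V X" "enriched_category V Y"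
    and FO: "\<And>x. x \<in> EOb X \<Longrightarrow> FO F x \<in> EOb Y"
    and FH: "\<And>x y. x \<in> EOb X \<Longrightarrow> y \<in> EOb X \<Longrightarrow> FH F x y \<in> hom V (EHom X x y) (EHom Y (FO F x) (FO F y))"
    and cmp: "\<And>a b. gel X a \<Longrightarrow> gel X b \<Longrightarrow> esrc a = etgt b \<Longrightarrow> app F (a \<star>[X] b) = app F a \<star>[Y] app F b"
    and id: "\<And>x. x \<in> EOb X \<Longrightarrow> app F (idel X x) = idel Y (FO F x)"
  shows "vfunctor V X Y F"
proof -
  interpret X: enriched V \<kappa> X by unfold_locales fact
  interpret Y: enriched V \<kappa> Y by unfold_locales fact
  have [simp]: "FH F x y \<in> Arr V" "Dom V (FH F x y) = EHom X x y" "Cod V (FH F x y) = EHom Y (FO F x) (FO F y)"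
    if "x \<in> EOb X" "y \<in> EOb X" for x y
    using FH[OF that] by (simp_all add: hom_def)
  have "FH F x z \<cdot> EComp X x y z = EComp Y (FO F x) (FO F y) (FO F z) \<cdot> (FH F y z \<odot> FH F x y)"
    if "x \<in> EOb X" "y \<in> EOb X" "z \<in> EOb X" for x y z
    using cmp[of "gen X y z" "gen X x y"] that by (simp add: cmp_def app_def gen_def gel_def)
  moreover have "FH F x x \<cdot> EId X x = EId Y (FO F x)" if "x \<in> EOb X" for x
    using id[OF that] by (simp add: app_def idel_def)
  ultimately show ?thesis using FO FH by (simp add: vfunctor_def)
qed

lemma vfunctor_comp:
  assumes "enriched_category V X" "enriched_category V Y" "enriched_category V Z"
    and "vfunctor V X Y F" "vfunctor V Y Z G"
  shows "vfunctor V X Z (comp_vfun V G F)"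
    and "gel X a \<Longrightarrow> app (comp_vfun V G F) a = app G (app F a)"
proof -
  interpret X: enriched V \<kappa> X by unfold_locales fact
  interpret Y: enriched V \<kappa> Y by unfold_locales fact
  interpret Z: enriched V \<kappa> Z by unfold_locales fact
  interpret F: enriched_functor V \<kappa> X Y F by unfold_locales fact
  interpret G: enriched_functor V \<kappa> Y Z G by unfold_locales fact
  show 1: "app (comp_vfun V G F) a = app G (app F a)" if "gel X a" for a
    using that by (simp add: app_def comp_vfun_def gel_def)
  show "vfunctor V X Z (comp_vfun V G F)"
  proof (rule vfunctorI[OF assms(1,3)])
    fix a b assume "gel X a" "gel X b" "esrc a = etgt b"
    then show "app (comp_vfun V G F) (a \<star>[X] b) = app (comp_vfun V G F) a \<star>[Z] app (comp_vfun V G F) b"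
      by (simp add: 1 F.app_cmp G.app_cmp)
  next
    fix x assume "x \<in> EOb X"
    then show "app (comp_vfun V G F) (idel X x) = idel Z (FO (comp_vfun V G F) x)"
      by (simp add: 1 F.app_idel G.app_idel) (simp add: comp_vfun_def)
  qed (simp_all add: comp_vfun_def hom_def)
qed

lemma vfunctor_id:
  assumes "enriched_category V X"
  shows "vfunctor V X X (id_vfun V X)" and "gel X a \<Longrightarrow> app (id_vfun V X) a = a"
proof -
  interpret X: enriched V \<kappa> X by unfold_locales fact
  show 1: "app (id_vfun V X) a = a" if "gel X a" for a
    using that by (cases a) (simp add: app_def id_vfun_def gel_def)
  show "vfunctor V X X (id_vfun V X)"
    by (rule vfunctorI[OF assms assms]) (simp_all add: 1, simp_all add: id_vfun_def hom_def)
qed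

definition fam :: "('x, 'y, 'a) vfun \<Rightarrow> ('x, 'y, 'a) vfun \<Rightarrow> ('x \<Rightarrow> 'a) \<Rightarrow> 'x \<Rightarrow> ('y, 'a) elem" where
  "fam F G \<alpha> x = Elem (FO F x) (FO G x) (\<alpha> x)"

lemma fam_simps [simp]:
  "esrc (fam F G \<alpha> x) = FO F x" "etgt (fam F G \<alpha> x) = FO G x" "earr (fam F G \<alpha> x) = \<alpha> x"
  by (simp_all add: fam_def)

end

section \<open>Natural families and natural isomorphisms between two functors\<close>

locale functor_pair = system_of_arities V \<kappa> + F: enriched_functor V \<kappa> X Y F + G: enriched_functor V \<kappa> X Y G
  for V :: "('o, 'a, 'm) base_scheme" (structure) and \<kappa> :: "'s itself"
    and X :: "('x, 'o, 'a, 'n) vcat_scheme" and Y :: "('y, 'o, 'a, 'k) vcat_scheme" and F G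
begin

text \<open>The defining square is naturality at \<open>gen\<close>; any other element is a
  precomposition of it, and the symmetry slides past that arrow by its own naturality. The symmetry
  is present because the parameter \<open>W\<close> comes first on one side and last on the
  other.\<close>

lemma vnatural_iff:
  "vnatural V X Y F G W \<alpha> \<longleftrightarrow> W \<in> Obj V \<and>
     (\<forall>x \<in> EOb X. gel Y (fam F G \<alpha> x) \<and> dm (fam F G \<alpha> x) = W) \<and>
     (\<forall>t. gel X t \<longrightarrow> fam F G \<alpha> (etgt t) \<star>[Y] app F t = (app G t \<star>[Y] fam F G \<alpha> (esrc t)) \<lhd> Swap V W (dm t))"
    (is "_ \<longleftrightarrow> _ \<and> ?B \<and> ?C")
proof -
  let ?N = "\<lambda>x y. EComp Y (FO F x) (FO F y) (FO G y) \<cdot> (\<alpha> y \<odot> FH F x y) =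
        EComp Y (FO F x) (FO G x) (FO G y) \<cdot> (FH G x y \<odot> \<alpha> x) \<cdot> Swap V W (EHom X x y)"
  have B: "?B \<longleftrightarrow> (\<forall>x \<in> EOb X. \<alpha> x \<in> hom V W (EHom Y (FO F x) (FO G x)))"
    by (auto simp: gel_def hom_def)
  have "(\<forall>x \<in> EOb X. \<forall>y \<in> EOb X. ?N x y) \<longleftrightarrow> ?C" if W [simp]: "W \<in> Obj V" and ?B
  proof -
    have \<alpha> [simp]: "\<alpha> x \<in> Arr V" "Dom V (\<alpha> x) = W" "Cod V (\<alpha> x) = EHom Y (FO F x) (FO G x)" if "x \<in> EOb X" for x
      using \<open>?B\<close> that by (simp_all add: gel_def)
    show ?thesis
    proof (intro iffI allI impI ballI)
      fix t assume n: "\<forall>x \<in> EOb X. \<forall>y \<in> EOb X. ?N x y" and t: "gel X t"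
      obtain x y f where e: "t = Elem x y f" by (cases t)
      have [simp]: "x \<in> EOb X" "y \<in> EOb X" "f \<in> Arr V" "Cod V f = EHom X x y"
        using t by (simp_all add: e gel_def)
      have "EComp Y (FO F x) (FO F y) (FO G y) \<cdot> (\<alpha> y \<odot> (FH F x y \<cdot> f))
          = EComp Y (FO F x) (FO F y) (FO G y) \<cdot> ((\<alpha> y \<odot> FH F x y) \<cdot> (Ident V W \<odot> f))"
        by simp
      also have "\<dots> = (EComp Y (FO F x) (FO G x) (FO G y) \<cdot> (FH G x y \<odot> \<alpha> x) \<cdot> Swap V W (EHom X x y)) \<cdot> (Ident V W \<odot> f)"
        by (rule comp_extend) (use n in simp_all)
      also have "\<dots> = EComp Y (FO F x) (FO G x) (FO G y) \<cdot> ((FH G x y \<odot> \<alpha> x) \<cdot> ((f \<odot> Ident V W) \<cdot> Swap V W (Dom V f)))"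
        by (simp add: Swap_nat del: interchange_left)
      also have "\<dots> = EComp Y (FO F x) (FO G x) (FO G y) \<cdot> (((FH G x y \<cdot> f) \<odot> \<alpha> x) \<cdot> Swap V W (Dom V f))"
        by simp
      finally show "fam F G \<alpha> (etgt t) \<star>[Y] app F t = (app G t \<star>[Y] fam F G \<alpha> (esrc t)) \<lhd> Swap V W (dm t)"
        by (simp add: e fam_def cmp_def pre_def app_def)
    next
      fix x y assume c: ?C and [simp]: "x \<in> EOb X" "y \<in> EOb X"
      from c[rule_format, of "gen X x y"]
      show "?N x y" by (simp add: gen_def fam_def cmp_def pre_def app_def gel_def)
    qed
  qed
  then show ?thesis unfolding vnatural_def B[symmetric] by blast
qed

lemma vnatural_simps:
  assumes "vnatural V X Y F G W \<alpha>"
  shows "W \<in> Obj V" "x \<in> EOb X \<Longrightarrow> gel Y (fam F G \<alpha> x)" "x \<in> EOb X \<Longrightarrow> Dom V (\<alpha> x) = W"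
    "gel X t \<Longrightarrow> fam F G \<alpha> (etgt t) \<star>[Y] app F t = (app G t \<star>[Y] fam F G \<alpha> (esrc t)) \<lhd> Swap V W (dm t)"
  using assms unfolding vnatural_iff by auto

lemma vnatural_unit:
  assumes "vnatural V X Y F G (Unit V) \<alpha>" "gel X t"
  shows "lact Y (fam F G \<alpha> (etgt t)) (app F t) = ract Y (app G t) (fam F G \<alpha> (esrc t))"
  using vnatural_simps[OF assms(1)] assms(2) gelD(1,2)[OF assms(2)]
  by (simp add: lact_def ract_def Swap_Lun')

text \<open>Naturality at \<open>k\<close> expresses the component at the source, composed with
  \<open>app G k\<close>, by the component at the target, and \<open>app G k\<close> is cancellable
  as a cotensor. With \<open>k\<close> the projection \<open>L \<rightarrow> I\<close> of a theory,
  this is the monicity of evaluation at \<open>I\<close>.\<close>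

lemma vnatural_determined:
  assumes \<alpha>: "vnatural V X Y F G W \<alpha>" and \<beta>: "vnatural V X Y F G W \<beta>"
    and k: "gel X k" "cotens Y (app G k)" and eq: "\<alpha> (etgt k) = \<beta> (etgt k)"
  shows "\<alpha> (esrc k) = \<beta> (esrc k)"
proof -
  note s = vnatural_simps[OF \<alpha>] vnatural_simps[OF \<beta>]
  have e: "fam F G \<alpha> (etgt k) = fam F G \<beta> (etgt k)" using eq by (simp add: fam_def)
  have [simp]: "esrc k \<in> EOb X" using gelD[OF k(1)] by simp
  have "app G k \<star>[Y] fam F G \<alpha> (esrc k)
      = (fam F G \<alpha> (etgt k) \<star>[Y] app F k) \<lhd> Swap V (dm k) W"
    using s(1-3) k(1) by (simp add: s(4))
  also have "\<dots> = app G k \<star>[Y] fam F G \<beta> (esrc k)"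
    using s(1) s(6,7) k(1) by (simp add: e s(8))
  finally have "fam F G \<alpha> (esrc k) = fam F G \<beta> (esrc k)"
    by (rule F.Y.cotens_eqD[OF k(2)]) (use s in simp_all)
  then show ?thesis by (simp add: fam_def)
qed

lemma natural_isoD:
  assumes "natural_iso V X Y F G f"
  obtains g where "vnatural V X Y F G (Unit V) f" "vnatural V X Y G F (Unit V) g"
    "\<And>x. x \<in> EOb X \<Longrightarrow> enriched.inverse_el V Y (fam F G f x) (fam G F g x)"
proof -
  interpret GF: functor_pair V \<kappa> X Y G F by unfold_locales
  obtain g where f: "vnatural V X Y F G (Unit V) f" and g: "vnatural V X Y G F (Unit V) g"
    and i: "\<And>x. x \<in> EOb X \<Longrightarrow> vertical_comp V Y (FO F x) (FO G x) (FO F x) (g x) (f x) = EId Y (FO F x) \<and>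
           vertical_comp V Y (FO G x) (FO F x) (FO G x) (f x) (g x) = EId Y (FO G x)"
    using assms unfolding natural_iso_def by blast
  have "F.Y.inverse_el (fam F G f x) (fam G F g x)" if x: "x \<in> EOb X" for x
  proof -
    note s = vnatural_simps(2,3)[OF f] GF.vnatural_simps(2,3)[OF g]
    have [simp]: "f x \<in> Arr V" "g x \<in> Arr V" "Cod V (f x) = EHom Y (FO F x) (FO G x)" "Cod V (g x) = EHom Y (FO G x) (FO F x)"
      using s[OF x] gelD[of Y "fam F G f x"] gelD[of Y "fam G F g x"] by simp_all
    show ?thesis
      using s i[OF x] x unfolding F.Y.inverse_el_def vertical_comp_def
      by (simp add: lact_def cmp_def pre_def idel_def)
  qed
  then show ?thesis using that f g by blast
qed

lemma natural_isoI:
  assumes "vnatural V X Y F G (Unit V) f" "vnatural V X Y G F (Unit V) g"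
    "\<And>x. x \<in> EOb X \<Longrightarrow> enriched.inverse_el V Y (fam F G f x) (fam G F g x)"
  shows "natural_iso V X Y F G f"
proof -
  interpret GF: functor_pair V \<kappa> X Y G F by unfold_locales
  note s = vnatural_simps(2,3)[OF assms(1)] GF.vnatural_simps(2,3)[OF assms(2)]
  have "vertical_comp V Y (FO F x) (FO G x) (FO F x) (g x) (f x) = EId Y (FO F x) \<and>
           vertical_comp V Y (FO G x) (FO F x) (FO G x) (f x) (g x) = EId Y (FO G x)" if x: "x \<in> EOb X" for x
  proof -
    have [simp]: "f x \<in> Arr V" "g x \<in> Arr V" "Cod V (f x) = EHom Y (FO F x) (FO G x)" "Cod V (g x) = EHom Y (FO G x) (FO F x)"
      using s[OF x] gelD[of Y "fam F G f x"] gelD[of Y "fam G F g x"] by simp_all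
    show ?thesis
      using s(2,4)[OF x] assms(3)[OF x] x unfolding F.Y.inverse_el_def vertical_comp_def
      by (simp add: lact_def cmp_def pre_def idel_def)
  qed
  then show ?thesis using assms(1,2) unfolding natural_iso_def by blast
qed

end

section \<open>Designated cotensors and the functors \<open>[J,-]\<close>\<close>

locale cotensored = enriched V \<kappa> X
  for V :: "('o, 'a, 'm) base_scheme" (structure) and \<kappa> :: "'s itself"
    and X :: "('x, 'o, 'a, 'n) cvcat_scheme" +
  assumes cot: "has_designated_cotensors V X"
begin

definition ctu :: "'o \<Rightarrow> 'x \<Rightarrow> ('x, 'a) elem" where
  "ctu J x = Elem (Cot X J x) x (Ctu X J x)"

definition cotf :: "'o \<Rightarrow> ('x, 'x, 'a) vfun" where
  "cotf J = \<lparr>FO = Cot X J, FH = cot_map V X J\<rparr>"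

lemma ctu_cotens: "J \<in> Job V \<Longrightarrow> x \<in> EOb X \<Longrightarrow> cotens X (ctu J x)"
  using cot by (simp add: has_designated_cotensors_def is_cotensor_iff ctu_def)

lemma ctu_simps [simp]:
  "esrc (ctu J x) = Cot X J x" "etgt (ctu J x) = x" "earr (ctu J x) = Ctu X J x"
  "FO (cotf J) x = Cot X J x" "FH (cotf J) = cot_map V X J"
  by (simp_all add: ctu_def cotf_def)

lemma ctu_gel [simp]:
  assumes "J \<in> Job V" "x \<in> EOb X"
  shows "gel X (ctu J x)" "Dom V (Ctu X J x) = J" "Cot X J x \<in> EOb X"
proof -
  show 1: "gel X (ctu J x)" by (rule cotens_gel[OF ctu_cotens[OF assms]])
  show "Dom V (Ctu X J x) = J" using cot assms by (simp add: has_designated_cotensors_def is_cotensor_iff)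
  show "Cot X J x \<in> EOb X" using gelD(1)[OF 1] by simp
qed

lemma ctu_Unit: "x \<in> EOb X \<Longrightarrow> ctu (Unit V) x = idel X x" and Cot_Unit: "x \<in> EOb X \<Longrightarrow> Cot X (Unit V) x = x"
  using cot by (simp_all add: has_designated_cotensors_def ctu_def idel_def)

lemma cot_map_spec:
  assumes [simp]: "J \<in> Job V" "x \<in> EOb X" "y \<in> EOb X"
  defines "h \<equiv> Elem (Cot X J x) (Cot X J y) (cot_map V X J x y)"
  shows "gel X h" "dm h = EHom X x y"
    "ctu J y \<star>[X] h = (gen X x y \<star>[X] ctu J x) \<lhd> Swap V J (EHom X x y)"
proof -
  let ?\<phi> = "(gen X x y \<star>[X] ctu J x) \<lhd> Swap V J (EHom X x y)"
  have [simp]: "Ctu X J x \<in> Arr V" "Cod V (Ctu X J x) = EHom X (Cot X J x) x"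
    using gelD[OF ctu_gel(1), of J x] by simp_all
  have "earr ?\<phi> = EComp X (Cot X J x) x y \<cdot> (Ident V (EHom X x y) \<odot> Ctu X J x) \<cdot> Swap V J (EHom X x y)"
    by (simp add: cmp_def pre_def)
  then have cm: "cot_map V X J x y = cot_lift V X y (Cot X J y) (Ctu X J y) (Cot X J x) (EHom X x y) (earr ?\<phi>)"
    by (simp only: cot_map_def)
  show "gel X h" unfolding h_def cm by (rule cot_lift_eq(1)[OF ctu_cotens[of J y], of ?\<phi>]) simp_all
  show "dm h = EHom X x y" unfolding h_def cm by (rule cot_lift_eq(2)[OF ctu_cotens[of J y], of ?\<phi>]) simp_all
  show "ctu J y \<star>[X] h = ?\<phi>" unfolding h_def cm by (rule cot_lift_eq(3)[OF ctu_cotens[of J y], of ?\<phi>]) simp_all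
qed

text \<open>The third part is naturality of the counit. As composition with a counit is injective,
  it determines \<open>app (cotf J) t\<close>, and later facts about \<open>[J,-]\<close> are
  checked after composing with the counit.\<close>

lemma cotf_spec:
  assumes J [simp]: "J \<in> Job V" and t: "gel X t"
  shows "gel X (app (cotf J) t)" "dm (app (cotf J) t) = dm t"
    "ctu J (etgt t) \<star>[X] app (cotf J) t = (t \<star>[X] ctu J (esrc t)) \<lhd> Swap V J (dm t)"
proof -
  obtain x y f where e: "t = Elem x y f" by (cases t)
  have [simp]: "x \<in> EOb X" "y \<in> EOb X" "f \<in> Arr V" "Cod V f = EHom X x y"
    using t by (simp_all add: e gel_def)
  let ?h = "Elem (Cot X J x) (Cot X J y) (cot_map V X J x y)"
  let ?\<phi> = "(gen X x y \<star>[X] ctu J x) \<lhd> Swap V J (EHom X x y)"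
  note h = cot_map_spec[of J x y, simplified]
  note h3 = cot_map_spec(3)[of J x y]
  have app: "app (cotf J) t = ?h \<lhd> f" by (simp add: app_def pre_def e)
  show "gel X (app (cotf J) t)" "dm (app (cotf J) t) = dm t"
    unfolding app using h by (simp_all add: e)
  have t': "t = gen X x y \<lhd> f" using gel_eq_gen[OF t] by (simp add: e)
  have "ctu J y \<star>[X] (?h \<lhd> f) = ?\<phi> \<lhd> (Ident V J \<odot> f)"
    using h by (simp add: cmp_pre_right h3)
  also have "\<dots> = ((gen X x y \<lhd> f) \<star>[X] ctu J x) \<lhd> Swap V J (Dom V f)"
    by (simp add: cmp_pre_left Swap_nat)
  finally show "ctu J (etgt t) \<star>[X] app (cotf J) t = (t \<star>[X] ctu J (esrc t)) \<lhd> Swap V J (dm t)"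
    by (simp only: app t'[symmetric]) (simp add: e)
qed

lemma cotf_functor:
  assumes J [simp]: "J \<in> Job V"
  shows "vfunctor V X X (cotf J)"
proof (rule vfunctorI[OF X X])
  fix x y assume a: "x \<in> EOb X" "y \<in> EOb X"
  have "cot_map V X J x y \<in> Arr V \<and> Dom V (cot_map V X J x y) = EHom X x y \<and> Cod V (cot_map V X J x y) = EHom X (Cot X J x) (Cot X J y)"
    using cot_map_spec(1,2)[OF J a] by (simp add: gel_def)
  then show "FH (cotf J) x y \<in> hom V (EHom X x y) (EHom X (FO (cotf J) x) (FO (cotf J) y))"
    by (simp add: hom_def)
next
  fix a b assume ab: "gel X a" "gel X b" "esrc a = etgt b"
  note [simp] = cotf_spec[OF J] gelD(1,2)[OF ab(1)] gelD(1,2)[OF ab(2)] ab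
  show "app (cotf J) (a \<star>[X] b) = app (cotf J) a \<star>[X] app (cotf J) b"
  proof (rule cotens_eqD[OF ctu_cotens[of J "etgt a"]])
    have "ctu J (etgt a) \<star>[X] (app (cotf J) a \<star>[X] app (cotf J) b)
        = ((a \<star>[X] ctu J (esrc a)) \<star>[X] app (cotf J) b) \<lhd> ((Swap V J (dm a) \<odot> Ident V (dm b)) \<cdot> Assoc' J (dm a) (dm b))"
      by (simp add: cmp_assoc' cmp_pre_left)
    also have "\<dots> = (a \<star>[X] (ctu J (etgt b) \<star>[X] app (cotf J) b)) \<lhd> exch J (dm a) (dm b)"
      by (simp add: cmp_assoc exch_def del: cotf_spec(3))
    also have "\<dots> = (a \<star>[X] (b \<star>[X] ctu J (esrc b))) \<lhd> ((Ident V (dm a) \<odot> Swap V J (dm b)) \<cdot> exch J (dm a) (dm b))"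
      by (simp add: cmp_pre_right)
    also have "\<dots> = ((a \<star>[X] b) \<star>[X] ctu J (esrc b)) \<lhd> Swap V J (dm a \<otimes> dm b)"
      by (simp add: cmp_assoc' Swap_tens_right)
    finally show "ctu J (etgt a) \<star>[X] app (cotf J) (a \<star>[X] b) = ctu J (etgt a) \<star>[X] (app (cotf J) a \<star>[X] app (cotf J) b)"
      using cotf_spec(3)[OF J, of "a \<star>[X] b"] by simp
  qed simp_all
next
  fix x assume x [simp]: "x \<in> EOb X"
  show "app (cotf J) (idel X x) = idel X (FO (cotf J) x)"
  proof (rule cotens_eqD[OF ctu_cotens[of J x]])
    show "ctu J x \<star>[X] app (cotf J) (idel X x) = ctu J x \<star>[X] idel X (FO (cotf J) x)"
      using cotf_spec(3)[OF J, of "idel X x"] by (simp add: cmp_idel_left cmp_idel_right Lun_Swap)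
  qed (use cotf_spec[OF J, of "idel X x"] in simp_all)
qed simp

text \<open>Cotensors commute with each other: by \<open>key\<close>, lifting along
  \<open>[J,k]\<close> amounts to moving \<open>J\<close> past the domain of \<open>k\<close>,
  lifting along \<open>k\<close>, and then lifting along the counit.\<close>

lemma cotf_preserves:
  assumes J [simp]: "J \<in> Job V" and k: "cotens X k"
  shows "cotens X (app (cotf J) k)"
proof -
  interpret E: enriched_functor V \<kappa> X X "cotf J" by unfold_locales (rule cotf_functor[OF J])
  note [simp] = k[THEN cotens_gel] gelD(1,2)[OF k[THEN cotens_gel]]
  have key: "ctu J (etgt k) \<star>[X] (app (cotf J) k \<star>[X] h)
      = (k \<star>[X] (ctu J (esrc k) \<star>[X] h)) \<lhd> exch J (dm k) (dm h)"
    if "gel X h" "etgt h = Cot X J (esrc k)" for h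
    using that by (simp add: cmp_assoc'[of "ctu J (etgt k)"] cotf_spec(3) cmp_pre_left)
      (simp add: cmp_assoc exch_def)
  show ?thesis
  proof (rule cotensI)
    fix \<phi> W assume a: "W \<in> Obj V" "gel X \<phi>" "etgt \<phi> = etgt (app (cotf J) k)" "dm \<phi> = dm (app (cotf J) k) \<otimes> W"
    let ?p = "(ctu J (etgt k) \<star>[X] \<phi>) \<lhd> exch (dm k) J W"
    obtain h1 where h1: "gel X h1" "esrc h1 = esrc ?p" "etgt h1 = esrc k" "dm h1 = J \<otimes> W" "k \<star>[X] h1 = ?p"
      by (rule cotens_lift[OF k, of "J \<otimes> W" ?p]) (use a in simp_all)
    obtain h where h: "gel X h" "esrc h = esrc h1" "etgt h = esrc (ctu J (esrc k))" "dm h = W" "ctu J (esrc k) \<star>[X] h = h1"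
      by (rule cotens_lift[OF ctu_cotens[of J "esrc k"], of W h1]) (use a h1 in simp_all)
    have "app (cotf J) k \<star>[X] h = \<phi>"
      by (rule cotens_eqD[OF ctu_cotens[of J "etgt k"]]) (use a h h1 key[of h] in simp_all)
    then show "\<exists>h. gel X h \<and> esrc h = esrc \<phi> \<and> etgt h = esrc (app (cotf J) k) \<and> dm h = W \<and> app (cotf J) k \<star>[X] h = \<phi>"
      using h h1 by (intro exI[of _ h]) simp
  next
    fix h h' assume a: "gel X h" "gel X h'" "esrc h = esrc h'" "etgt h = esrc (app (cotf J) k)" "etgt h' = esrc (app (cotf J) k)"
      "dm h = dm h'" "app (cotf J) k \<star>[X] h = app (cotf J) k \<star>[X] h'"
    then have "(k \<star>[X] (ctu J (esrc k) \<star>[X] h)) \<lhd> exch J (dm k) (dm h') \<lhd> exch (dm k) J (dm h')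
       = (k \<star>[X] (ctu J (esrc k) \<star>[X] h')) \<lhd> exch J (dm k) (dm h') \<lhd> exch (dm k) J (dm h')"
      using key[of h] key[of h'] by simp
    then have "k \<star>[X] (ctu J (esrc k) \<star>[X] h) = k \<star>[X] (ctu J (esrc k) \<star>[X] h')"
      using a(1-6) by simp
    then have "ctu J (esrc k) \<star>[X] h = ctu J (esrc k) \<star>[X] h'"
      by (rule cotens_eqD[OF k]) (use a(1-6) in simp_all)
    then show "h = h'"
      by (rule cotens_eqD[OF ctu_cotens[OF J gelD(1)[OF cotens_gel[OF k]]]]) (use a(1-6) in simp_all)
  qed simp
qed

lemma cotf_Unit:
  assumes t [simp]: "gel X t"
  shows "app (cotf (Unit V)) t = t"
proof -
  note [simp] = gelD(1,2)[OF t] Job_unit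
  note s = cotf_spec[OF Job_unit t]
  show ?thesis
  proof (rule cotens_eqD[OF cotens_idel[of "etgt t"]])
    show "idel X (etgt t) \<star>[X] app (cotf (Unit V)) t = idel X (etgt t) \<star>[X] t"
      using s(3) by (simp add: ctu_Unit cmp_idel_left cmp_idel_right Run_Swap)
  qed (use s in \<open>simp_all add: Cot_Unit\<close>)
qed

end

locale algebra_functor = cotensored V \<kappa> X + A: enriched_functor V \<kappa> T X A
  for V :: "('o, 'a, 'm) base_scheme" (structure) and \<kappa> :: "'s itself"
    and T :: "('t, 'o, 'a, 'k) vcat_scheme" and X :: "('x, 'o, 'a, 'n) cvcat_scheme" and A
begin

lemma FO_cot_vfun [simp]: "FO (cot_vfun V X J A) x = Cot X J (FO A x)"
  by (simp add: cot_vfun_def)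

lemma cot_vfun_eq: "cot_vfun V X J A = comp_vfun V (cotf J) A"
  by (simp add: cot_vfun_def comp_vfun_def)

lemma cot_vfun_functor: "J \<in> Job V \<Longrightarrow> vfunctor V T X (cot_vfun V X J A)"
  unfolding cot_vfun_eq by (rule vfunctor_comp[OF A.X.X X X A.F cotf_functor])

lemma app_cot_vfun: "J \<in> Job V \<Longrightarrow> gel T t \<Longrightarrow> app (cot_vfun V X J A) t = app (cotf J) (app A t)"
  unfolding cot_vfun_eq by (rule vfunctor_comp[OF A.X.X X X A.F cotf_functor])

lemma app_cot_vfun_Unit: "gel T t \<Longrightarrow> app (cot_vfun V X (Unit V) A) t = app A t"
  using app_cot_vfun[OF Job_unit] cotf_Unit by simp

lemma cot_vfun_algebra:
  assumes "preserves_cotensors V T X A" "J \<in> Job V"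
  shows "algebra V T X (cot_vfun V X J A)"
proof -
  have "cotens X (app (cotf J) (app A e))" if "cotens T e" "dm e \<in> Job V" for e
    using assms that preserves_cotensors_iff[OF A.X.X X A.F] cotf_preserves by blast
  then have "preserves_cotensors V T X (cot_vfun V X J A)"
    using preserves_cotensors_iff[OF A.X.X X cot_vfun_functor[OF assms(2)]] app_cot_vfun[OF assms(2)]
      cotens_gel by metis
  then show ?thesis using cot_vfun_functor[OF assms(2)] by (simp add: algebra_def)
qed

end

section \<open>Theories\<close>

context system_of_arities
begin

lemma Jop_simps [simp]:
  "EOb (Jop V) = Job V" "EHom (Jop V) J K = IHom V K J" "EId (Jop V) J = curry_arr V (Unit V) J J (Lun V J)"
  by (simp_all add: Jop_def)

lemma Job_closed [simp]: "Unit V \<in> Job V" "J \<in> Job V \<Longrightarrow> K \<in> Job V \<Longrightarrow> J \<otimes> K \<in> Job V"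
  by (simp_all add: Job_unit Job_tens)

lemma Jop_EComp [simp]:
  assumes "J \<in> Job V" "K \<in> Job V" "L \<in> Job V"
  shows "EComp (Jop V) J K L \<in> Arr V" "Dom V (EComp (Jop V) J K L) = IHom V L K \<otimes> IHom V K J"
    "Cod V (EComp (Jop V) J K L) = IHom V L J"
  using assms by (simp_all add: Jop_def)

lemma Jop_comp_Ev:
  assumes [simp]: "J \<in> Job V" "K \<in> Job V" "L \<in> Job V"
    and [simp]: "a \<in> Arr V" "Cod V a = IHom V L K" "b \<in> Arr V" "Cod V b = IHom V K J"
  shows "Ev V L J \<cdot> ((EComp (Jop V) J K L \<cdot> (a \<odot> b)) \<odot> Ident V L)
    = Ev V K J \<cdot> ((b \<odot> (Ev V L K \<cdot> (a \<odot> Ident V L))) \<cdot>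
        (Assoc V (Dom V b) (Dom V a) L \<cdot> (Swap V (Dom V a) (Dom V b) \<odot> Ident V L)))"
proof -
  let ?c = "Ev V K J \<cdot> ((Ident V (IHom V K J) \<odot> Ev V L K) \<cdot> (Assoc V (IHom V K J) (IHom V L K) L \<cdot>
         (Swap V (IHom V L K) (IHom V K J) \<odot> Ident V L)))"
  have "EComp (Jop V) J K L = curry_arr V (IHom V L K \<otimes> IHom V K J) L J ?c"
    by (simp add: Jop_def)
  then have c: "Ev V L J \<cdot> (EComp (Jop V) J K L \<odot> Ident V L) = ?c"
    by simp
  have "Ev V L J \<cdot> ((EComp (Jop V) J K L \<cdot> (a \<odot> b)) \<odot> Ident V L)
      = Ev V L J \<cdot> ((EComp (Jop V) J K L \<odot> Ident V L) \<cdot> ((a \<odot> b) \<odot> Ident V L))"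
    by simp
  also have "\<dots> = ?c \<cdot> ((a \<odot> b) \<odot> Ident V L)"
    by (rule comp_extend[OF c]) simp_all
  also have "\<dots> = Ev V K J \<cdot> ((Ident V (IHom V K J) \<odot> Ev V L K) \<cdot> (Assoc V (IHom V K J) (IHom V L K) L \<cdot>
         (((b \<odot> a) \<odot> Ident V L) \<cdot> (Swap V (Dom V a) (Dom V b) \<odot> Ident V L))))"
    by (simp add: Swap_nat)
  also have "\<dots> = Ev V K J \<cdot> ((Ident V (IHom V K J) \<odot> Ev V L K) \<cdot> ((b \<odot> (a \<odot> Ident V L)) \<cdot>
      (Assoc V (Dom V b) (Dom V a) L \<cdot> (Swap V (Dom V a) (Dom V b) \<odot> Ident V L))))"
    by (subst Assoc_nat_extend) simp_all
  also have "\<dots> = Ev V K J \<cdot> ((b \<odot> (Ev V L K \<cdot> (a \<odot> Ident V L))) \<cdot>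
        (Assoc V (Dom V b) (Dom V a) L \<cdot> (Swap V (Dom V a) (Dom V b) \<odot> Ident V L)))"
    by simp
  finally show ?thesis .
qed

text \<open>Double currying, \<open>[J \<otimes> K, Y] \<cong> [J,[K,Y]]\<close>, transported along
  \<open>p\<close>. With \<open>p\<close> the right unit isomorphism it gives \<open>J\<close> as
  \<open>[J,I]\<close>, and with \<open>p\<close> an identity it gives \<open>J \<otimes> K\<close>
  as \<open>[J,K]\<close>.\<close>

lemma Jop_cotensor:
  assumes [simp]: "J \<in> Job V" "K \<in> Job V" "P \<in> Job V"
    and p [simp]: "p \<in> Arr V" "Dom V p = J \<otimes> K" "Cod V p = P" "iso V p"
  shows "is_cotensor V (Jop V) J K P (curry_arr V J K P p)"
proof -
  let ?k = "curry_arr V J K P p" and ?p' = "inverse_arr V p"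
  note p' = inverse_arr_simps[OF p(4), simplified]
  have "iso V (curry_arr V (IHom V P Y) J (IHom V K Y)
        (EComp (Jop V) Y P K \<cdot> (?k \<odot> Ident V (IHom V P Y)) \<cdot> Swap V (IHom V P Y) J))"
    if Y [simp]: "Y \<in> Job V" for Y
  proof -
    let ?q = "EComp (Jop V) Y P K \<cdot> (?k \<odot> Ident V (IHom V P Y)) \<cdot> Swap V (IHom V P Y) J"
    let ?m = "curry_arr V (IHom V P Y) J (IHom V K Y) ?q"
    let ?H = "IHom V J (IHom V K Y)"
    \<comment> \<open>Uncurried form of the inverse: split \<open>P\<close> as
      \<open>J \<otimes> K\<close> by the inverse of \<open>p\<close>, then evaluate at
      \<open>J\<close> and at \<open>K\<close>.\<close>
    let ?r = "Ev V K Y \<cdot> ((Ev V J (IHom V K Y) \<odot> Ident V K) \<cdot> (Assoc' ?H J K \<cdot> (Ident V ?H \<odot> ?p')))"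
    let ?n = "curry_arr V ?H P Y ?r"
    have m [simp]: "?m \<in> Arr V" "Dom V ?m = IHom V P Y" "Cod V ?m = ?H"
      by simp_all
    have m': "Ev V J (IHom V K Y) \<cdot> (?m \<odot> Ident V J) = ?q" by simp
    have n [simp]: "?n \<in> Arr V" "Dom V ?n = ?H" "Cod V ?n = IHom V P Y" "Ev V P Y \<cdot> (?n \<odot> Ident V P) = ?r"
      using p' by simp_all
    have "Ev V K Y \<cdot> (?q \<odot> Ident V K)
        = Ev V K Y \<cdot> (((EComp (Jop V) Y P K \<cdot> (?k \<odot> Ident V (IHom V P Y))) \<odot> Ident V K) \<cdot> (Swap V (IHom V P Y) J \<odot> Ident V K))"
      by simp
    also have "\<dots> = (Ev V P Y \<cdot> ((Ident V (IHom V P Y) \<odot> (Ev V K P \<cdot> (?k \<odot> Ident V K))) \<cdot>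
        (Assoc V (IHom V P Y) J K \<cdot> (Swap V J (IHom V P Y) \<odot> Ident V K)))) \<cdot> (Swap V (IHom V P Y) J \<odot> Ident V K)"
      by (rule comp_extend[OF Jop_comp_Ev[where a = ?k and b = "Ident V (IHom V P Y)", THEN trans]]) simp_all
    also have "\<dots> = Ev V P Y \<cdot> ((Ident V (IHom V P Y) \<odot> p) \<cdot> Assoc V (IHom V P Y) J K)"
      by simp
    finally have q: "Ev V K Y \<cdot> (?q \<odot> Ident V K) = Ev V P Y \<cdot> ((Ident V (IHom V P Y) \<odot> p) \<cdot> Assoc V (IHom V P Y) J K)" .
    have q_dom [simp]: "?q \<in> Arr V" "Dom V ?q = IHom V P Y \<otimes> J" "Cod V ?q = IHom V K Y" by simp_all
    have "Ev V P Y \<cdot> ((?n \<cdot> ?m) \<odot> Ident V P) = Ev V P Y \<cdot> ((?n \<odot> Ident V P) \<cdot> (?m \<odot> Ident V P))"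
      by simp
    also have "\<dots> = ?r \<cdot> (?m \<odot> Ident V P)"
      by (rule comp_extend[OF n(4)]) simp_all
    also have "\<dots> = Ev V K Y \<cdot> ((Ev V J (IHom V K Y) \<odot> Ident V K) \<cdot> (Assoc' ?H J K \<cdot> ((?m \<odot> Ident V (J \<otimes> K)) \<cdot> (Ident V (IHom V P Y) \<odot> ?p'))))"
      using p' by simp
    also have "Assoc' ?H J K \<cdot> ((?m \<odot> Ident V (J \<otimes> K)) \<cdot> (Ident V (IHom V P Y) \<odot> ?p'))
        = ((?m \<odot> Ident V J) \<odot> Ident V K) \<cdot> (Assoc' (IHom V P Y) J K \<cdot> (Ident V (IHom V P Y) \<odot> ?p'))"
    proof (rule iso_cancel_left[of "Assoc V ?H J K"])
      show "Assoc V ?H J K \<cdot> (Assoc' ?H J K \<cdot> ((?m \<odot> Ident V (J \<otimes> K)) \<cdot> (Ident V (IHom V P Y) \<odot> ?p')))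
        = Assoc V ?H J K \<cdot> (((?m \<odot> Ident V J) \<odot> Ident V K) \<cdot> (Assoc' (IHom V P Y) J K \<cdot> (Ident V (IHom V P Y) \<odot> ?p')))"
        using p' by (subst Assoc_nat_extend) simp_all
    qed (use p' in simp_all)
    also have "Ev V K Y \<cdot> ((Ev V J (IHom V K Y) \<odot> Ident V K) \<cdot> (((?m \<odot> Ident V J) \<odot> Ident V K) \<cdot> (Assoc' (IHom V P Y) J K \<cdot> (Ident V (IHom V P Y) \<odot> ?p'))))
        = Ev V K Y \<cdot> ((?q \<odot> Ident V K) \<cdot> (Assoc' (IHom V P Y) J K \<cdot> (Ident V (IHom V P Y) \<odot> ?p')))"
      using p' by (subst interchange_left) (simp_all only: m', simp_all)
    also have "\<dots> = (Ev V P Y \<cdot> ((Ident V (IHom V P Y) \<odot> p) \<cdot> Assoc V (IHom V P Y) J K)) \<cdot> (Assoc' (IHom V P Y) J K \<cdot> (Ident V (IHom V P Y) \<odot> ?p'))"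
      by (rule comp_extend[OF q]) (use p' in simp_all)
    also have "\<dots> = Ev V P Y \<cdot> (Ident V (IHom V P Y) \<odot> Ident V P)"
      using p' by simp
    finally have 1: "?n \<cdot> ?m = Ident V (IHom V P Y)"
      by (rule uncurry_eqD[rotated -1]) simp_all
    have "Ev V K Y \<cdot> ((Ev V J (IHom V K Y) \<cdot> ((?m \<cdot> ?n) \<odot> Ident V J)) \<odot> Ident V K)
        = Ev V K Y \<cdot> ((Ev V J (IHom V K Y) \<cdot> ((?m \<odot> Ident V J) \<cdot> (?n \<odot> Ident V J))) \<odot> Ident V K)"
      by simp
    also have "Ev V J (IHom V K Y) \<cdot> ((?m \<odot> Ident V J) \<cdot> (?n \<odot> Ident V J)) = ?q \<cdot> (?n \<odot> Ident V J)"
      by (rule comp_extend[OF m']) simp_all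
    also have "Ev V K Y \<cdot> ((?q \<cdot> (?n \<odot> Ident V J)) \<odot> Ident V K) = Ev V K Y \<cdot> ((?q \<odot> Ident V K) \<cdot> ((?n \<odot> Ident V J) \<odot> Ident V K))"
      by simp
    also have "\<dots> = (Ev V P Y \<cdot> ((Ident V (IHom V P Y) \<odot> p) \<cdot> Assoc V (IHom V P Y) J K)) \<cdot> ((?n \<odot> Ident V J) \<odot> Ident V K)"
      by (rule comp_extend[OF q]) simp_all
    also have "\<dots> = Ev V P Y \<cdot> ((?n \<odot> Ident V P) \<cdot> ((Ident V ?H \<odot> p) \<cdot> Assoc V ?H J K))"
      by (simp add: Assoc_nat)
    also have "\<dots> = ?r \<cdot> ((Ident V ?H \<odot> p) \<cdot> Assoc V ?H J K)"
      by (rule comp_extend[OF n(4)]) simp_all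
    also have "\<dots> = Ev V K Y \<cdot> (Ev V J (IHom V K Y) \<odot> Ident V K)"
      using p' by simp
    finally have "Ev V J (IHom V K Y) \<cdot> ((?m \<cdot> ?n) \<odot> Ident V J) = Ev V J (IHom V K Y)"
      by (rule uncurry_eqD[rotated -1]) simp_all
    then have 2: "?m \<cdot> ?n = Ident V ?H"
      by (intro uncurry_eqD[of J "IHom V K Y" "?m \<cdot> ?n" "Ident V ?H"]) simp_all
    show ?thesis using 1 2 by (intro isoI[of ?m ?n]) simp_all
  qed
  then show ?thesis by (simp add: is_cotensor_def hom_def)
qed

text \<open>The element that exhibits \<open>L\<close> as \<open>[L,I]\<close>: the projection
  \<open>L \<rightarrow> I\<close> of the overview.\<close>

definition structure_el :: "('o, 'a) vtheory \<Rightarrow> 'o \<Rightarrow> ('o, 'a) elem" where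
  "structure_el T L = Elem L (Unit V) (structure_arr V T L)"

lemma structure_el_simps [simp]:
  "esrc (structure_el T L) = L" "etgt (structure_el T L) = Unit V" "earr (structure_el T L) = structure_arr V T L"
  by (simp_all add: structure_el_def)

definition tau_el :: "('o, 'a) vtheory \<Rightarrow> 'o \<Rightarrow> 'o \<Rightarrow> ('o, 'a) elem" where
  "tau_el T J K = Elem J K (Tau T J K)"

lemma theory_cvcat_simps [simp]:
  "EOb (theory_cvcat V T) = EOb T" "EHom (theory_cvcat V T) = EHom T"
  "EComp (theory_cvcat V T) = EComp T" "EId (theory_cvcat V T) = EId T"
  by (simp_all add: theory_cvcat_def)

lemma Cot_theory_Unit [simp]: "Cot (theory_cvcat V T) J (Unit V) = J"
  by (simp add: theory_cvcat_def)

lemma enriched_theory_cvcat: "enriched_category V (theory_cvcat V T) \<longleftrightarrow> enriched_category V T"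
  by (simp add: enriched_category_def)

lemma vfunctor_theory_cvcat:
  "vfunctor V (theory_cvcat V T) Y F \<longleftrightarrow> vfunctor V T Y F"
  "vfunctor V Y (theory_cvcat V T) G \<longleftrightarrow> vfunctor V Y T G"
  by (simp_all add: vfunctor_def)

lemma gel_theory_cvcat: "gel (theory_cvcat V T) a \<longleftrightarrow> gel T a"
  by (simp add: gel_def)

lemma cotens_theory_cvcat: "cotens (theory_cvcat V T) e \<longleftrightarrow> cotens T e"
  by (simp add: cotens_def gel_def cmp_def)

context
  fixes T :: "('o, 'a) vtheory"
  assumes th: "theory_enlarged V T"
begin

lemma theory_EOb: "EOb T = Job V" and theory_enriched: "enriched_category V T"
  using th by (simp_all add: theory_enlarged_def)

lemma structure_el_cotens: "L \<in> Job V \<Longrightarrow> cotens T (structure_el T L)" "L \<in> Job V \<Longrightarrow> dm (structure_el T L) = L"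
proof -
  interpret enriched V \<kappa> T by unfold_locales (rule theory_enriched)
  assume [simp]: "L \<in> Job V"
  have "is_cotensor V (Jop V) L (Unit V) L (curry_arr V L (Unit V) L (Run V L))"
    by (rule Jop_cotensor) simp_all
  then have "is_cotensor V T L (Unit V) L (structure_arr V T L)"
    using th unfolding theory_enlarged_def preserves_cotensors_def structure_arr_def
    by (metis Job_closed(1) \<open>L \<in> Job V\<close> vfun.select_convs)
  then show "cotens T (structure_el T L)" "dm (structure_el T L) = L"
    by (simp_all add: is_cotensor_iff structure_el_def)
qed

lemma Tau_simps:
  assumes "J \<in> Job V" "K \<in> Job V"
  shows "Tau T J K \<in> Arr V" "Dom V (Tau T J K) = IHom V K J" "Cod V (Tau T J K) = EHom T J K"
  using th assms by (simp_all add: theory_enlarged_def vfunctor_def hom_def)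

lemma structure_el_Unit: "structure_el T (Unit V) = idel T (Unit V)"
proof -
  have "Tau T (Unit V) (Unit V) \<cdot> EId (Jop V) (Unit V) = EId T (Unit V)"
    using th by (simp add: theory_enlarged_def vfunctor_def)
  then show ?thesis by (simp add: structure_el_def idel_def structure_arr_def Lun_Unit)
qed

text \<open>Functoriality of \<open>Tau\<close> reduces this to a computation in \<open>Jop\<close>.
  As the projection is cancellable, the equation determines \<open>Tau\<close>; it has the form of
  the definite description in \<open>theory_of_structure\<close>, so that the structures of two
  theories can be compared by it.\<close>

lemma structure_el_Tau:
  assumes [simp]: "J \<in> Job V" "K \<in> Job V"
  shows "gel T (tau_el T J K)" "dm (tau_el T J K) = IHom V K J"
    "structure_el T K \<star>[T] tau_el T J K = structure_el T J \<lhd> (Ev V K J \<cdot> Swap V K (IHom V K J))"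
proof -
  interpret enriched V \<kappa> T by unfold_locales (rule theory_enriched)
  note [simp] = Tau_simps theory_EOb
  show "gel T (tau_el T J K)" "dm (tau_el T J K) = IHom V K J"
    by (simp_all add: tau_el_def gel_def)
  let ?I = "Unit V"
  let ?e = "\<lambda>J. curry_arr V J ?I J (Run V J)"
  have f: "Tau T J ?I \<cdot> EComp (Jop V) J K ?I = EComp T J K ?I \<cdot> (Tau T K ?I \<odot> Tau T J K)"
    using th by (simp add: theory_enlarged_def vfunctor_def)
  have "EComp (Jop V) J K ?I \<cdot> (?e K \<odot> Ident V (IHom V K J)) = ?e J \<cdot> (Ev V K J \<cdot> Swap V K (IHom V K J))"
  proof (rule uncurry_eqD[of ?I J])
    have "Ev V ?I J \<cdot> ((EComp (Jop V) J K ?I \<cdot> (?e K \<odot> Ident V (IHom V K J))) \<odot> Ident V ?I)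
       = Ev V K J \<cdot> ((Ident V (IHom V K J) \<odot> Run V K) \<cdot> (Assoc V (IHom V K J) K ?I \<cdot> (Swap V K (IHom V K J) \<odot> Ident V ?I)))"
      by (subst Jop_comp_Ev) simp_all
    also have "\<dots> = Ev V K J \<cdot> (Run V (IHom V K J \<otimes> K) \<cdot> (Swap V K (IHom V K J) \<odot> Ident V ?I))"
      by (subst comp_extend[OF Run_tens]) simp_all
    also have "\<dots> = (Ev V K J \<cdot> Swap V K (IHom V K J)) \<cdot> Run V (K \<otimes> IHom V K J)"
      by (simp add: Run_nat)
    also have "\<dots> = Run V J \<cdot> ((Ev V K J \<cdot> Swap V K (IHom V K J)) \<odot> Ident V ?I)"
      by (subst Run_nat) simp_all
    also have "\<dots> = Ev V ?I J \<cdot> ((?e J \<odot> Ident V ?I) \<cdot> ((Ev V K J \<cdot> Swap V K (IHom V K J)) \<odot> Ident V ?I))"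
      by (rule comp_extend[symmetric]) simp_all
    also have "\<dots> = Ev V ?I J \<cdot> ((?e J \<cdot> (Ev V K J \<cdot> Swap V K (IHom V K J))) \<odot> Ident V ?I)"
      by simp
    finally show "Ev V ?I J \<cdot> ((EComp (Jop V) J K ?I \<cdot> (?e K \<odot> Ident V (IHom V K J))) \<odot> Ident V ?I)
      = Ev V ?I J \<cdot> ((?e J \<cdot> (Ev V K J \<cdot> Swap V K (IHom V K J))) \<odot> Ident V ?I)" .
  qed simp_all
  then have "Tau T J ?I \<cdot> (EComp (Jop V) J K ?I \<cdot> (?e K \<odot> Ident V (IHom V K J)))
      = (Tau T J ?I \<cdot> ?e J) \<cdot> (Ev V K J \<cdot> Swap V K (IHom V K J))"
    by simp
  also have "Tau T J ?I \<cdot> (EComp (Jop V) J K ?I \<cdot> (?e K \<odot> Ident V (IHom V K J)))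
      = EComp T J K ?I \<cdot> ((Tau T K ?I \<cdot> ?e K) \<odot> Tau T J K)"
    by (subst comp_extend[OF f]) simp_all
  finally show "structure_el T K \<star>[T] tau_el T J K = structure_el T J \<lhd> (Ev V K J \<cdot> Swap V K (IHom V K J))"
    by (simp only: cmp_def pre_def structure_el_def tau_el_def structure_arr_def elem.sel)
qed

text \<open>The three cases are those in the definition of \<open>Ctu\<close>: an identity, a
  projection, and the image under \<open>Tau\<close> of a cotensor of arities.\<close>

lemma theory_cvcat_cotensored: "cotensored V \<kappa> (theory_cvcat V T)"
proof -
  interpret S: enriched V \<kappa> "theory_cvcat V T"
    by unfold_locales (simp add: enriched_theory_cvcat theory_enriched)
  have "is_cotensor V (theory_cvcat V T) J x (Cot (theory_cvcat V T) J x) (Ctu (theory_cvcat V T) J x)"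
    if [simp]: "J \<in> Job V" "x \<in> Job V" for J x
  proof -
    consider "J = Unit V" | "J \<noteq> Unit V" "x = Unit V" | "J \<noteq> Unit V" "x \<noteq> Unit V" by blast
    then show ?thesis
    proof cases
      case 1
      have "x \<in> EOb (theory_cvcat V T)" by (simp add: theory_EOb)
      from S.cotens_idel[OF this] S.EId_simps(2)[OF this] show ?thesis
        by (simp add: S.is_cotensor_iff 1 idel_def) (simp add: theory_cvcat_def)
    next
      case 2
      then show ?thesis using structure_el_cotens[of J]
        by (simp add: S.is_cotensor_iff cotens_theory_cvcat) (simp add: theory_cvcat_def structure_el_def)
    next
      case 3
      have "is_cotensor V (Jop V) J x (J \<otimes> x) (curry_arr V J x (J \<otimes> x) (Ident V (J \<otimes> x)))"
        by (rule Jop_cotensor) (simp_all add: iso_Ident)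
      then have "is_cotensor V T J x (J \<otimes> x) (Tau T (J \<otimes> x) x \<cdot> curry_arr V J x (J \<otimes> x) (Ident V (J \<otimes> x)))"
        using th unfolding theory_enlarged_def preserves_cotensors_def
        by (metis that(1) vfun.select_convs)
      then show ?thesis using 3 by (simp add: is_cotensor_def) (simp add: theory_cvcat_def)
    qed
  qed
  then have "has_designated_cotensors V (theory_cvcat V T)"
    unfolding has_designated_cotensors_def theory_cvcat_simps theory_EOb
    by (auto simp: theory_cvcat_def)
  then show ?thesis by unfold_locales
qed

text \<open>An object \<open>c\<close> that is a cotensor \<open>[J,x]\<close> in a theory is also a cotensor \<open>[x \<otimes> J, I]\<close>,
  because \<open>x\<close> is \<open>[x,I]\<close>. So it is isomorphic to the object \<open>x \<otimes> J\<close>, and only the cotensors of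
  \<open>I\<close> have to be considered.\<close>

lemma preserves_cotensors_from_structure:
  assumes X: "enriched_category V X" and F: "vfunctor V T X F"
    and s: "\<And>L. L \<in> Job V \<Longrightarrow> cotens X (app F (structure_el T L))"
  shows "preserves_cotensors V T X F"
proof -
  interpret T: enriched V \<kappa> T by unfold_locales (rule theory_enriched)
  interpret X: enriched V \<kappa> X by unfold_locales fact
  interpret F: enriched_functor V \<kappa> T X F by unfold_locales fact
  note [simp] = structure_el_cotens structure_el_cotens(1)[THEN cotens_gel]
  show ?thesis
    unfolding preserves_cotensors_iff[OF theory_enriched X F]
  proof (intro allI impI)
    fix e assume e: "cotens T e" and J [simp]: "dm e \<in> Job V"
    note [simp] = e[THEN cotens_gel]
    have x [simp]: "etgt e \<in> Job V" using gelD(2)[of T e] by (simp add: theory_EOb)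
    have c: "cotens T (structure_el T (etgt e) \<star>[T] e)"
      by (rule T.cotens_cmp) (use e in simp_all)
    have s': "cotens T (structure_el T (etgt e \<otimes> dm e))" by simp
    obtain j i where j: "T.inverse_el j i" "etgt j = esrc (structure_el T (etgt e \<otimes> dm e))"
        "ract T (structure_el T (etgt e \<otimes> dm e)) j = structure_el T (etgt e) \<star>[T] e"
      by (rule T.cotens_unique[OF s' c]) (simp_all del: structure_el_simps(3))
    have [simp]: "gel T j" "gel T i" "dm j = Unit V" "dm i = Unit V" "esrc j = etgt i" "esrc i = etgt j"
      using j(1) by (simp_all add: T.inverse_el_def)
    have "X.inverse_el (app F j) (app F i)"
      using j(1) gelD(2)[of T i] gelD(2)[of T j] unfolding T.inverse_el_def X.inverse_el_def
      by (simp add: F.app_idel flip: F.app_lact)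
    from X.cotens_ract[OF s this] have "cotens X (ract X (app F (structure_el T (etgt e \<otimes> dm e))) (app F j))"
      using j(2) by simp
    also have "ract X (app F (structure_el T (etgt e \<otimes> dm e))) (app F j) = app F (structure_el T (etgt e)) \<star>[X] app F e"
      using j(2) by (simp add: j(3) F.app_cmp flip: F.app_ract)
    finally show "cotens X (app F e)"
      by (rule X.cotens_cmp_cancel[OF s, rotated -1]) simp_all
  qed
qed

end

lemma theory_morphismD:
  assumes "theory_morphism V T U M"
  shows "vfunctor V T U M" "J \<in> Job V \<Longrightarrow> FO M J = J"
    "J \<in> Job V \<Longrightarrow> K \<in> Job V \<Longrightarrow> FH M J K \<cdot> Tau T J K = Tau U J K"
  using assms by (auto simp: theory_morphism_def functor_eq_def comp_vfun_def)

lemma theory_morphism_structure_el: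
  assumes T: "theory_enlarged V T" and M: "theory_morphism V T U M" and L [simp]: "L \<in> Job V"
  shows "app M (structure_el T L) = structure_el U L"
proof -
  note m = theory_morphismD[OF M]
  have "FH M L (Unit V) \<in> hom V (EHom T L (Unit V)) (EHom U (FO M L) (FO M (Unit V)))"
    using m(1) theory_EOb[OF T] by (simp add: vfunctor_def)
  then have "FH M L (Unit V) \<cdot> (Tau T L (Unit V) \<cdot> curry_arr V L (Unit V) L (Run V L))
     = Tau U L (Unit V) \<cdot> curry_arr V L (Unit V) L (Run V L)"
    using m(3)[OF L, of "Unit V"] by (subst comp_extend) (simp_all add: Tau_simps[OF T] hom_def)
  then show ?thesis using m(2) by (simp add: app_def structure_el_def structure_arr_def)
qed

end

section \<open>Commutants\<close>

context functor_pair
begin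

lemma vnatural_pre:
  assumes n: "vnatural V X Y F G W \<alpha>" and [simp]: "p \<in> Arr V" "Cod V p = W"
  shows "vnatural V X Y F G (Dom V p) (\<lambda>x. \<alpha> x \<cdot> p)"
proof -
  note s [simp] = vnatural_simps(1-3)[OF n]
  have f: "fam F G (\<lambda>x. \<alpha> x \<cdot> p) x = fam F G \<alpha> x \<lhd> p" for x
    by (simp add: fam_def pre_def)
  show ?thesis
    unfolding vnatural_iff f
  proof (intro conjI ballI allI impI)
    fix t assume t: "gel X t"
    note [simp] = t gelD(1,2)[OF t]
    show "(fam F G \<alpha> (etgt t) \<lhd> p) \<star>[Y] app F t = (app G t \<star>[Y] (fam F G \<alpha> (esrc t) \<lhd> p)) \<lhd> Swap V (Dom V p) (dm t)"
      by (simp add: F.Y.cmp_pre_left F.Y.cmp_pre_right vnatural_simps(4)[OF n] Swap_nat)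
  qed simp_all
qed

text \<open>For \<open>W = I\<close> the symmetry turns the left unit isomorphism into the right one
  (\<open>Swap_Lun'\<close>), and naturality becomes an equation without coherence arrows.\<close>

lemma vnatural_unit_iff:
  "vnatural V X Y F G (Unit V) \<alpha> \<longleftrightarrow>
     (\<forall>x \<in> EOb X. gel Y (fam F G \<alpha> x) \<and> dm (fam F G \<alpha> x) = Unit V) \<and>
     (\<forall>t. gel X t \<longrightarrow> lact Y (fam F G \<alpha> (etgt t)) (app F t) = ract Y (app G t) (fam F G \<alpha> (esrc t)))"
    (is "_ \<longleftrightarrow> ?A \<and> ?B")
proof -
  have "(fam F G \<alpha> (etgt t) \<star>[Y] app F t = (app G t \<star>[Y] fam F G \<alpha> (esrc t)) \<lhd> Swap V (Unit V) (dm t))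
      \<longleftrightarrow> lact Y (fam F G \<alpha> (etgt t)) (app F t) = ract Y (app G t) (fam F G \<alpha> (esrc t))"
    if A: ?A and t: "gel X t" for t
  proof -
    note [simp] = t gelD(1,2)[OF t]
    have [simp]: "gel Y (fam F G \<alpha> (etgt t))" "gel Y (fam F G \<alpha> (esrc t))"
      "Dom V (\<alpha> (etgt t)) = Unit V" "Dom V (\<alpha> (esrc t)) = Unit V"
      using A[rule_format, of "etgt t"] A[rule_format, of "esrc t"] by simp_all
    show ?thesis
    proof
      assume "fam F G \<alpha> (etgt t) \<star>[Y] app F t = (app G t \<star>[Y] fam F G \<alpha> (esrc t)) \<lhd> Swap V (Unit V) (dm t)"
      then show "lact Y (fam F G \<alpha> (etgt t)) (app F t) = ract Y (app G t) (fam F G \<alpha> (esrc t))"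
        by (simp add: lact_def ract_def Swap_Lun')
    next
      assume l: "lact Y (fam F G \<alpha> (etgt t)) (app F t) = ract Y (app G t) (fam F G \<alpha> (esrc t))"
      have "(fam F G \<alpha> (etgt t) \<star>[Y] app F t) \<lhd> Lun' (dm t) \<lhd> Lun V (dm t)
        = (app G t \<star>[Y] fam F G \<alpha> (esrc t)) \<lhd> Run' (dm t) \<lhd> Lun V (dm t)"
        using l by (simp add: lact_def ract_def del: F.Y.pre_pre)
      then show "fam F G \<alpha> (etgt t) \<star>[Y] app F t = (app G t \<star>[Y] fam F G \<alpha> (esrc t)) \<lhd> Swap V (Unit V) (dm t)"
        by (simp flip: Swap_Lun')
    qed
  qed
  then show ?thesis unfolding vnatural_iff using unit by blast
qed

end

context enriched_functor
begin

lemma vnatural_idel: "vnatural V X Y F F (Unit V) (\<lambda>x. EId Y (FO F x))"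
proof -
  interpret FF: functor_pair V \<kappa> X Y F F by unfold_locales
  have f: "fam F F (\<lambda>x. EId Y (FO F x)) x = idel Y (FO F x)" for x
    by (simp add: fam_def idel_def)
  show ?thesis unfolding FF.vnatural_unit_iff f
    by (simp add: Y.lact_idel Y.ract_idel gelD)
qed

end

locale functor_triple = system_of_arities V \<kappa> + FG: functor_pair V \<kappa> X Y F G + GH: functor_pair V \<kappa> X Y G H
  for V :: "('o, 'a, 'm) base_scheme" (structure) and \<kappa> :: "'s itself"
    and X :: "('x, 'o, 'a, 'n) vcat_scheme" and Y :: "('y, 'o, 'a, 'k) vcat_scheme" and F G H
begin

lemma vnatural_comp:
  assumes \<alpha>: "vnatural V X Y F G W \<alpha>" and \<beta>: "vnatural V X Y G H W' \<beta>"
  shows "vnatural V X Y F H (W' \<otimes> W) (\<lambda>x. EComp Y (FO F x) (FO G x) (FO H x) \<cdot> (\<beta> x \<odot> \<alpha> x))"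
proof -
  interpret FH: functor_pair V \<kappa> X Y F H by unfold_locales
  let ?a = "fam F G \<alpha>" and ?b = "fam G H \<beta>"
  note s [simp] = FG.vnatural_simps(1-3)[OF \<alpha>] GH.vnatural_simps(1-3)[OF \<beta>]
  have f: "fam F H (\<lambda>x. EComp Y (FO F x) (FO G x) (FO H x) \<cdot> (\<beta> x \<odot> \<alpha> x)) x = ?b x \<star>[Y] ?a x" for x
    by (simp add: fam_def cmp_def)
  show ?thesis
    unfolding FH.vnatural_iff f
  proof (intro conjI ballI allI impI)
    fix t assume t: "gel X t"
    note [simp] = t gelD(1,2)[OF t]
    have "(?b (etgt t) \<star>[Y] ?a (etgt t)) \<star>[Y] app F t
        = (?b (etgt t) \<star>[Y] (?a (etgt t) \<star>[Y] app F t)) \<lhd> Assoc V W' W (dm t)"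
      by (simp add: FG.F.Y.cmp_assoc)
    also have "\<dots> = (?b (etgt t) \<star>[Y] (app G t \<star>[Y] ?a (esrc t))) \<lhd> ((Ident V W' \<odot> Swap V W (dm t)) \<cdot> Assoc V W' W (dm t))"
      by (simp add: FG.vnatural_simps(4)[OF \<alpha>] FG.F.Y.cmp_pre_right)
    also have "\<dots> = ((?b (etgt t) \<star>[Y] app G t) \<star>[Y] ?a (esrc t))
        \<lhd> (Assoc' W' (dm t) W \<cdot> ((Ident V W' \<odot> Swap V W (dm t)) \<cdot> Assoc V W' W (dm t)))"
      by (simp add: FG.F.Y.cmp_assoc')
    also have "\<dots> = (app H t \<star>[Y] (?b (esrc t) \<star>[Y] ?a (esrc t)))
        \<lhd> (exch W' (dm t) W \<cdot> ((Ident V W' \<odot> Swap V W (dm t)) \<cdot> Assoc V W' W (dm t)))"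
      by (simp add: GH.vnatural_simps(4)[OF \<beta>] FG.F.Y.cmp_pre_left FG.F.Y.cmp_assoc exch_def)
    \<comment> \<open>The two exchanges of \<open>t\<close>, past \<open>\<alpha>\<close> and past
      \<open>\<beta>\<close>, combine into a single symmetry past
      \<open>W' \<otimes> W\<close>.\<close>
    also have "exch W' (dm t) W \<cdot> ((Ident V W' \<odot> Swap V W (dm t)) \<cdot> Assoc V W' W (dm t)) = Swap V (W' \<otimes> W) (dm t)"
      by (subst comp_extend[OF Swap_tens_left[symmetric]]) simp_all
    finally show "(?b (etgt t) \<star>[Y] ?a (etgt t)) \<star>[Y] app F t
        = (app H t \<star>[Y] (?b (esrc t) \<star>[Y] ?a (esrc t))) \<lhd> Swap V (W' \<otimes> W) (dm t)" .
  qed simp_all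
qed

end

context algebra_functor
begin

text \<open>Pointwise this is the counit at \<open>A L\<close>, so naturality is that of
  \<open>cotf_spec\<close>. The lift of the family to the end is the structure morphism of the
  commutant.\<close>

lemma vnatural_counit:
  assumes [simp]: "J \<in> Job V"
  shows "vnatural V T X (cot_vfun V X J A) (cot_vfun V X (Unit V) A) J (\<lambda>L. Ctu X J (FO A L))"
proof -
  interpret F: enriched_functor V \<kappa> T X "cot_vfun V X J A" by unfold_locales (rule cot_vfun_functor[OF assms])
  interpret G: enriched_functor V \<kappa> T X "cot_vfun V X (Unit V) A" by unfold_locales (rule cot_vfun_functor[OF Job_unit])
  interpret FG: functor_pair V \<kappa> T X "cot_vfun V X J A" "cot_vfun V X (Unit V) A" by unfold_locales
  have f: "fam (cot_vfun V X J A) (cot_vfun V X (Unit V) A) (\<lambda>L. Ctu X J (FO A L)) L = ctu J (FO A L)"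
    if "L \<in> EOb T" for L
    using that by (simp add: fam_def ctu_def Cot_Unit)
  show ?thesis
    unfolding FG.vnatural_iff
  proof (intro conjI ballI allI impI)
    fix t assume t: "gel T t"
    note [simp] = t gelD(1,2)[OF t]
    show "fam (cot_vfun V X J A) (cot_vfun V X (Unit V) A) (\<lambda>L. Ctu X J (FO A L)) (etgt t) \<star>[X] app (cot_vfun V X J A) t
      = (app (cot_vfun V X (Unit V) A) t \<star>[X]
          fam (cot_vfun V X J A) (cot_vfun V X (Unit V) A) (\<lambda>L. Ctu X J (FO A L)) (esrc t)) \<lhd> Swap V J (dm t)"
      using cotf_spec(3)[OF assms, of "app A t"] by (simp add: f app_cot_vfun cotf_Unit)
  qed (simp_all add: f)
qed

end

text \<open>The existence of ends is assumed only between the functors \<open>[J,A]\<close>. This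
  covers an algebra in an admissible category, and also the theory morphism \<open>M\<close> into
  \<open>U\<close>, whose ends are constructed by hand.\<close>

locale commutant_setting = algebra_functor V \<kappa> T X A
  for V :: "('o, 'a, 'm) base_scheme" (structure) and \<kappa> :: "'s itself"
    and T :: "('o, 'a) vtheory" and X :: "('x, 'o, 'a, 'n) cvcat_scheme" and A +
  assumes thy: "theory_enlarged V T"
    and ends: "\<lbrakk>J \<in> Job V; K \<in> Job V\<rbrakk>
      \<Longrightarrow> \<exists>e. is_hom_end V (Vob V) T X (cot_vfun V X J A) (cot_vfun V X K A) e"
begin

abbreviation cA :: "'o \<Rightarrow> ('o, 'x, 'a) vfun" where "cA J \<equiv> cot_vfun V X J A"
abbreviation N :: "'o \<Rightarrow> 'o \<Rightarrow> 'o" where "N J K \<equiv> nat_obj V T X (cA J) (cA K)"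
abbreviation pr :: "'o \<Rightarrow> 'o \<Rightarrow> 'o \<Rightarrow> 'a" where "pr J K \<equiv> nat_proj V T X (cA J) (cA K)"
abbreviation R :: "('o, 'a) vtheory" where "R \<equiv> commutant_theory V T X A"

definition counit_el :: "'o \<Rightarrow> 'a" where
  "counit_el J = nat_lift V T X (cA J) (cA (Unit V)) J (\<lambda>L. Ctu X J (FO A L))"

lemma R_simps [simp]:
  "EOb R = Job V" "EHom R J K = N J K"
  "EComp R J K L = nat_lift V T X (cA J) (cA L) (N K L \<otimes> N J K)
     (\<lambda>x. EComp X (FO (cA J) x) (FO (cA K) x) (FO (cA L) x) \<cdot> (pr K L x \<odot> pr J K x))"
  "EId R J = nat_lift V T X (cA J) (cA J) (Unit V) (\<lambda>x. EId X (FO (cA J) x))"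
  by (simp_all add: commutant_theory_def theory_of_structure_def alg_vcat_def)

lemma theory_EOb_T [simp]: "EOb T = Job V"
  by (rule theory_EOb[OF thy])

lemma Vob_simps [simp]: "J \<in> Job V \<Longrightarrow> J \<in> Vob V" "W \<in> Vob V \<Longrightarrow> W \<in> Obj V" "Unit V \<in> Vob V"
  "W \<in> Vob V \<Longrightarrow> W' \<in> Vob V \<Longrightarrow> W \<otimes> W' \<in> Vob V" "W \<in> Vob V \<Longrightarrow> W' \<in> Vob V \<Longrightarrow> IHom V W W' \<in> Vob V"
  using Job Vob Vob_unit Vob_tens Vob_ihom by blast+

lemma pair: "J \<in> Job V \<Longrightarrow> K \<in> Job V \<Longrightarrow> functor_pair V \<kappa> T X (cA J) (cA K)"
  using cot_vfun_functor by unfold_locales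

lemma hom_end_spec:
  assumes "J \<in> Job V" "K \<in> Job V"
  shows "is_hom_end V (Vob V) T X (cA J) (cA K) (N J K, pr J K)"
  using ends[OF assms] unfolding nat_obj_def nat_proj_def hom_end_def
  by (simp add: someI_ex)

lemma N_Vob [simp]: "J \<in> Job V \<Longrightarrow> K \<in> Job V \<Longrightarrow> N J K \<in> Vob V"
  and pr_vnatural: "J \<in> Job V \<Longrightarrow> K \<in> Job V \<Longrightarrow> vnatural V T X (cA J) (cA K) (N J K) (pr J K)"
  using hom_end_spec by (auto simp: is_hom_end_def)

lemma pr_simps [simp]:
  assumes "J \<in> Job V" "K \<in> Job V" "L \<in> Job V"
  shows "pr J K L \<in> Arr V" "Dom V (pr J K L) = N J K"
    "Cod V (pr J K L) = EHom X (Cot X J (FO A L)) (Cot X K (FO A L))"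
  using pr_vnatural[OF assms(1,2)] assms(3) by (simp_all add: vnatural_def hom_def)

lemma nat_lift_spec:
  assumes "J \<in> Job V" "K \<in> Job V" "W \<in> Vob V" "vnatural V T X (cA J) (cA K) W \<alpha>"
  shows "nat_lift V T X (cA J) (cA K) W \<alpha> \<in> Arr V" "Dom V (nat_lift V T X (cA J) (cA K) W \<alpha>) = W"
    "Cod V (nat_lift V T X (cA J) (cA K) W \<alpha>) = N J K"
    "L \<in> Job V \<Longrightarrow> pr J K L \<cdot> nat_lift V T X (cA J) (cA K) W \<alpha> = \<alpha> L"
proof -
  have "\<exists>!h. h \<in> hom V W (N J K) \<and> (\<forall>x \<in> EOb T. pr J K x \<cdot> h = \<alpha> x)"
    using hom_end_spec[OF assms(1,2)] assms(3,4) by (simp add: is_hom_end_def)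
  from theI'[OF this]
  show "nat_lift V T X (cA J) (cA K) W \<alpha> \<in> Arr V" "Dom V (nat_lift V T X (cA J) (cA K) W \<alpha>) = W"
    "Cod V (nat_lift V T X (cA J) (cA K) W \<alpha>) = N J K"
    "L \<in> Job V \<Longrightarrow> pr J K L \<cdot> nat_lift V T X (cA J) (cA K) W \<alpha> = \<alpha> L"
    unfolding nat_lift_def by (auto simp: hom_def)
qed

text \<open>The end is universal with respect to \<open>Vob\<close>, hence the restriction on the
  domain of \<open>h\<close> and \<open>h'\<close>.\<close>

lemma pr_joint_mono:
  assumes J: "J \<in> Job V" "K \<in> Job V" and h: "h \<in> Arr V" "h' \<in> Arr V" "Dom V h = Dom V h'" "Dom V h' \<in> Vob V"
    "Cod V h = N J K" "Cod V h' = N J K" and eq: "\<And>L. L \<in> Job V \<Longrightarrow> pr J K L \<cdot> h = pr J K L \<cdot> h'"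
  shows "h = h'"
proof -
  interpret functor_pair V \<kappa> T X "cA J" "cA K" by (rule pair[OF J])
  have "vnatural V T X (cA J) (cA K) (Dom V h') (\<lambda>L. pr J K L \<cdot> h')"
    by (rule vnatural_pre[OF pr_vnatural]) (use J h in simp_all)
  then have "\<exists>!k. k \<in> hom V (Dom V h') (N J K) \<and> (\<forall>x \<in> EOb T. pr J K x \<cdot> k = pr J K x \<cdot> h')"
    using hom_end_spec[OF J] h(4) by (simp add: is_hom_end_def)
  moreover have "h \<in> hom V (Dom V h') (N J K) \<and> (\<forall>x \<in> EOb T. pr J K x \<cdot> h = pr J K x \<cdot> h')"
    "h' \<in> hom V (Dom V h') (N J K) \<and> (\<forall>x \<in> EOb T. pr J K x \<cdot> h' = pr J K x \<cdot> h')"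
    using h eq by (simp_all add: hom_def)
  ultimately show ?thesis by blast
qed

text \<open>Families between algebras are determined at \<open>I\<close>, by
  \<open>vnatural_determined\<close> at the projections. For domains in \<open>Vob\<close> this is
  the faithfulness of the commutant algebra, whose action on homs is the projection at
  \<open>I\<close>.\<close>

lemma pr_Unit_mono:
  assumes A: "preserves_cotensors V T X A"
    and J: "J \<in> Job V" "K \<in> Job V" and h: "h \<in> Arr V" "h' \<in> Arr V" "Dom V h = Dom V h'" "Dom V h' \<in> Vob V"
    "Cod V h = N J K" "Cod V h' = N J K" and eq: "pr J K (Unit V) \<cdot> h = pr J K (Unit V) \<cdot> h'"
  shows "h = h'"
proof (rule pr_joint_mono[OF J h])
  fix L assume L: "L \<in> Job V"
  interpret functor_pair V \<kappa> T X "cA J" "cA K" by (rule pair[OF J])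
  have s: "gel T (structure_el T L)" using structure_el_cotens[OF thy L] cotens_gel by blast
  have "cotens X (app A (structure_el T L))"
    using A structure_el_cotens[OF thy L] L preserves_cotensors_iff[OF A.X.X X A.F] by simp
  then have c: "cotens X (app (cA K) (structure_el T L))"
    using app_cot_vfun[OF J(2) s] cotf_preserves[OF J(2)] by simp
  have "(\<lambda>L. pr J K L \<cdot> h) (esrc (structure_el T L)) = (\<lambda>L. pr J K L \<cdot> h') (esrc (structure_el T L))"
  proof (rule vnatural_determined[OF _ _ s c])
    show "vnatural V T X (cA J) (cA K) (Dom V h) (\<lambda>L. pr J K L \<cdot> h)"
      by (rule vnatural_pre[OF pr_vnatural]) (use J h in simp_all)
    show "vnatural V T X (cA J) (cA K) (Dom V h) (\<lambda>L. pr J K L \<cdot> h')"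
      unfolding h(3) by (rule vnatural_pre[OF pr_vnatural]) (use J h in simp_all)
  qed (use eq in simp)
  then show "pr J K L \<cdot> h = pr J K L \<cdot> h'" by simp
qed

lemma EComp_R_spec:
  assumes "J \<in> Job V" "K \<in> Job V" "M \<in> Job V"
  shows "EComp R J K M \<in> Arr V" "Dom V (EComp R J K M) = N K M \<otimes> N J K" "Cod V (EComp R J K M) = N J M"
    "L \<in> Job V \<Longrightarrow> pr J M L \<cdot> EComp R J K M
      = EComp X (Cot X J (FO A L)) (Cot X K (FO A L)) (Cot X M (FO A L)) \<cdot> (pr K M L \<odot> pr J K L)"
proof -
  interpret t: functor_triple V \<kappa> T X "cA J" "cA K" "cA M"
    using pair[OF assms(1,2)] pair[OF assms(2,3)] by (simp add: functor_triple_def functor_pair_def)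
  have "vnatural V T X (cA J) (cA M) (N K M \<otimes> N J K)
    (\<lambda>x. EComp X (FO (cA J) x) (FO (cA K) x) (FO (cA M) x) \<cdot> (pr K M x \<odot> pr J K x))"
    by (rule t.vnatural_comp) (use pr_vnatural assms in blast)+
  note s = nat_lift_spec[OF assms(1,3) _ this]
  show "EComp R J K M \<in> Arr V" "Dom V (EComp R J K M) = N K M \<otimes> N J K" "Cod V (EComp R J K M) = N J M"
    "L \<in> Job V \<Longrightarrow> pr J M L \<cdot> EComp R J K M
      = EComp X (Cot X J (FO A L)) (Cot X K (FO A L)) (Cot X M (FO A L)) \<cdot> (pr K M L \<odot> pr J K L)"
    using s assms by simp_all
qed

lemma EId_R_spec:
  assumes "J \<in> Job V"
  shows "EId R J \<in> Arr V" "Dom V (EId R J) = Unit V" "Cod V (EId R J) = N J J"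
    "L \<in> Job V \<Longrightarrow> pr J J L \<cdot> EId R J = EId X (Cot X J (FO A L))"
proof -
  interpret enriched_functor V \<kappa> T X "cA J" by unfold_locales (rule cot_vfun_functor[OF assms])
  note s = nat_lift_spec[OF assms assms _ vnatural_idel]
  show "EId R J \<in> Arr V" "Dom V (EId R J) = Unit V" "Cod V (EId R J) = N J J"
    "L \<in> Job V \<Longrightarrow> pr J J L \<cdot> EId R J = EId X (Cot X J (FO A L))"
    using s assms by simp_all
qed

lemma counit_el_spec:
  assumes "J \<in> Job V"
  shows "counit_el J \<in> Arr V" "Dom V (counit_el J) = J" "Cod V (counit_el J) = N J (Unit V)"
    "L \<in> Job V \<Longrightarrow> pr J (Unit V) L \<cdot> counit_el J = Ctu X J (FO A L)"
  unfolding counit_el_def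
  using nat_lift_spec[OF assms Job_unit _ vnatural_counit[OF assms]] assms by simp_all

definition pr_el :: "'o \<Rightarrow> 'o \<Rightarrow> 'a \<Rightarrow> 'o \<Rightarrow> ('x, 'a) elem" where
  "pr_el J K h L = Elem (Cot X J (FO A L)) (Cot X K (FO A L)) (pr J K L \<cdot> h)"

text \<open>\<open>Tau\<close> of the commutant is a definite description of a lift along
  \<open>counit_el\<close>. Projecting at every \<open>L\<close> turns its defining equation into
  \<open>eq\<close>, and the projections are jointly injective.\<close>

lemma Tau_R:
  assumes J [simp]: "J \<in> Job V" "K \<in> Job V"
    and h [simp]: "h \<in> Arr V" "Dom V h = IHom V K J" "Cod V h = N J K"
    and eq: "\<And>L. L \<in> Job V \<Longrightarrow>
      ctu K (FO A L) \<star>[X] pr_el J K h L = ctu J (FO A L) \<lhd> (Ev V K J \<cdot> Swap V K (IHom V K J))"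
  shows "Tau R J K = h"
proof -
  let ?\<phi> = "counit_el J \<cdot> Ev V K J \<cdot> Swap V K (IHom V K J)"
  let ?P = "\<lambda>h. h \<in> hom V (IHom V K J) (N J K) \<and> EComp R J K (Unit V) \<cdot> (counit_el K \<odot> h) = ?\<phi>"
  have [simp]: "FO A L \<in> EOb X" if "L \<in> Job V" for L using that by simp
  have [simp]: "Ctu X J x \<in> Arr V" "Cod V (Ctu X J x) = EHom X (Cot X J x) x" if "J \<in> Job V" "x \<in> EOb X" for J x
    using gelD[OF ctu_gel(1)[OF that]] by simp_all
  note [simp] = counit_el_spec(1-3) EComp_R_spec(1-3) EId_R_spec(1-3)
  have P: "?P h \<longleftrightarrow> h \<in> hom V (IHom V K J) (N J K) \<and> (\<forall>L \<in> Job V.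
      ctu K (FO A L) \<star>[X] pr_el J K h L = ctu J (FO A L) \<lhd> (Ev V K J \<cdot> Swap V K (IHom V K J)))" for h
  proof (rule conj_cong[OF refl])
    assume "h \<in> hom V (IHom V K J) (N J K)"
    then have h [simp]: "h \<in> Arr V" "Dom V h = IHom V K J" "Cod V h = N J K" by (auto simp: hom_def)
    have L: "ctu K (FO A L) \<star>[X] pr_el J K h L = ctu J (FO A L) \<lhd> (Ev V K J \<cdot> Swap V K (IHom V K J))
        \<longleftrightarrow> pr J (Unit V) L \<cdot> (EComp R J K (Unit V) \<cdot> (counit_el K \<odot> h)) = pr J (Unit V) L \<cdot> ?\<phi>"
      if [simp]: "L \<in> Job V" for L
    proof -
      have "pr J (Unit V) L \<cdot> (EComp R J K (Unit V) \<cdot> (counit_el K \<odot> h))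
          = (EComp X (Cot X J (FO A L)) (Cot X K (FO A L)) (FO A L) \<cdot> (pr K (Unit V) L \<odot> pr J K L)) \<cdot> (counit_el K \<odot> h)"
        by (rule comp_extend) (simp_all add: EComp_R_spec(4) Cot_Unit del: R_simps)
      also have "\<dots> = EComp X (Cot X J (FO A L)) (Cot X K (FO A L)) (FO A L) \<cdot> (Ctu X K (FO A L) \<odot> (pr J K L \<cdot> h))"
        by (simp add: counit_el_spec(4) Cot_Unit)
      moreover have "pr J (Unit V) L \<cdot> ?\<phi> = Ctu X J (FO A L) \<cdot> (Ev V K J \<cdot> Swap V K (IHom V K J))"
        using comp_extend[OF counit_el_spec(4), of J L "Ev V K J \<cdot> Swap V K (IHom V K J)"] by simp
      ultimately show ?thesis
        by (simp add: cmp_def pr_el_def ctu_def pre_def)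
    qed
    show "(EComp R J K (Unit V) \<cdot> (counit_el K \<odot> h) = ?\<phi>) \<longleftrightarrow> (\<forall>L \<in> Job V.
      ctu K (FO A L) \<star>[X] pr_el J K h L = ctu J (FO A L) \<lhd> (Ev V K J \<cdot> Swap V K (IHom V K J)))"
    proof (intro iffI ballI)
      assume e: "\<forall>L \<in> Job V. ctu K (FO A L) \<star>[X] pr_el J K h L = ctu J (FO A L) \<lhd> (Ev V K J \<cdot> Swap V K (IHom V K J))"
      show "EComp R J K (Unit V) \<cdot> (counit_el K \<odot> h) = ?\<phi>"
        by (rule pr_joint_mono[of J "Unit V"]) (use e L in \<open>simp_all del: R_simps\<close>)
    qed (simp add: L del: R_simps)
  qed
  have "Tau R J K = (THE h. ?P h)"
    unfolding commutant_theory_def theory_of_structure_def cot_lift_def by (simp add: alg_vcat_def counit_el_def)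
  also have "(THE h. ?P h) = h"
  proof (rule the_equality)
    show "?P h" unfolding P using eq by (simp add: hom_def)
    fix k assume "?P k"
    then have k: "k \<in> Arr V" "Dom V k = IHom V K J" "Cod V k = N J K"
      and ek: "\<And>L. L \<in> Job V \<Longrightarrow>
        ctu K (FO A L) \<star>[X] pr_el J K k L = ctu J (FO A L) \<lhd> (Ev V K J \<cdot> Swap V K (IHom V K J))"
      unfolding P by (auto simp: hom_def)
    show "k = h"
    proof (rule pr_joint_mono[OF J])
      fix L assume L [simp]: "L \<in> Job V"
      have AL: "FO A L \<in> EOb X" by simp
      have "pr_el J K k L = pr_el J K h L"
        by (rule cotens_eqD[OF ctu_cotens[OF J(2) AL]])
          (use k in \<open>simp_all add: ek eq\<close>, simp_all add: pr_el_def gel_def)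
      then show "pr J K L \<cdot> k = pr J K L \<cdot> h" by (simp add: pr_el_def)
    qed (use k in simp_all)
  qed
  finally show ?thesis .
qed

text \<open>The commutant is defined from the structure morphisms \<open>counit_el\<close>, whereas
  \<open>structure_arr\<close> reads them back from the resulting \<open>Tau\<close>; this is the
  round trip.\<close>

lemma structure_arr_R:
  assumes J [simp]: "J \<in> Job V"
  shows "structure_arr V R J = counit_el J"
proof -
  let ?I = "Unit V"
  \<comment> \<open>The candidate for \<open>Tau R J I\<close>: under \<open>[I,J] \<cong> J\<close>
    it is the counit.\<close>
  let ?h = "counit_el J \<cdot> (Ev V ?I J \<cdot> (Swap V ?I (IHom V ?I J) \<cdot> Lun' (IHom V ?I J)))"
  note [simp] = counit_el_spec(1-3)
  have [simp]: "Ctu X J x \<in> Arr V" "Cod V (Ctu X J x) = EHom X (Cot X J x) x" if "J \<in> Job V" "x \<in> EOb X" for J x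
    using gelD[OF ctu_gel(1)[OF that]] by simp_all
  have "Tau R J ?I = ?h"
  proof (rule Tau_R)
    fix L assume L [simp]: "L \<in> Job V"
    have AL [simp]: "FO A L \<in> EOb X" by simp
    have p: "pr_el J ?I ?h L = ctu J (FO A L) \<lhd> (Ev V ?I J \<cdot> (Swap V ?I (IHom V ?I J) \<cdot> Lun' (IHom V ?I J)))"
      unfolding pr_el_def
      by (subst comp_extend[OF counit_el_spec(4)]) (simp_all add: pre_def ctu_def Cot_Unit)
    show "ctu ?I (FO A L) \<star>[X] pr_el J ?I ?h L = ctu J (FO A L) \<lhd> (Ev V ?I J \<cdot> Swap V ?I (IHom V ?I J))"
      unfolding p by (simp add: ctu_Unit cmp_idel_left)
  qed simp_all
  then have "structure_arr V R J = ?h \<cdot> curry_arr V J ?I J (Run V J)"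
    by (simp add: structure_arr_def)
  also have "\<dots> = counit_el J \<cdot> (Ev V ?I J \<cdot> (Run' (IHom V ?I J) \<cdot> curry_arr V J ?I J (Run V J)))"
    by (simp add: Swap_Lun')
  also have "Run' (IHom V ?I J) \<cdot> curry_arr V J ?I J (Run V J) = (curry_arr V J ?I J (Run V J) \<odot> Ident V ?I) \<cdot> Run' J"
  proof (rule iso_cancel_left[of "Run V (IHom V ?I J)"])
    show "Run V (IHom V ?I J) \<cdot> (Run' (IHom V ?I J) \<cdot> curry_arr V J ?I J (Run V J))
      = Run V (IHom V ?I J) \<cdot> ((curry_arr V J ?I J (Run V J) \<odot> Ident V ?I) \<cdot> Run' J)"
      by (subst comp_extend[OF Run_nat]) simp_all
  qed simp_all
  also have "Ev V ?I J \<cdot> ((curry_arr V J ?I J (Run V J) \<odot> Ident V ?I) \<cdot> Run' J) = Run V J \<cdot> Run' J"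
    by (rule comp_extend) simp_all
  finally show ?thesis by simp
qed

end

section \<open>Right-commutant algebras\<close>

context system_of_arities
begin

lemma Alg_morphism_iff:
  "Alg_morphism V X c T A U B M \<longleftrightarrow>
     (theory_enlarged V T \<and> vfunctor V T X A \<and> preserves_cotensors V T X A \<and> FO A (Unit V) = c) \<and>
     (theory_enlarged V U \<and> vfunctor V U X B \<and> preserves_cotensors V U X B \<and> FO B (Unit V) = c) \<and>
     theory_morphism V T U M \<and> (\<exists>f. natural_iso V T X A (comp_vfun V B M) f \<and> f (Unit V) = EId X c)"
  by (auto simp: Alg_morphism_def Alg_object_def algebra_def)

lemma theory_morphism_comp:
  assumes T: "theory_enlarged V T" and U: "theory_enlarged V U" and W: "theory_enlarged V W"
    and M: "theory_morphism V T U M" and N: "theory_morphism V U W N"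
  shows "theory_morphism V T W (comp_vfun V N M)"
proof -
  note m = theory_morphismD[OF M] and n = theory_morphismD[OF N]
  interpret M: enriched_functor V \<kappa> T U M
    by unfold_locales (simp_all add: theory_enriched T U m(1))
  interpret N: enriched_functor V \<kappa> U W N
    by unfold_locales (simp_all add: theory_enriched U W n(1))
  note [simp] = theory_EOb[OF T] theory_EOb[OF U] Tau_simps[OF T]
  have "FH N J K \<cdot> FH M J K \<cdot> Tau T J K = Tau W J K" if [simp]: "J \<in> Job V" "K \<in> Job V" for J K
    using m(2)[of J] m(2)[of K] n(2)[of J] n(2)[of K] M.FH_simps[of J K] N.FH_simps[of J K] m(3) n(3) by simp
  then show ?thesis
    using vfunctor_comp(1)[OF theory_enriched[OF T] theory_enriched[OF U] theory_enriched[OF W] m(1) n(1)] m(2) n(2)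
    by (simp add: theory_morphism_def functor_eq_def) (simp add: comp_vfun_def)
qed

text \<open>Pasting of \<open>A \<cong> B M\<close> with \<open>B \<cong> D N\<close>. As
  \<open>M\<close> is the identity on objects, the component of the second isomorphism at
  \<open>M x\<close> is the one at \<open>x\<close>, and at \<open>I\<close> two identities are
  composed.\<close>

lemma Alg_morphism_comp:
  assumes X: "enriched_category V X"
    and M: "Alg_morphism V X c T A U B M" and N: "Alg_morphism V X c U B W D N"
  shows "Alg_morphism V X c T A W D (comp_vfun V N M)"
proof -
  obtain f where f: "natural_iso V T X A (comp_vfun V B M) f" "f (Unit V) = EId X c"
    using M by (auto simp: Alg_morphism_iff)
  obtain g where g: "natural_iso V U X B (comp_vfun V D N) g" "g (Unit V) = EId X c"
    using N by (auto simp: Alg_morphism_iff)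
  have T: "theory_enlarged V T" "vfunctor V T X A" and U: "theory_enlarged V U" "vfunctor V U X B"
    and W: "theory_enlarged V W" "vfunctor V W X D" and c: "FO A (Unit V) = c" "FO B (Unit V) = c" "FO D (Unit V) = c"
    and MN: "theory_morphism V T U M" "theory_morphism V U W N"
    using M N by (simp_all add: Alg_morphism_iff)
  note m = theory_morphismD[OF MN(1)] and n = theory_morphismD[OF MN(2)]
  note e [simp] = theory_EOb[OF T(1)] theory_EOb[OF U(1)] theory_EOb[OF W(1)]
  note en = theory_enriched[OF T(1)] theory_enriched[OF U(1)] theory_enriched[OF W(1)]
  have MN': "theory_morphism V T W (comp_vfun V N M)"
    by (rule theory_morphism_comp[OF T(1) U(1) W(1) MN])
  interpret X: enriched V \<kappa> X by unfold_locales fact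
  interpret A: enriched_functor V \<kappa> T X A by unfold_locales (use en T in simp_all)
  interpret M: enriched_functor V \<kappa> T U M by unfold_locales (use en m in simp_all)
  interpret N: enriched_functor V \<kappa> U W N by unfold_locales (use en n in simp_all)
  interpret B: enriched_functor V \<kappa> U X B by unfold_locales (use U in simp_all)
  interpret D: enriched_functor V \<kappa> W X D by unfold_locales (use W in simp_all)
  let ?BM = "comp_vfun V B M" and ?DN = "comp_vfun V D N" and ?E = "comp_vfun V D (comp_vfun V N M)"
  interpret BM: enriched_functor V \<kappa> T X ?BM
    by unfold_locales (rule vfunctor_comp[OF en(1,2) X m(1) U(2)])
  interpret DN: enriched_functor V \<kappa> U X ?DN
    by unfold_locales (rule vfunctor_comp[OF en(2,3) X n(1) W(2)])
  interpret NM: enriched_functor V \<kappa> T W "comp_vfun V N M"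
    by unfold_locales (rule vfunctor_comp[OF en(1,2,3) m(1) n(1)])
  interpret E: enriched_functor V \<kappa> T X ?E
    by unfold_locales (rule vfunctor_comp[OF en(1,3) X NM.F W(2)])
  note app = vfunctor_comp(2)[OF en(1,2) X m(1) U(2)] vfunctor_comp(2)[OF en(2,3) X n(1) W(2)]
    vfunctor_comp(2)[OF en(1,3) X NM.F W(2)] vfunctor_comp(2)[OF en(1,2,3) m(1) n(1)]
  have fo [simp]: "FO ?BM x = FO B x" "FO ?DN x = FO D x" "FO ?E x = FO D x" if "x \<in> Job V" for x
    using that m(2) n(2) by (simp_all add: comp_vfun_def)
  interpret p: functor_pair V \<kappa> T X A ?BM by unfold_locales
  interpret p': functor_pair V \<kappa> T X ?BM A by unfold_locales
  interpret q: functor_pair V \<kappa> U X B ?DN by unfold_locales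
  interpret q': functor_pair V \<kappa> U X ?DN B by unfold_locales
  interpret r: functor_pair V \<kappa> T X A ?E by unfold_locales
  interpret r': functor_pair V \<kappa> T X ?E A by unfold_locales
  obtain f' where f': "vnatural V T X A ?BM (Unit V) f" "vnatural V T X ?BM A (Unit V) f'"
    "\<And>x. x \<in> Job V \<Longrightarrow> X.inverse_el (fam A ?BM f x) (fam ?BM A f' x)"
    using p.natural_isoD[OF f(1)] by (metis e(1))
  obtain g' where g': "vnatural V U X B ?DN (Unit V) g" "vnatural V U X ?DN B (Unit V) g'"
    "\<And>x. x \<in> Job V \<Longrightarrow> X.inverse_el (fam B ?DN g x) (fam ?DN B g' x)"
    using q.natural_isoD[OF g(1)] by (metis e(2))
  let ?f = "fam A ?BM f" and ?f' = "fam ?BM A f'" and ?g = "fam B ?DN g" and ?g' = "fam ?DN B g'"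
  have t [simp]: "gel X (?f x)" "gel X (?f' x)" "gel X (?g x)" "gel X (?g' x)"
    "Dom V (f x) = Unit V" "Dom V (f' x) = Unit V" "Dom V (g x) = Unit V" "Dom V (g' x) = Unit V" if "x \<in> Job V" for x
    using f'(3)[OF that] g'(3)[OF that] by (simp_all add: X.inverse_el_def)
  let ?h = "\<lambda>x. earr (lact X (?g x) (?f x))" and ?h' = "\<lambda>x. earr (lact X (?f' x) (?g' x))"
  have h: "fam A ?E ?h x = lact X (?g x) (?f x)" "fam ?E A ?h' x = lact X (?f' x) (?g' x)" if "x \<in> Job V" for x
    using that by (simp_all add: fam_def lact_def pre_def cmp_def)
  have appM [simp]: "esrc (app M t) = esrc t" "etgt (app M t) = etgt t" if "gel T t" for t
    using gelD(1,2)[OF that] m(2) by simp_all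
  have 1: "vnatural V T X A ?E (Unit V) ?h"
    unfolding r.vnatural_unit_iff
  proof (intro conjI ballI allI impI)
    fix t assume t': "gel T t"
    note [simp] = t' gelD(1,2)[OF t', simplified]
    have "lact X (lact X (?g (etgt t)) (?f (etgt t))) (app A t) = lact X (?g (etgt t)) (lact X (?f (etgt t)) (app A t))"
      by (simp add: X.lact_lact)
    also have "\<dots> = ract X (lact X (?g (etgt t)) (app B (app M t))) (?f (esrc t))"
      using p.vnatural_unit[OF f'(1) t'] m(2) by (simp add: app X.ract_lact)
    also have "\<dots> = ract X (app D (app N (app M t))) (lact X (?g (esrc t)) (?f (esrc t)))"
      using q.vnatural_unit[OF g'(1), of "app M t"] m(2) n(2) by (simp add: app X.ract_ract)
    finally show "lact X (fam A ?E ?h (etgt t)) (app A t) = ract X (app ?E t) (fam A ?E ?h (esrc t))"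
      by (simp add: h app)
  qed (simp_all add: h)
  have 2: "vnatural V T X ?E A (Unit V) ?h'"
    unfolding r'.vnatural_unit_iff
  proof (intro conjI ballI allI impI)
    fix t assume t': "gel T t"
    note [simp] = t' gelD(1,2)[OF t', simplified]
    have "lact X (lact X (?f' (etgt t)) (?g' (etgt t))) (app D (app N (app M t)))
        = lact X (?f' (etgt t)) (lact X (?g' (etgt t)) (app D (app N (app M t))))"
      using m(2) n(2) by (simp add: X.lact_lact)
    also have "\<dots> = ract X (lact X (?f' (etgt t)) (app B (app M t))) (?g' (esrc t))"
      using q'.vnatural_unit[OF g'(2), of "app M t"] m(2) n(2) by (simp add: app X.ract_lact)
    also have "\<dots> = ract X (app A t) (lact X (?f' (esrc t)) (?g' (esrc t)))"
      using p'.vnatural_unit[OF f'(2) t'] m(2) by (simp add: app X.ract_ract)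
    finally show "lact X (fam ?E A ?h' (etgt t)) (app ?E t) = ract X (app A t) (fam ?E A ?h' (esrc t))"
      by (simp add: h app)
  qed (simp_all add: h)
  have "X.inverse_el (fam A ?E ?h x) (fam ?E A ?h' x)" if x [simp]: "x \<in> Job V" for x
  proof -
    have i: "lact X (?f x) (?f' x) = idel X (FO B x)" "lact X (?f' x) (?f x) = idel X (FO A x)"
      "lact X (?g x) (?g' x) = idel X (FO D x)" "lact X (?g' x) (?g x) = idel X (FO B x)"
      using f'(3)[OF x] g'(3)[OF x] by (simp_all add: X.inverse_el_def)
    have "lact X (lact X (?g x) (?f x)) (lact X (?f' x) (?g' x)) = lact X (?g x) (lact X (lact X (?f x) (?f' x)) (?g' x))"
      by (simp add: X.lact_lact[symmetric])
    then have a: "lact X (lact X (?g x) (?f x)) (lact X (?f' x) (?g' x)) = idel X (FO D x)"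
      by (simp add: i X.lact_idel)
    have "lact X (lact X (?f' x) (?g' x)) (lact X (?g x) (?f x)) = lact X (?f' x) (lact X (lact X (?g' x) (?g x)) (?f x))"
      by (simp add: X.lact_lact[symmetric])
    then have b: "lact X (lact X (?f' x) (?g' x)) (lact X (?g x) (?f x)) = idel X (FO A x)"
      by (simp add: i X.lact_idel)
    show ?thesis unfolding X.inverse_el_def by (simp add: h a b)
  qed
  then have iso: "natural_iso V T X A ?E ?h"
    by (intro r.natural_isoI[OF 1 2]) simp_all
  have cc: "c \<in> EOb X" using A.FO_EOb[of "Unit V"] c by simp
  have "?f (Unit V) = idel X c" "?g (Unit V) = idel X c"
    by (simp_all add: fam_def idel_def f(2) g(2) c)
  then have "lact X (?g (Unit V)) (?f (Unit V)) = idel X c"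
    by (simp add: X.lact_idel cc)
  then have "?h (Unit V) = EId X c" by simp
  then show ?thesis using iso MN' M N unfolding Alg_morphism_iff by blast
qed

end

text \<open>\<open>B\<close> plays the right face and \<open>P\<close> its identification with the
  commutant of the left face \<open>A\<close>. The retraction \<open>Q\<close> makes
  \<open>P\<close> injective on homs.\<close>

locale right_commutant_setting = commutant_setting V \<kappa> T C A
  for V :: "('o, 'a, 'm) base_scheme" (structure) and \<kappa> :: "'s itself"
    and T :: "('o, 'a) vtheory" and C :: "('x, 'o, 'a, 'n) cvcat_scheme" and A +
  fixes U :: "('o, 'a) vtheory" and B P Q
  assumes A_pres: "preserves_cotensors V T C A" and T_homs: "homs_in_V V T" and U_homs: "homs_in_V V U"
    and P: "Alg_morphism V C (FO A (Unit V)) U B (commutant_theory V T C A) (commutant V T C A) P"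
    and Q: "theory_morphism V (commutant_theory V T C A) U Q"
    and QP: "functor_eq U (comp_vfun V Q P) (id_vfun V U)"
begin

abbreviation S :: "('o, 'o, 'a) cvcat" where "S \<equiv> theory_cvcat V U"

lemma thU: "theory_enlarged V U" and B_functor: "vfunctor V U C B" and B_pres: "preserves_cotensors V U C B"
  and thR: "theory_enlarged V R" and commutant_functor: "vfunctor V R C (commutant V T C A)"
  and P_morphism: "theory_morphism V U R P" and FO_B_Unit [simp]: "FO B (Unit V) = FO A (Unit V)"
  using P by (simp_all add: Alg_morphism_iff)

end

sublocale right_commutant_setting \<subseteq> S: cotensored V \<kappa> "theory_cvcat V U"
  by (rule theory_cvcat_cotensored[OF thU])

context right_commutant_setting
begin

text \<open>The simplification rules of the interpretation \<open>S\<close> apply only as long as \<open>EHom S\<close> is not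
  unfolded to \<open>EHom U\<close>.\<close>

declare theory_cvcat_simps [simp del]

lemma EOb_S [simp]: "EOb S = Job V"
  by (simp add: theory_cvcat_simps theory_EOb[OF thU])

end

sublocale right_commutant_setting \<subseteq> B: enriched_functor V \<kappa> "theory_cvcat V U" C B
  by unfold_locales (simp add: vfunctor_theory_cvcat B_functor)

context right_commutant_setting
begin

lemma B_cotens:
  assumes "cotens S k" "dm k \<in> Job V"
  shows "cotens C (app B k)"
proof -
  have "preserves_cotensors V S C B"
    using B_pres by (simp add: preserves_cotensors_def is_cotensor_def theory_cvcat_simps)
  then show ?thesis using preserves_cotensors_iff[OF S.X X B.F] assms by blast
qed

lemma structure_el_cotens_S: "L \<in> Job V \<Longrightarrow> cotens S (structure_el U L)"
  by (simp add: cotens_theory_cvcat structure_el_cotens[OF thU])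

lemma structure_el_gel [simp]: "L \<in> Job V \<Longrightarrow> gel S (structure_el U L)" "L \<in> Job V \<Longrightarrow> Dom V (structure_arr V U L) = L"
  using cotens_gel[OF structure_el_cotens_S] structure_el_cotens(2)[OF thU] by simp_all

lemma structure_el_gel_T [simp]: "L \<in> Job V \<Longrightarrow> gel T (structure_el T L)" "L \<in> Job V \<Longrightarrow> Dom V (structure_arr V T L) = L"
  using cotens_gel[OF structure_el_cotens(1)[OF thy]] structure_el_cotens(2)[OF thy] by simp_all

lemma structure_el_cotens_B: "L \<in> Job V \<Longrightarrow> cotens C (app B (structure_el U L))"
  by (rule B_cotens[OF structure_el_cotens_S]) simp_all

lemma EHom_Vob [simp]: "J \<in> Job V \<Longrightarrow> K \<in> Job V \<Longrightarrow> EHom S J K \<in> Vob V"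
  "J \<in> Job V \<Longrightarrow> K \<in> Job V \<Longrightarrow> EHom T J K \<in> Vob V"
  using U_homs T_homs theory_EOb[OF thU] theory_EOb[OF thy]
  by (simp_all add: homs_in_V_def theory_cvcat_simps)

lemma P_simps [simp]:
  assumes "J \<in> Job V" "K \<in> Job V"
  shows "FO P J = J" "FH P J K \<in> Arr V" "Dom V (FH P J K) = EHom S J K" "Cod V (FH P J K) = N J K"
  using theory_morphismD(1,2)[OF P_morphism] assms theory_EOb[OF thU]
  by (simp_all add: vfunctor_def hom_def theory_cvcat_simps)

lemma QP_cancel:
  assumes "J \<in> Job V" "K \<in> Job V" "h \<in> Arr V" "Cod V h = EHom S J K"
  shows "FH Q J K \<cdot> (FH P J K \<cdot> h) = h"
proof -
  have q: "FH Q J K \<in> hom V (N J K) (EHom U J K)"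
    using theory_morphismD(1,2)[OF Q] assms by (simp add: vfunctor_def)
  have e: "FH Q J K \<cdot> FH P J K = Ident V (EHom S J K)"
    using QP assms theory_EOb[OF thU] by (simp add: functor_eq_def comp_vfun_def id_vfun_def theory_cvcat_simps)
  have "FH Q J K \<cdot> (FH P J K \<cdot> h) = Ident V (EHom S J K) \<cdot> h"
    by (rule comp_extend[OF e]) (use q assms in \<open>simp_all add: hom_def\<close>)
  then show ?thesis using assms by simp
qed

abbreviation AP :: "('o, 'x, 'a) vfun" where "AP \<equiv> comp_vfun V (commutant V T C A) P"

text \<open>\<open>P\<close> asserts only the existence of an isomorphism from \<open>B\<close> to
  the commutant composed with \<open>P\<close>; one with identity component at \<open>I\<close> is
  fixed here.\<close>

definition g :: "'o \<Rightarrow> 'a" where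
  "g = (SOME f. natural_iso V U C B AP f \<and> f (Unit V) = EId C (FO A (Unit V)))"

definition perp_iso :: "'o \<Rightarrow> ('x, 'a) elem" where "perp_iso J = fam B AP g J"

lemma g: "natural_iso V S C B AP g" "g (Unit V) = EId C (FO A (Unit V))"
proof -
  have "\<exists>f. natural_iso V U C B AP f \<and> f (Unit V) = EId C (FO A (Unit V))"
    using P unfolding Alg_morphism_iff by blast
  from someI_ex[OF this, folded g_def] show "natural_iso V S C B AP g" "g (Unit V) = EId C (FO A (Unit V))"
    by (simp_all add: natural_iso_def vnatural_def theory_cvcat_simps)
qed

lemma FO_AP [simp]: "J \<in> Job V \<Longrightarrow> FO AP J = Cot C J (FO A (Unit V))"
  by (simp add: comp_vfun_def commutant_def)

lemma FH_AP: "J \<in> Job V \<Longrightarrow> K \<in> Job V \<Longrightarrow> FH AP J K = pr J K (Unit V) \<cdot> FH P J K"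
  by (simp add: comp_vfun_def commutant_def)

lemma AP_functor: "enriched_functor V \<kappa> S C AP"
proof unfold_locales
  have "vfunctor V U C AP"
    by (rule vfunctor_comp[OF theory_enriched[OF thU] theory_enriched[OF thR] X theory_morphismD(1)[OF P_morphism] commutant_functor])
  then show "vfunctor V S C AP" by (simp add: vfunctor_theory_cvcat)
qed

lemma perp_iso_spec:
  assumes J [simp]: "J \<in> Job V"
  shows "gel C (perp_iso J)" "esrc (perp_iso J) = FO B J" "etgt (perp_iso J) = Cot C J (FO A (Unit V))" "dm (perp_iso J) = Unit V"
    "\<exists>i. inverse_el (perp_iso J) i"
    "perp_iso (Unit V) = idel C (FO A (Unit V))"
    "gel S t \<Longrightarrow> lact C (perp_iso (etgt t)) (app B t) = ract C (app AP t) (perp_iso (esrc t))"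
proof -
  interpret AP: enriched_functor V \<kappa> S C AP by (rule AP_functor)
  interpret p: functor_pair V \<kappa> S C B AP by unfold_locales
  obtain g' where n: "vnatural V S C B AP (Unit V) g" "inverse_el (fam B AP g J) (fam AP B g' J)"
    using p.natural_isoD[OF g(1)] by (metis EOb_S J)
  then show "gel C (perp_iso J)" "dm (perp_iso J) = Unit V" "\<exists>i. inverse_el (perp_iso J) i"
    by (auto simp: perp_iso_def inverse_el_def)
  show "esrc (perp_iso J) = FO B J" "etgt (perp_iso J) = Cot C J (FO A (Unit V))" by (simp_all add: perp_iso_def)
  show "perp_iso (Unit V) = idel C (FO A (Unit V))"
    by (simp add: perp_iso_def g(2) fam_def idel_def Cot_Unit)
  show "gel S t \<Longrightarrow> lact C (perp_iso (etgt t)) (app B t) = ract C (app AP t) (perp_iso (esrc t))"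
    unfolding perp_iso_def by (rule p.vnatural_unit[OF n(1)])
qed

text \<open>\<open>P\<close> preserves projections, the projection of the commutant is
  \<open>counit_el\<close>, and its value at \<open>I\<close> is the counit at the carrier.\<close>

lemma app_AP_structure_el: "J \<in> Job V \<Longrightarrow> app AP (structure_el U J) = ctu J (FO A (Unit V))"
proof -
  assume J [simp]: "J \<in> Job V"
  have "app AP (structure_el U J) = app (commutant V T C A) (app P (structure_el U J))"
    by (rule vfunctor_comp(2)[OF theory_enriched[OF thU] theory_enriched[OF thR] X theory_morphismD(1)[OF P_morphism] commutant_functor])
      (use structure_el_gel[OF J] in \<open>simp add: gel_theory_cvcat\<close>)
  also have "app P (structure_el U J) = structure_el R J"
    by (rule theory_morphism_structure_el[OF thU P_morphism J])
  also have "app (commutant V T C A) (structure_el R J) = ctu J (FO A (Unit V))"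
    using counit_el_spec(4)[OF J, of "Unit V"]
    by (simp add: app_def structure_arr_R commutant_def ctu_def Cot_Unit)
  finally show ?thesis .
qed

text \<open>Three injective steps: conjugation by \<open>perp_iso\<close> replaces \<open>B\<close>
  by \<open>AP\<close>, evaluation at \<open>I\<close> is cancelled by \<open>pr_Unit_mono\<close>,
  and \<open>Q\<close> cancels \<open>P\<close>. The second one is the reason for the domain in
  \<open>Vob\<close>.\<close>

lemma B_faithful:
  assumes a: "gel S a" "gel S a'" "esrc a = esrc a'" "etgt a = etgt a'" "dm a = dm a'" "dm a' \<in> Vob V"
    and eq: "app B a = app B a'"
  shows "a = a'"
proof -
  interpret AP: enriched_functor V \<kappa> S C AP by (rule AP_functor)
  have J [simp]: "esrc a' \<in> Job V" "etgt a' \<in> Job V" using gelD(1,2)[OF a(2)] by simp_all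
  obtain i where i: "inverse_el (perp_iso (esrc a')) i" using perp_iso_spec(5)[OF J(1)] by blast
  have "ract C (app AP a) (perp_iso (esrc a')) = ract C (app AP a') (perp_iso (esrc a'))"
    using perp_iso_spec(7)[OF J(1) a(1)] perp_iso_spec(7)[OF J(1) a(2)] a(3,4) eq by simp
  then have "ract C (ract C (app AP a) (perp_iso (esrc a'))) i = ract C (ract C (app AP a') (perp_iso (esrc a'))) i"
    by simp
  then have "app AP a = app AP a'"
    using a(1-5) by (simp add: ract_inverse_el[OF i] perp_iso_spec)
  then have "FH AP (esrc a') (etgt a') \<cdot> earr a = FH AP (esrc a') (etgt a') \<cdot> earr a'"
    using a(3,4) by (simp add: app_def)
  then have "pr (esrc a') (etgt a') (Unit V) \<cdot> (FH P (esrc a') (etgt a') \<cdot> earr a)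
      = pr (esrc a') (etgt a') (Unit V) \<cdot> (FH P (esrc a') (etgt a') \<cdot> earr a')"
    using gelD[OF a(1)] gelD[OF a(2)] a(3,4) by (simp add: FH_AP)
  then have "FH P (esrc a') (etgt a') \<cdot> earr a = FH P (esrc a') (etgt a') \<cdot> earr a'"
    by (rule pr_Unit_mono[OF A_pres J, rotated -1]) (use gelD[OF a(1)] gelD[OF a(2)] a in simp_all)
  then have "FH Q (esrc a') (etgt a') \<cdot> (FH P (esrc a') (etgt a') \<cdot> earr a)
      = FH Q (esrc a') (etgt a') \<cdot> (FH P (esrc a') (etgt a') \<cdot> earr a')"
    by simp
  then have "earr a = earr a'"
    using gelD[OF a(1)] gelD[OF a(2)] a(3,4) by (simp add: QP_cancel)
  then show ?thesis using a(3,4) by (cases a, cases a') simp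
qed

lemma ctu_S_Unit [simp]: "J \<in> Job V \<Longrightarrow> S.ctu J (Unit V) = structure_el U J"
  using structure_el_Unit[OF thU] unfolding S.ctu_def by (simp add: structure_el_def theory_cvcat_def idel_def)

lemma Alg_morphism_iso:
  assumes M: "Alg_morphism V C (FO A (Unit V)) T A U B M"
  obtains f f' where "\<And>J. J \<in> Job V \<Longrightarrow> esrc (f J) = FO A J \<and> etgt (f J) = FO B J \<and> inverse_el (f J) (f' J)"
    "f (Unit V) = idel C (FO A (Unit V))"
    "\<And>t. gel T t \<Longrightarrow> lact C (f (etgt t)) (app A t) = ract C (app B (app M t)) (f (esrc t))"
    "\<And>t. gel T t \<Longrightarrow> lact C (f' (etgt t)) (app B (app M t)) = ract C (app A t) (f' (esrc t))"
proof -
  have Mm: "theory_morphism V T U M" using M by (simp add: Alg_morphism_iff)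
  interpret M: enriched_functor V \<kappa> T S M
    by unfold_locales (simp add: vfunctor_theory_cvcat theory_morphismD(1)[OF Mm])
  let ?BM = "comp_vfun V B M"
  interpret BM: enriched_functor V \<kappa> T C ?BM
    by unfold_locales (rule vfunctor_comp[OF A.X.X S.X X M.F B.F])
  interpret p: functor_pair V \<kappa> T C A ?BM by unfold_locales
  interpret p': functor_pair V \<kappa> T C ?BM A by unfold_locales
  obtain f where f: "natural_iso V T C A ?BM f" "f (Unit V) = EId C (FO A (Unit V))"
    using M by (auto simp: Alg_morphism_iff)
  obtain f' where n: "vnatural V T C A ?BM (Unit V) f" "vnatural V T C ?BM A (Unit V) f'"
    "\<And>x. x \<in> Job V \<Longrightarrow> inverse_el (fam A ?BM f x) (fam ?BM A f' x)"
    using p.natural_isoD[OF f(1)] by (metis theory_EOb_T)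
  have fo: "FO ?BM J = FO B J" if "J \<in> Job V" for J
    using that theory_morphismD(2)[OF Mm] by (simp add: comp_vfun_def)
  have app: "app ?BM t = app B (app M t)" if "gel T t" for t
    by (rule vfunctor_comp(2)[OF A.X.X S.X X M.F B.F that])
  show ?thesis
  proof (rule that[of "fam A ?BM f" "fam ?BM A f'"])
    show "fam A ?BM f (Unit V) = idel C (FO A (Unit V))"
      by (simp add: fam_def idel_def fo f(2))
    show "lact C (fam A ?BM f (etgt t)) (app A t) = ract C (app B (app M t)) (fam A ?BM f (esrc t))" if "gel T t" for t
      using p.vnatural_unit[OF n(1) that] app[OF that] by simp
    show "lact C (fam ?BM A f' (etgt t)) (app B (app M t)) = ract C (app A t) (fam ?BM A f' (esrc t))" if "gel T t" for t
      using p'.vnatural_unit[OF n(2) that] app[OF that] by simp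
  qed (simp_all add: n fo)
qed

lemma Alg_morphism_unique:
  assumes M: "Alg_morphism V C (FO A (Unit V)) T A U B M" and M': "Alg_morphism V C (FO A (Unit V)) T A U B M'"
  shows "functor_eq T M' M"
proof -
  obtain f f' where f: "\<And>J. J \<in> Job V \<Longrightarrow> esrc (f J) = FO A J \<and> etgt (f J) = FO B J \<and> inverse_el (f J) (f' J)"
    "f (Unit V) = idel C (FO A (Unit V))"
    "\<And>t. gel T t \<Longrightarrow> lact C (f (etgt t)) (app A t) = ract C (app B (app M t)) (f (esrc t))"
    using Alg_morphism_iso[OF M] by metis
  obtain h h' where h: "\<And>J. J \<in> Job V \<Longrightarrow> esrc (h J) = FO A J \<and> etgt (h J) = FO B J \<and> inverse_el (h J) (h' J)"
    "h (Unit V) = idel C (FO A (Unit V))"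
    "\<And>t. gel T t \<Longrightarrow> lact C (h (etgt t)) (app A t) = ract C (app B (app M' t)) (h (esrc t))"
    using Alg_morphism_iso[OF M'] by metis
  have Mm: "theory_morphism V T U M" "theory_morphism V T U M'" using M M' by (simp_all add: Alg_morphism_iff)
  have fh [simp]: "gel C (f J)" "dm (f J) = Unit V" "esrc (f J) = FO A J" "etgt (f J) = FO B J"
    "gel C (h J)" "dm (h J) = Unit V" "esrc (h J) = FO A J" "etgt (h J) = FO B J" if "J \<in> Job V" for J
    using f(1)[OF that] h(1)[OF that] by (simp_all add: inverse_el_def)
  \<comment> \<open>Both isomorphisms are identities at \<open>I\<close>, and \<open>M\<close> and
    \<open>M'\<close> send the projection of \<open>T\<close> to that of \<open>U\<close>. Since
    \<open>B\<close> preserves the cotensor \<open>[L,I]\<close>, the component at \<open>L\<close>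
    is determined.\<close>
  have eq: "f L = h L" if L [simp]: "L \<in> Job V" for L
  proof (rule cotens_eqD[OF structure_el_cotens_B[OF L]])
    note [simp] = Job_unit
    have "ract C (app B (structure_el U L)) (f L) = ract C (app B (structure_el U L)) (h L)"
      using f(3)[OF structure_el_gel_T(1)[OF L]] h(3)[OF structure_el_gel_T(1)[OF L]]
        theory_morphism_structure_el[OF thy Mm(1) L] theory_morphism_structure_el[OF thy Mm(2) L] f(2) h(2)
      by simp
    then have "ract C (app B (structure_el U L)) (f L) \<lhd> Run V L = ract C (app B (structure_el U L)) (h L) \<lhd> Run V L" by simp
    then show "app B (structure_el U L) \<star>[C] f L = app B (structure_el U L) \<star>[C] h L"
      by (simp add: ract_def)
  qed simp_all
  interpret M: enriched_functor V \<kappa> T S M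
    by unfold_locales (simp add: vfunctor_theory_cvcat theory_morphismD(1)[OF Mm(1)])
  interpret M': enriched_functor V \<kappa> T S M'
    by unfold_locales (simp add: vfunctor_theory_cvcat theory_morphismD(1)[OF Mm(2)])
  note [simp] = theory_morphismD(2)[OF Mm(1)] theory_morphismD(2)[OF Mm(2)]
  have "FH M' J K = FH M J K" if [simp]: "J \<in> Job V" "K \<in> Job V" for J K
  proof -
    \<comment> \<open>The domain of this element is the hom-object \<open>T(J,K)\<close>, which lies
      in \<open>Vob\<close>, so \<open>B_faithful\<close> applies.\<close>
    let ?t = "gen T J K"
    have "ract C (app B (app M ?t)) (f J) = ract C (app B (app M' ?t)) (f J)"
      using f(3)[of ?t] h(3)[of ?t] by (simp add: eq)
    then have "ract C (ract C (app B (app M ?t)) (f J)) (f' J) = ract C (ract C (app B (app M' ?t)) (f J)) (f' J)"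
      by simp
    then have "app B (app M ?t) = app B (app M' ?t)"
      using f(1)[of J] by (simp add: ract_inverse_el)
    then have "app M ?t = app M' ?t"
      by (rule B_faithful[rotated -1]) simp_all
    then show ?thesis by (simp add: app_def)
  qed
  then show ?thesis by (simp add: functor_eq_def)
qed

end

locale central_setting = right_commutant_setting V \<kappa> T C A U B P Q
  for V :: "('o, 'a, 'm) base_scheme" (structure) and \<kappa> :: "'s itself"
    and T :: "('o, 'a) vtheory" and C :: "('x, 'o, 'a, 'n) cvcat_scheme" and A
    and U :: "('o, 'a) vtheory" and B P Q +
  fixes M :: "('o, 'o, 'a) vfun" and f f' :: "'o \<Rightarrow> ('x, 'a) elem"
  assumes M_morphism: "theory_morphism V T U M"
    and f: "J \<in> Job V \<Longrightarrow> esrc (f J) = FO A J \<and> etgt (f J) = FO B J \<and> inverse_el (f J) (f' J)"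
    and f_Unit: "f (Unit V) = idel C (FO A (Unit V))"
    and f_natural: "gel T t \<Longrightarrow> lact C (f (etgt t)) (app A t) = ract C (app B (app M t)) (f (esrc t))"
    and f'_natural: "gel T t \<Longrightarrow> lact C (f' (etgt t)) (app B (app M t)) = ract C (app A t) (f' (esrc t))"

sublocale central_setting \<subseteq> M: algebra_functor V \<kappa> T "theory_cvcat V U" M
  by unfold_locales (simp add: vfunctor_theory_cvcat theory_morphismD(1)[OF M_morphism])

context central_setting
begin

lemma FO_M [simp]: "J \<in> Job V \<Longrightarrow> FO M J = J"
  using theory_morphismD(2)[OF M_morphism] by simp

lemma app_M_structure_el [simp]: "L \<in> Job V \<Longrightarrow> app M (structure_el T L) = structure_el U L"
  by (rule theory_morphism_structure_el[OF thy M_morphism])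

lemma f_simps [simp]:
  assumes "J \<in> Job V"
  shows "gel C (f J)" "dm (f J) = Unit V" "esrc (f J) = FO A J" "etgt (f J) = FO B J"
    "gel C (f' J)" "dm (f' J) = Unit V" "esrc (f' J) = FO B J" "etgt (f' J) = FO A J"
  using f[OF assms] unfolding inverse_el_def by metis+

lemma f'_Unit: "f' (Unit V) = idel C (FO A (Unit V))"
proof -
  have "lact C (f (Unit V)) (f' (Unit V)) = idel C (FO A (Unit V))"
    using f[of "Unit V"] by (simp add: inverse_el_def)
  then show ?thesis by (simp add: f_Unit lact_idel)
qed

end

section \<open>Centrality\<close>

context system_of_arities
begin

definition clift :: "('x, 'o, 'a, 'n) vcat_scheme \<Rightarrow> ('x, 'a) elem \<Rightarrow> ('x, 'a) elem \<Rightarrow> 'o \<Rightarrow> ('x, 'a) elem" where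
  "clift X e \<phi> W = (THE h. gel X h \<and> esrc h = esrc \<phi> \<and> etgt h = esrc e \<and> dm h = W \<and> e \<star>[X] h = \<phi>)"

lemma clift_spec:
  assumes "cotens X e" "W \<in> Obj V" "gel X \<phi>" "etgt \<phi> = etgt e" "dm \<phi> = dm e \<otimes> W"
  shows "gel X (clift X e \<phi> W)" "esrc (clift X e \<phi> W) = esrc \<phi>" "etgt (clift X e \<phi> W) = esrc e"
    "dm (clift X e \<phi> W) = W" "e \<star>[X] clift X e \<phi> W = \<phi>"
proof -
  have "\<exists>!h. gel X h \<and> esrc h = esrc \<phi> \<and> etgt h = esrc e \<and> dm h = W \<and> e \<star>[X] h = \<phi>"
    using assms unfolding cotens_def by blast
  from theI'[OF this]
  show "gel X (clift X e \<phi> W)" "esrc (clift X e \<phi> W) = esrc \<phi>" "etgt (clift X e \<phi> W) = esrc e"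
    "dm (clift X e \<phi> W) = W" "e \<star>[X] clift X e \<phi> W = \<phi>"
    unfolding clift_def by blast+
qed

end

lemma (in functor_pair) vnaturalI_gen:
  assumes "W \<in> Obj V" "\<And>x. x \<in> EOb X \<Longrightarrow> gel Y (fam F G \<alpha> x) \<and> dm (fam F G \<alpha> x) = W"
    and "\<And>x y. x \<in> EOb X \<Longrightarrow> y \<in> EOb X \<Longrightarrow> fam F G \<alpha> y \<star>[Y] app F (gen X x y)
      = (app G (gen X x y) \<star>[Y] fam F G \<alpha> x) \<lhd> Swap V W (EHom X x y)"
  shows "vnatural V X Y F G W \<alpha>"
proof -
  have [simp]: "\<alpha> x \<in> Arr V" "Dom V (\<alpha> x) = W" "Cod V (\<alpha> x) = EHom Y (FO F x) (FO G x)" if "x \<in> EOb X" for x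
    using assms(2)[OF that] by (simp_all add: gel_def)
  have "EComp Y (FO F x) (FO F y) (FO G y) \<cdot> (\<alpha> y \<odot> FH F x y) =
        EComp Y (FO F x) (FO G x) (FO G y) \<cdot> (FH G x y \<odot> \<alpha> x) \<cdot> Swap V W (EHom X x y)"
    if [simp]: "x \<in> EOb X" "y \<in> EOb X" for x y
    using assms(1) assms(3)[OF that] by (simp add: fam_def app_def cmp_def pre_def)
  then show ?thesis using assms(1) unfolding vnatural_def by (simp add: hom_def)
qed

section \<open>The action of arrows of \<open>U\<close> on cotensors\<close>

context central_setting
begin

lemma Cot_Job [simp]: "K \<in> Job V \<Longrightarrow> L \<in> Job V \<Longrightarrow> Cot S K L \<in> Job V"
  using S.ctu_gel(3)[of K L] by simp

text \<open>\<open>[J,-]\<close> applied to the projection \<open>L \<rightarrow> I\<close>. Its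
  target is \<open>[J,I] = J\<close> on the nose, by the choice of designated cotensors in
  \<open>theory_cvcat\<close>.\<close>

definition proj :: "'o \<Rightarrow> 'o \<Rightarrow> ('o, 'a) elem" where
  "proj J L = app (S.cotf J) (structure_el U L)"

text \<open>An arrow \<open>u : J \<rightarrow> I\<close> of \<open>U\<close> acts as \<open>[u,1] : [J,L] \<rightarrow> L\<close>. Here \<open>L = [L,I]\<close>, so this is
  determined by its composites with the projections \<open>L \<rightarrow> I\<close>.\<close>

definition act_gen :: "'o \<Rightarrow> 'o \<Rightarrow> ('o, 'a) elem" where
  "act_gen J L = clift S (structure_el U L) ((gen S J (Unit V) \<star>[S] proj J L) \<lhd> Swap V L (EHom S J (Unit V))) (EHom S J (Unit V))"

definition act :: "'o \<Rightarrow> ('o, 'a) elem \<Rightarrow> ('o, 'a) elem" where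
  "act L v = act_gen (esrc v) L \<lhd> earr v"

lemma proj_simps [simp]:
  assumes "J \<in> Job V" "L \<in> Job V"
  shows "gel S (proj J L)" "esrc (proj J L) = Cot S J L" "etgt (proj J L) = J" "dm (proj J L) = L"
  using S.cotf_spec[OF assms(1) structure_el_gel(1)[OF assms(2)]] assms by (simp_all add: proj_def)

text \<open>The counit of \<open>[J,-]\<close> is natural at the projection of \<open>L\<close>; so
  \<open>[J,L]\<close> reaches \<open>I\<close> equally through \<open>J\<close> and through
  \<open>L\<close>.\<close>

lemma proj_ctu: "J \<in> Job V \<Longrightarrow> L \<in> Job V \<Longrightarrow> structure_el U J \<star>[S] proj J L = (structure_el U L \<star>[S] S.ctu J L) \<lhd> Swap V J L"
  using S.cotf_spec(3)[of J "structure_el U L"] by (simp add: proj_def)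

lemma act_gen_simps [simp]:
  assumes [simp]: "J \<in> Job V" "L \<in> Job V"
  shows "gel S (act_gen J L)" "esrc (act_gen J L) = Cot S J L" "etgt (act_gen J L) = L" "dm (act_gen J L) = EHom S J (Unit V)"
    "structure_el U L \<star>[S] act_gen J L = (gen S J (Unit V) \<star>[S] proj J L) \<lhd> Swap V L (EHom S J (Unit V))"
proof -
  let ?\<phi> = "(gen S J (Unit V) \<star>[S] proj J L) \<lhd> Swap V L (EHom S J (Unit V))"
  note s = clift_spec[OF structure_el_cotens_S[OF assms(2)], of "EHom S J (Unit V)" ?\<phi>]
  show "gel S (act_gen J L)" unfolding act_gen_def by (rule s(1)) simp_all
  have "esrc (act_gen J L) = esrc ?\<phi>" unfolding act_gen_def by (rule s(2)) simp_all
  then show "esrc (act_gen J L) = Cot S J L" by simp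
  have "etgt (act_gen J L) = esrc (structure_el U L)" unfolding act_gen_def by (rule s(3)) simp_all
  then show "etgt (act_gen J L) = L" by simp
  show "dm (act_gen J L) = EHom S J (Unit V)" unfolding act_gen_def by (rule s(4)) simp_all
  show "structure_el U L \<star>[S] act_gen J L = ?\<phi>" unfolding act_gen_def by (rule s(5)) simp_all
qed

lemma gen_pre: "gel S u \<Longrightarrow> esrc u = J \<Longrightarrow> etgt u = K \<Longrightarrow> gen S J K \<lhd> earr u = u"
  using S.gel_eq_gen by metis

lemma act_simps [simp]:
  assumes [simp]: "gel S v" "etgt v = Unit V" "L \<in> Job V"
  shows "gel S (act L v)" "esrc (act L v) = Cot S (esrc v) L" "etgt (act L v) = L" "dm (act L v) = dm v"
    "structure_el U L \<star>[S] act L v = (v \<star>[S] proj (esrc v) L) \<lhd> Swap V L (dm v)"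
proof -
  have [simp]: "esrc v \<in> Job V" "earr v \<in> Arr V" "Cod V (earr v) = EHom S (esrc v) (Unit V)"
    using gelD[OF assms(1)] by simp_all
  show "gel S (act L v)" "esrc (act L v) = Cot S (esrc v) L" "etgt (act L v) = L" "dm (act L v) = dm v"
    by (simp_all add: act_def)
  have "structure_el U L \<star>[S] act L v = (gen S (esrc v) (Unit V) \<star>[S] proj (esrc v) L) \<lhd> ((earr v \<odot> Ident V L) \<cdot> Swap V L (dm v))"
    by (simp add: act_def S.cmp_pre_right Swap_nat)
  also have "\<dots> = ((gen S (esrc v) (Unit V) \<lhd> earr v) \<star>[S] proj (esrc v) L) \<lhd> Swap V L (dm v)"
    by (simp add: S.cmp_pre_left)
  finally show "structure_el U L \<star>[S] act L v = (v \<star>[S] proj (esrc v) L) \<lhd> Swap V L (dm v)"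
    by (simp add: gen_pre)
qed

lemma act_pre:
  assumes "gel S v" "etgt v = Unit V" "L \<in> Job V" "p \<in> Arr V" "Cod V p = dm v"
  shows "act L (v \<lhd> p) = act L v \<lhd> p"
proof -
  have [simp]: "esrc v \<in> Job V" "earr v \<in> Arr V" "Cod V (earr v) = EHom S (esrc v) (Unit V)"
    using gelD[OF assms(1)] assms(2) by simp_all
  show ?thesis using assms by (simp add: act_def) (simp add: pre_def)
qed

lemma act_Unit:
  assumes [simp]: "gel S v" "etgt v = Unit V"
  shows "act (Unit V) v = v"
proof -
  have [simp]: "esrc v \<in> Job V" using gelD[OF assms(1)] by simp
  have sU: "structure_el U (Unit V) = idel S (Unit V)"
    using structure_el_Unit[OF thU] by (simp add: idel_def theory_cvcat_simps)
  interpret E: enriched_functor V \<kappa> S S "S.cotf (esrc v)"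
    by unfold_locales (rule S.cotf_functor, simp)
  have g: "proj (esrc v) (Unit V) = idel S (esrc v)"
    by (simp add: proj_def sU E.app_idel)
  show ?thesis
  proof (rule S.cotens_eqD[OF structure_el_cotens_S[OF Job_unit]])
    show "structure_el U (Unit V) \<star>[S] act (Unit V) v = structure_el U (Unit V) \<star>[S] v"
      by (simp add: g S.cmp_idel_right Run_Swap) (simp add: sU S.cmp_idel_left)
  qed simp_all
qed

text \<open>After composition with the projection of \<open>L\<close>, the two sides are those of
  \<open>proj_ctu\<close>. The identity law of \<open>pow_fun\<close> and its preservation of
  cotensors rest on this.\<close>

lemma act_structure_el:
  assumes [simp]: "J \<in> Job V" "L \<in> Job V"
  shows "act L (structure_el U J) = S.ctu J L"
proof (rule S.cotens_eqD[OF structure_el_cotens_S[OF assms(2)]])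
  show "structure_el U L \<star>[S] act L (structure_el U J) = structure_el U L \<star>[S] S.ctu J L"
    by (simp add: proj_ctu)
qed simp_all

text \<open>The image under \<open>P\<close> of the universal arrow
  \<open>J \<rightarrow> I\<close>, as a family \<open>[J,A] \<rightarrow> A\<close> evaluated at
  \<open>L\<close>; naturality in \<open>L\<close> is what membership in the commutant
  provides.\<close>

definition perp_nat :: "'o \<Rightarrow> 'o \<Rightarrow> ('x, 'a) elem" where
  "perp_nat J L = Elem (Cot C J (FO A L)) (FO A L) (pr J (Unit V) L \<cdot> FH P J (Unit V))"

lemma perp_nat_spec:
  assumes J [simp]: "J \<in> Job V"
  shows "L \<in> Job V \<Longrightarrow> gel C (perp_nat J L)" "L \<in> Job V \<Longrightarrow> dm (perp_nat J L) = EHom S J (Unit V)"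
    "gel T t \<Longrightarrow> perp_nat J (etgt t) \<star>[C] app (cotf J) (app A t) = (app A t \<star>[C] perp_nat J (esrc t)) \<lhd> Swap V (EHom S J (Unit V)) (dm t)"
proof -
  interpret functor_pair V \<kappa> T C "cA J" "cA (Unit V)" by (rule pair[OF J Job_unit])
  have "vnatural V T C (cA J) (cA (Unit V)) (Dom V (FH P J (Unit V))) (\<lambda>L. pr J (Unit V) L \<cdot> FH P J (Unit V))"
    by (rule vnatural_pre[OF pr_vnatural]) simp_all
  then have n: "vnatural V T C (cA J) (cA (Unit V)) (EHom S J (Unit V)) (\<lambda>L. pr J (Unit V) L \<cdot> FH P J (Unit V))"
    by simp
  have t: "fam (cA J) (cA (Unit V)) (\<lambda>L. pr J (Unit V) L \<cdot> FH P J (Unit V)) L = perp_nat J L" if "L \<in> Job V" for L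
    using that by (simp add: fam_def perp_nat_def Cot_Unit)
  show "L \<in> Job V \<Longrightarrow> gel C (perp_nat J L)" "L \<in> Job V \<Longrightarrow> dm (perp_nat J L) = EHom S J (Unit V)"
    using vnatural_simps(2,3)[OF n, of L] t[of L] by (simp_all add: perp_nat_def)
  show "gel T t \<Longrightarrow> perp_nat J (etgt t) \<star>[C] app (cotf J) (app A t) = (app A t \<star>[C] perp_nat J (esrc t)) \<lhd> Swap V (EHom S J (Unit V)) (dm t)"
    using vnatural_simps(4)[OF n, of t] gelD(1,2)[of T t] by (simp add: t app_cot_vfun cotf_Unit)
qed

lemma perp_nat_simps [simp]: "esrc (perp_nat J L) = Cot C J (FO A L)" "etgt (perp_nat J L) = FO A L"
  by (simp_all add: perp_nat_def)

text \<open>The canonical arrow \<open>B [J,L] \<rightarrow> [J, A L]\<close>, induced by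
  \<open>B\<close> of the counit and \<open>B L \<cong> A L\<close>. It is an element with domain
  \<open>I\<close>, so the element to be lifted has domain \<open>J \<otimes> I\<close>, hence
  \<open>Run\<close>.\<close>

definition comparison :: "'o \<Rightarrow> 'o \<Rightarrow> ('x, 'a) elem" where
  "comparison J L = clift C (ctu J (FO A L)) (lact C (f' L) (app B (S.ctu J L)) \<lhd> Run V J) (Unit V)"

lemma comparison_simps [simp]:
  assumes [simp]: "J \<in> Job V" "L \<in> Job V"
  shows "gel C (comparison J L)" "esrc (comparison J L) = FO B (Cot S J L)" "etgt (comparison J L) = Cot C J (FO A L)"
    "dm (comparison J L) = Unit V" "ract C (ctu J (FO A L)) (comparison J L) = lact C (f' L) (app B (S.ctu J L))"
proof -
  have AL [simp]: "FO A L \<in> EOb C" by simp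
  let ?\<phi> = "lact C (f' L) (app B (S.ctu J L)) \<lhd> Run V J"
  note s = clift_spec[OF ctu_cotens[OF assms(1) AL], of "Unit V" ?\<phi>]
  show 1: "gel C (comparison J L)" unfolding comparison_def by (rule s(1)) simp_all
  have "esrc (comparison J L) = esrc ?\<phi>" unfolding comparison_def by (rule s(2)) simp_all
  then show 2: "esrc (comparison J L) = FO B (Cot S J L)" by simp
  have "etgt (comparison J L) = esrc (ctu J (FO A L))" unfolding comparison_def by (rule s(3)) simp_all
  then show 3: "etgt (comparison J L) = Cot C J (FO A L)" by simp
  show 4: "dm (comparison J L) = Unit V" unfolding comparison_def by (rule s(4)) simp_all
  have "ctu J (FO A L) \<star>[C] comparison J L = ?\<phi>" unfolding comparison_def by (rule s(5)) simp_all
  then show "ract C (ctu J (FO A L)) (comparison J L) = lact C (f' L) (app B (S.ctu J L))"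
    by (simp add: ract_def)
qed

text \<open>After composition with the counit of \<open>[J,-]\<close> in \<open>C\<close>,
  naturality of the counits in \<open>U\<close> and in \<open>C\<close> and of \<open>f'\<close>
  suffices.\<close>

lemma comparison_natural:
  assumes J [simp]: "J \<in> Job V" and t [simp]: "gel T t"
  shows "lact C (comparison J (etgt t)) (app B (app (S.cotf J) (app M t))) = ract C (app (cotf J) (app A t)) (comparison J (esrc t))"
proof -
  have L [simp]: "esrc t \<in> Job V" "etgt t \<in> Job V" using gelD(1,2)[OF t] by simp_all
  have AL [simp]: "FO A (esrc t) \<in> EOb C" "FO A (etgt t) \<in> EOb C" by simp_all
  note sp [simp] = S.cotf_spec(1,2)[OF J M.A.gel_app[OF t]] cotf_spec(1,2)[OF J A.gel_app[OF t]]
  note sc = S.cotf_spec(3)[OF J M.A.gel_app[OF t], simplified] cotf_spec(3)[OF J A.gel_app[OF t], simplified]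
  let ?y = "app (S.cotf J) (app M t)"
  show ?thesis
  proof (rule cotens_eqD[OF ctu_cotens[OF J AL(2)]])
    have "ctu J (FO A (etgt t)) \<star>[C] lact C (comparison J (etgt t)) (app B ?y)
        = lact C (f' (etgt t)) (app B (S.ctu J (etgt t))) \<star>[C] app B ?y"
      by (simp flip: cmp_ract_lact)
    also have "\<dots> = lact C (f' (etgt t)) (app B (S.ctu J (etgt t) \<star>[S] ?y))"
      by (simp add: cmp_lact B.app_cmp)
    also have "\<dots> = lact C (f' (etgt t)) (app B (app M t) \<star>[C] app B (S.ctu J (esrc t))) \<lhd> Swap V J (dm t)"
      by (simp add: sc B.app_pre B.app_cmp lact_pre)
    also have "\<dots> = (lact C (f' (etgt t)) (app B (app M t)) \<star>[C] app B (S.ctu J (esrc t))) \<lhd> Swap V J (dm t)"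
      by (simp add: cmp_lact)
    also have "\<dots> = (app A t \<star>[C] ract C (ctu J (FO A (esrc t))) (comparison J (esrc t))) \<lhd> Swap V J (dm t)"
      by (simp add: f'_natural cmp_ract_lact)
    also have "\<dots> = ract C (app A t \<star>[C] ctu J (FO A (esrc t))) (comparison J (esrc t)) \<lhd> Swap V J (dm t)"
      by (simp add: cmp_ract del: comparison_simps(5))
    also have "\<dots> = ctu J (FO A (etgt t)) \<star>[C] ract C (app (cotf J) (app A t)) (comparison J (esrc t))"
      by (simp add: cmp_ract sc ract_pre)
    finally show "ctu J (FO A (etgt t)) \<star>[C] lact C (comparison J (etgt t)) (app B ?y)
      = ctu J (FO A (etgt t)) \<star>[C] ract C (app (cotf J) (app A t)) (comparison J (esrc t))" .
  qed simp_all
qed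

text \<open>Composed with the counit, both arrows \<open>B J \<rightarrow> [J, A I]\<close> become
  \<open>B\<close> of the projection, by \<open>app_AP_structure_el\<close>. This links
  \<open>comparison\<close>, built from \<open>f'\<close> and cotensors, with
  right-commutation.\<close>

lemma comparison_Unit:
  assumes J [simp]: "J \<in> Job V"
  shows "comparison J (Unit V) = perp_iso J"
proof -
  have c [simp]: "FO A (Unit V) \<in> EOb C" by simp
  note [simp] = perp_iso_spec(1-4)[OF J]
  show ?thesis
  proof (rule cotens_eqD[OF ctu_cotens[OF J c]])
    have "ract C (ctu J (FO A (Unit V))) (comparison J (Unit V)) = app B (structure_el U J)"
      by (simp add: f'_Unit lact_idel)
    also have "\<dots> = ract C (ctu J (FO A (Unit V))) (perp_iso J)"
      using perp_iso_spec(7)[OF J structure_el_gel(1)[OF J]] perp_iso_spec(6)[OF J] by (simp add: lact_idel app_AP_structure_el)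
    finally have "ract C (ctu J (FO A (Unit V))) (comparison J (Unit V)) \<lhd> Run V J = ract C (ctu J (FO A (Unit V))) (perp_iso J) \<lhd> Run V J"
      by simp
    then show "ctu J (FO A (Unit V)) \<star>[C] comparison J (Unit V) = ctu J (FO A (Unit V)) \<star>[C] perp_iso J"
      by (simp add: ract_def del: comparison_simps(5))
  qed simp_all
qed

text \<open>The composite \<open>B [J,L] \<rightarrow> [J, A L] \<rightarrow> A L \<rightarrow> B
  L\<close>, whose middle arrow is the action of \<open>J \<rightarrow> I\<close> on
  \<open>A\<close> given by the commutant.\<close>

definition transported :: "'o \<Rightarrow> 'o \<Rightarrow> ('x, 'a) elem" where
  "transported J L = ract C (lact C (f L) (perp_nat J L)) (comparison J L)"

lemma transported_simps [simp]:
  assumes [simp]: "J \<in> Job V" "L \<in> Job V"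
  shows "gel C (transported J L)" "esrc (transported J L) = FO B (Cot S J L)" "etgt (transported J L) = FO B L"
    "dm (transported J L) = EHom S J (Unit V)"
  using perp_nat_spec(1,2)[OF assms] by (simp_all add: transported_def)

lemma transported_natural:
  assumes J [simp]: "J \<in> Job V" and t [simp]: "gel T t"
  shows "transported J (etgt t) \<star>[C] app B (app (S.cotf J) (app M t))
    = (app B (app M t) \<star>[C] transported J (esrc t)) \<lhd> Swap V (EHom S J (Unit V)) (dm t)"
proof -
  have L [simp]: "esrc t \<in> Job V" "etgt t \<in> Job V" using gelD(1,2)[OF t] by simp_all
  note [simp] = S.cotf_spec(1,2)[OF J M.A.gel_app[OF t]] cotf_spec(1,2)[OF J A.gel_app[OF t]] perp_nat_spec(1,2)[OF J]
  let ?x = "app B (app (S.cotf J) (app M t))" and ?W = "EHom S J (Unit V)"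
  have "transported J (etgt t) \<star>[C] ?x = lact C (f (etgt t)) (perp_nat J (etgt t) \<star>[C] lact C (comparison J (etgt t)) ?x)"
    by (simp add: transported_def cmp_ract_lact cmp_lact)
  also have "\<dots> = lact C (f (etgt t)) (ract C (perp_nat J (etgt t) \<star>[C] app (cotf J) (app A t)) (comparison J (esrc t)))"
    by (simp add: comparison_natural cmp_ract)
  also have "\<dots> = lact C (f (etgt t)) (ract C (app A t \<star>[C] perp_nat J (esrc t)) (comparison J (esrc t))) \<lhd> Swap V ?W (dm t)"
    by (simp add: perp_nat_spec(3) ract_pre lact_pre)
  also have "\<dots> = (lact C (f (etgt t)) (app A t) \<star>[C] ract C (perp_nat J (esrc t)) (comparison J (esrc t))) \<lhd> Swap V ?W (dm t)"
    by (simp add: cmp_lact cmp_ract ract_lact)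
  also have "\<dots> = (app B (app M t) \<star>[C] lact C (f (esrc t)) (ract C (perp_nat J (esrc t)) (comparison J (esrc t)))) \<lhd> Swap V ?W (dm t)"
    by (simp add: f_natural cmp_ract_lact)
  also have "\<dots> = (app B (app M t) \<star>[C] transported J (esrc t)) \<lhd> Swap V ?W (dm t)"
    by (simp add: transported_def ract_lact)
  finally show ?thesis .
qed

text \<open>At \<open>I\<close> the outer arrows reduce to \<open>perp_iso\<close> and an identity,
  so that naturality of \<open>perp_iso\<close> at the universal arrow
  \<open>J \<rightarrow> I\<close> gives \<open>B\<close> itself.\<close>

lemma transported_Unit:
  assumes J [simp]: "J \<in> Job V"
  shows "transported J (Unit V) = app B (gen S J (Unit V))"
proof -
  note [simp] = perp_iso_spec(1-4)[OF J] perp_nat_spec(1,2)[OF J]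
  have "app B (gen S J (Unit V)) = ract C (app AP (gen S J (Unit V))) (perp_iso J)"
    using perp_iso_spec(7)[OF J, of "gen S J (Unit V)"] perp_iso_spec(6)[OF J] by (simp add: lact_idel)
  also have "app AP (gen S J (Unit V)) = perp_nat J (Unit V)"
    by (simp add: app_def perp_nat_def FH_AP Cot_Unit)
  finally show ?thesis by (simp add: transported_def f_Unit lact_idel comparison_Unit)
qed

text \<open>The family \<open>transported\<close> is natural by construction. It agrees with the image of \<open>act_gen\<close> under \<open>B\<close>
  after composition with the projections \<open>L \<rightarrow> I\<close>, hence everywhere; as \<open>B\<close> is faithful, \<open>act_gen\<close> is
  natural.\<close>

lemma app_B_act_gen:
  assumes J [simp]: "J \<in> Job V" and L [simp]: "L \<in> Job V"
  shows "app B (act_gen J L) = transported J L"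
proof (rule cotens_eqD[OF structure_el_cotens_B[OF L]])
  let ?W = "EHom S J (Unit V)"
  have "app B (structure_el U L) \<star>[C] app B (act_gen J L) = (app B (gen S J (Unit V)) \<star>[C] app B (proj J L)) \<lhd> Swap V L ?W"
    by (simp add: B.app_pre B.app_cmp flip: B.app_cmp[of "structure_el U L"])
  also have "app B (gen S J (Unit V)) \<star>[C] app B (proj J L) = (app B (structure_el U L) \<star>[C] transported J L) \<lhd> Swap V ?W L"
    using transported_natural[OF J structure_el_gel_T(1)[OF L]] by (simp add: transported_Unit proj_def)
  finally show "app B (structure_el U L) \<star>[C] app B (act_gen J L) = app B (structure_el U L) \<star>[C] transported J L"
    by simp
qed simp_all

text \<open>\<open>B\<close> turns the square into \<open>transported_natural\<close>. Universal
  elements are taken since \<open>B_faithful\<close> asks for a domain in \<open>Vob\<close>;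
  \<open>act_natural\<close> extends the square to all elements.\<close>

lemma act_gen_natural_gen:
  assumes J [simp]: "J \<in> Job V" and L [simp]: "L \<in> Job V" "L' \<in> Job V"
  shows "act_gen J L' \<star>[S] app (S.cotf J) (app M (gen T L L'))
    = (app M (gen T L L') \<star>[S] act_gen J L) \<lhd> Swap V (EHom S J (Unit V)) (EHom T L L')"
proof (rule B_faithful)
  have t [simp]: "gel T (gen T L L')" by simp
  note [simp] = S.cotf_spec(1,2)[OF J M.A.gel_app[OF t]]
  show "app B (act_gen J L' \<star>[S] app (S.cotf J) (app M (gen T L L')))
      = app B ((app M (gen T L L') \<star>[S] act_gen J L) \<lhd> Swap V (EHom S J (Unit V)) (EHom T L L'))"
    using transported_natural[OF J t] by (simp add: B.app_pre B.app_cmp app_B_act_gen)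
qed (use S.cotf_spec(1,2)[OF J M.A.gel_app, of "gen T L L'"] in simp_all)

lemma act_natural:
  assumes v [simp]: "gel S v" "etgt v = Unit V" and t [simp]: "gel T t"
  shows "act (etgt t) v \<star>[S] app (S.cotf (esrc v)) (app M t)
    = (app M t \<star>[S] act (esrc t) v) \<lhd> Swap V (dm v) (dm t)"
proof -
  have J [simp]: "esrc v \<in> Job V" "earr v \<in> Arr V" "Cod V (earr v) = EHom S (esrc v) (Unit V)"
    using gelD[OF v(1)] by simp_all
  have L [simp]: "esrc t \<in> Job V" "etgt t \<in> Job V" "earr t \<in> Arr V" "Cod V (earr t) = EHom T (esrc t) (etgt t)"
    using gelD[OF t] by simp_all
  let ?J = "esrc v" and ?g = "gen T (esrc t) (etgt t)"
  have tg: "t = ?g \<lhd> earr t" by (rule A.X.gel_eq_gen) simp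
  interpret E: enriched_functor V \<kappa> S S "S.cotf ?J" by unfold_locales (rule S.cotf_functor, simp)
  have "act (etgt t) v \<star>[S] app (S.cotf ?J) (app M (?g \<lhd> earr t))
      = (act_gen ?J (etgt t) \<star>[S] app (S.cotf ?J) (app M ?g)) \<lhd> (earr v \<odot> earr t)"
    by (simp add: act_def M.A.app_pre E.app_pre S.cmp_pre_left S.cmp_pre_right)
  also have "\<dots> = (app M ?g \<star>[S] act_gen ?J (esrc t)) \<lhd> ((earr t \<odot> earr v) \<cdot> Swap V (dm v) (dm t))"
    by (simp add: act_gen_natural_gen Swap_nat)
  also have "\<dots> = (app M (?g \<lhd> earr t) \<star>[S] act (esrc t) v) \<lhd> Swap V (dm v) (dm t)"
    by (simp add: act_def M.A.app_pre S.cmp_pre_left S.cmp_pre_right)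
  finally show ?thesis by (simp flip: tg)
qed

text \<open>As \<open>K = [K,I]\<close>, an arrow \<open>J \<rightarrow> K\<close> is a
  \<open>K\<close>-indexed family of arrows \<open>J \<rightarrow> I\<close>. Each of them acts as
  \<open>[J,L] \<rightarrow> L\<close>, and the cotensor \<open>[K,L]\<close> collects the results
  to an arrow \<open>[J,L] \<rightarrow> [K,L]\<close>.\<close>

definition pow_gen :: "'o \<Rightarrow> 'o \<Rightarrow> 'o \<Rightarrow> ('o, 'a) elem" where
  "pow_gen J K L = clift S (S.ctu K L) (act L (structure_el U K \<star>[S] gen S J K)) (EHom S J K)"

text \<open>The functor \<open>[-,L]\<close> on \<open>U\<close>, which becomes the partial functor
  of the bifold algebra at a fixed \<open>L\<close>.\<close>

definition pow_fun :: "'o \<Rightarrow> ('o, 'o, 'a) vfun" where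
  "pow_fun L = \<lparr>FO = (\<lambda>J. Cot S J L), FH = (\<lambda>J K. earr (pow_gen J K L))\<rparr>"

lemma FO_pow_fun [simp]: "FO (pow_fun L) J = Cot S J L" and FH_pow_fun [simp]: "FH (pow_fun L) J K = earr (pow_gen J K L)"
  by (simp_all add: pow_fun_def)

lemma pow_gen_simps [simp]:
  assumes [simp]: "J \<in> Job V" "K \<in> Job V" "L \<in> Job V"
  shows "gel S (pow_gen J K L)" "esrc (pow_gen J K L) = Cot S J L" "etgt (pow_gen J K L) = Cot S K L" "dm (pow_gen J K L) = EHom S J K"
    "S.ctu K L \<star>[S] pow_gen J K L = act L (structure_el U K \<star>[S] gen S J K)"
proof -
  have L: "L \<in> EOb S" by simp
  let ?\<phi> = "act L (structure_el U K \<star>[S] gen S J K)"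
  note s = clift_spec[OF S.ctu_cotens[OF assms(2) L], of "EHom S J K" ?\<phi>]
  show "gel S (pow_gen J K L)" unfolding pow_gen_def by (rule s(1)) simp_all
  have "esrc (pow_gen J K L) = esrc ?\<phi>" unfolding pow_gen_def by (rule s(2)) simp_all
  then show "esrc (pow_gen J K L) = Cot S J L" by simp
  have "etgt (pow_gen J K L) = esrc (S.ctu K L)" unfolding pow_gen_def by (rule s(3)) simp_all
  then show "etgt (pow_gen J K L) = Cot S K L" by simp
  show "dm (pow_gen J K L) = EHom S J K" unfolding pow_gen_def by (rule s(4)) simp_all
  show "S.ctu K L \<star>[S] pow_gen J K L = ?\<phi>" unfolding pow_gen_def by (rule s(5)) simp_all
qed

lemma pow_fun_spec:
  assumes u [simp]: "gel S u" and L [simp]: "L \<in> Job V"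
  shows "gel S (app (pow_fun L) u)" "dm (app (pow_fun L) u) = dm u"
    "S.ctu (etgt u) L \<star>[S] app (pow_fun L) u = act L (structure_el U (etgt u) \<star>[S] u)"
proof -
  have J [simp]: "esrc u \<in> Job V" "etgt u \<in> Job V" "earr u \<in> Arr V" "Cod V (earr u) = EHom S (esrc u) (etgt u)"
    using gelD[OF u] by simp_all
  let ?g = "gen S (esrc u) (etgt u)"
  have a: "app (pow_fun L) u = pow_gen (esrc u) (etgt u) L \<lhd> earr u"
    by (simp add: app_def pre_def)
  show "gel S (app (pow_fun L) u)" "dm (app (pow_fun L) u) = dm u" by (simp_all add: a)
  have "S.ctu (etgt u) L \<star>[S] app (pow_fun L) u = act L (structure_el U (etgt u) \<star>[S] ?g) \<lhd> (Ident V (etgt u) \<odot> earr u)"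
    by (simp add: a S.cmp_pre_right)
  also have "\<dots> = act L (structure_el U (etgt u) \<star>[S] (?g \<lhd> earr u))"
    by (simp add: S.cmp_pre_right act_pre)
  finally show "S.ctu (etgt u) L \<star>[S] app (pow_fun L) u = act L (structure_el U (etgt u) \<star>[S] u)"
    by (simp add: gen_pre)
qed

text \<open>Both sides agree after the projection of the target, by \<open>act_Unit\<close>.
  Consequences are the identity right face and the uniqueness of factorizations in
  \<open>pow_gen_end\<close>.\<close>

lemma pow_fun_Unit:
  assumes u [simp]: "gel S u"
  shows "app (pow_fun (Unit V)) u = u"
proof -
  have J [simp]: "esrc u \<in> Job V" "etgt u \<in> Job V" using gelD[OF u] by simp_all
  note [simp] = pow_fun_spec(1,2)[OF u Job_unit]
  show ?thesis
    by (rule S.cotens_eqD[OF structure_el_cotens_S[OF J(2)]])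
      (use pow_fun_spec(3)[OF u Job_unit] in \<open>simp_all add: act_Unit\<close>)
qed

text \<open>The target of a projection is \<open>I\<close>, where the counit
  \<open>[I,L] \<rightarrow> L\<close> is an identity, so \<open>pow_fun\<close> reduces to
  \<open>act\<close>. Through \<open>preserves_cotensors_from_structure\<close> this yields
  preservation of cotensors by \<open>[-,L]\<close>.\<close>

lemma pow_fun_structure_el:
  assumes J [simp]: "J \<in> Job V" and L [simp]: "L \<in> Job V"
  shows "app (pow_fun L) (structure_el U J) = S.ctu J L"
proof -
  note [simp] = pow_fun_spec(1,2)[OF structure_el_gel(1)[OF J] L]
  have L': "L \<in> EOb S" by simp
  have i: "idel S L \<star>[S] app (pow_fun L) (structure_el U J) = act L (idel S (Unit V) \<star>[S] structure_el U J)"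
    using pow_fun_spec(3)[OF structure_el_gel(1)[OF J] L] structure_el_Unit[OF thU]
    by (simp add: S.ctu_Unit) (simp add: idel_def theory_cvcat_simps)
  show ?thesis
    by (rule S.cotens_eqD[OF S.cotens_idel[OF L']])
      (use i in \<open>simp_all add: S.cmp_idel_left act_pre act_structure_el S.Cot_Unit\<close>)
qed

text \<open>After composition with the counit this is \<open>act_natural\<close> for the components
  of \<open>u\<close> indexed by its target. It is the commutation of \<open>M\<close> with the
  identity of \<open>U\<close>, on which both centrality and the bifold algebra rest.\<close>

lemma pow_fun_natural:
  assumes u [simp]: "gel S u" and t [simp]: "gel T t"
  shows "app (pow_fun (etgt t)) u \<star>[S] app (S.cotf (esrc u)) (app M t)
    = (app (S.cotf (etgt u)) (app M t) \<star>[S] app (pow_fun (esrc t)) u) \<lhd> Swap V (dm u) (dm t)"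
proof -
  have J [simp]: "esrc u \<in> Job V" "etgt u \<in> Job V" using gelD[OF u] by simp_all
  have L [simp]: "esrc t \<in> Job V" "etgt t \<in> Job V" using gelD[OF t] by simp_all
  have L': "etgt t \<in> EOb S" by simp
  let ?K = "etgt u" and ?c = "\<lambda>J. app (S.cotf J) (app M t)"
  note p [simp] = pow_fun_spec[OF u L(1)] pow_fun_spec[OF u L(2)] S.cotf_spec(1,2)[OF J(1) M.A.gel_app[OF t]]
    S.cotf_spec(1,2)[OF J(2) M.A.gel_app[OF t]]
  note sc = S.cotf_spec(3)[OF J(2) M.A.gel_app[OF t], simplified]
  show ?thesis
  proof (rule S.cotens_eqD[OF S.ctu_cotens[OF J(2) L']])
    have "S.ctu ?K (etgt t) \<star>[S] (app (pow_fun (etgt t)) u \<star>[S] ?c (esrc u))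
        = (act (etgt t) (structure_el U ?K \<star>[S] u) \<star>[S] ?c (esrc u)) \<lhd> Assoc' ?K (dm u) (dm t)"
      by (simp add: S.cmp_assoc')
    also have "\<dots> = (app M t \<star>[S] act (esrc t) (structure_el U ?K \<star>[S] u)) \<lhd> (exch ?K (dm t) (dm u) \<cdot> (Ident V ?K \<odot> Swap V (dm u) (dm t)))"
      using act_natural[of "structure_el U ?K \<star>[S] u" t] by (simp add: Swap_tens_left)
    also have "\<dots> = ((app M t \<star>[S] S.ctu ?K (esrc t)) \<star>[S] app (pow_fun (esrc t)) u)
        \<lhd> ((Swap V ?K (dm t) \<odot> Ident V (dm u)) \<cdot> (Assoc' ?K (dm t) (dm u) \<cdot> (Ident V ?K \<odot> Swap V (dm u) (dm t))))"
      by (simp add: S.cmp_assoc exch_def)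
    also have "\<dots> = ((S.ctu ?K (etgt t) \<star>[S] ?c ?K) \<star>[S] app (pow_fun (esrc t)) u)
        \<lhd> (Assoc' ?K (dm t) (dm u) \<cdot> (Ident V ?K \<odot> Swap V (dm u) (dm t)))"
      by (simp add: sc S.cmp_pre_left)
    also have "\<dots> = S.ctu ?K (etgt t) \<star>[S] ((?c ?K \<star>[S] app (pow_fun (esrc t)) u) \<lhd> Swap V (dm u) (dm t))"
      by (simp add: S.cmp_assoc S.cmp_pre_right)
    finally show "S.ctu ?K (etgt t) \<star>[S] (app (pow_fun (etgt t)) u \<star>[S] ?c (esrc u))
      = S.ctu ?K (etgt t) \<star>[S] ((?c ?K \<star>[S] app (pow_fun (esrc t)) u) \<lhd> Swap V (dm u) (dm t))" .
  qed simp_all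
qed

text \<open>\<open>act L v\<close> is determined by its composite with the projection of
  \<open>L\<close>, and \<open>proj\<close> carries \<open>[u,1]\<close> to \<open>u\<close>.
  Compatibility of \<open>pow_fun\<close> with composition follows from this.\<close>

lemma act_cmp:
  assumes v [simp]: "gel S v" "etgt v = Unit V" and u [simp]: "gel S u" "etgt u = esrc v" and L [simp]: "L \<in> Job V"
  shows "act L v \<star>[S] app (pow_fun L) u = act L (v \<star>[S] u)"
proof (rule S.cotens_eqD[OF structure_el_cotens_S[OF L]])
  have J [simp]: "esrc u \<in> Job V" "esrc v \<in> Job V" using gelD[OF u(1)] gelD[OF v(1)] by simp_all
  note [simp] = pow_fun_spec(1,2)[OF u(1) L]
  \<comment> \<open>Naturality at the projection of \<open>T\<close>: \<open>M\<close> sends it to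
    the projection of \<open>U\<close>, and \<open>[u,1]\<close> at \<open>I\<close> is
    \<open>u\<close>.\<close>
  have n: "u \<star>[S] proj (esrc u) L = (proj (esrc v) L \<star>[S] app (pow_fun L) u) \<lhd> Swap V (dm u) L"
    using pow_fun_natural[OF u(1) structure_el_gel_T(1)[OF L]] by (simp add: proj_def pow_fun_Unit)
  have "structure_el U L \<star>[S] (act L v \<star>[S] app (pow_fun L) u)
      = (v \<star>[S] (proj (esrc v) L \<star>[S] app (pow_fun L) u)) \<lhd> exch L (dm v) (dm u)"
    by (simp add: S.cmp_assoc'[of "structure_el U L"] S.cmp_pre_left) (simp add: S.cmp_assoc exch_def)
  also have "\<dots> = (v \<star>[S] (u \<star>[S] proj (esrc u) L)) \<lhd> ((Ident V (dm v) \<odot> Swap V L (dm u)) \<cdot> exch L (dm v) (dm u))"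
    by (simp add: n S.cmp_pre_right)
  also have "\<dots> = ((v \<star>[S] u) \<star>[S] proj (esrc u) L) \<lhd> Swap V L (dm v \<otimes> dm u)"
    by (simp add: S.cmp_assoc' Swap_tens_right)
  also have "\<dots> = structure_el U L \<star>[S] act L (v \<star>[S] u)"
    by simp
  finally show "structure_el U L \<star>[S] (act L v \<star>[S] app (pow_fun L) u) = structure_el U L \<star>[S] act L (v \<star>[S] u)" .
qed (use pow_fun_spec(1,2)[OF u(1) L] in simp_all)

lemma pow_fun_functor:
  assumes L [simp]: "L \<in> Job V"
  shows "vfunctor V S S (pow_fun L)"
proof (rule vfunctorI[OF S.X S.X])
  have L': "L \<in> EOb S" by simp
  fix a b assume a [simp]: "gel S a" and b [simp]: "gel S b" and ab: "esrc a = etgt b"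
  have J [simp]: "esrc b \<in> Job V" "etgt b \<in> Job V" "etgt a \<in> Job V" using gelD[OF a] gelD[OF b] by simp_all
  note [simp] = ab pow_fun_spec[OF a L] pow_fun_spec(1,2)[OF b L]
  have "gel S (a \<star>[S] b)" by simp
  note [simp] = pow_fun_spec(1,2)[OF this L]
  show "app (pow_fun L) (a \<star>[S] b) = app (pow_fun L) a \<star>[S] app (pow_fun L) b"
  proof (rule S.cotens_eqD[OF S.ctu_cotens[OF J(3) L']])
    have "S.ctu (etgt a) L \<star>[S] app (pow_fun L) (a \<star>[S] b) = act L (structure_el U (etgt a) \<star>[S] (a \<star>[S] b))"
      using pow_fun_spec(3)[of "a \<star>[S] b" L] by simp
    also have "\<dots> = act L ((structure_el U (etgt a) \<star>[S] a) \<star>[S] b) \<lhd> Assoc' (etgt a) (dm a) (dm b)"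
      by (simp add: S.cmp_assoc' act_pre)
    also have "\<dots> = (act L (structure_el U (etgt a) \<star>[S] a) \<star>[S] app (pow_fun L) b) \<lhd> Assoc' (etgt a) (dm a) (dm b)"
      by (simp add: act_cmp)
    also have "\<dots> = S.ctu (etgt a) L \<star>[S] (app (pow_fun L) a \<star>[S] app (pow_fun L) b)"
      by (simp add: S.cmp_assoc')
    finally show "S.ctu (etgt a) L \<star>[S] app (pow_fun L) (a \<star>[S] b)
      = S.ctu (etgt a) L \<star>[S] (app (pow_fun L) a \<star>[S] app (pow_fun L) b)" .
  qed simp_all
next
  fix K assume "K \<in> EOb S"
  then have K [simp]: "K \<in> Job V" by simp
  have L': "L \<in> EOb S" by simp
  have K': "gel S (idel S K)" by simp
  note [simp] = pow_fun_spec(1,2)[OF K' L]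
  show "app (pow_fun L) (idel S K) = idel S (FO (pow_fun L) K)"
  proof (rule S.cotens_eqD[OF S.ctu_cotens[OF K L']])
    show "S.ctu K L \<star>[S] app (pow_fun L) (idel S K) = S.ctu K L \<star>[S] idel S (FO (pow_fun L) K)"
      using pow_fun_spec(3)[OF K' L] by (simp add: S.cmp_idel_right act_pre act_structure_el)
  qed simp_all
next
  fix J K assume "J \<in> EOb S" "K \<in> EOb S"
  then show "FH (pow_fun L) J K \<in> hom V (EHom S J K) (EHom S (FO (pow_fun L) J) (FO (pow_fun L) K))"
    using gel_hom[OF pow_gen_simps(1), of J K L] by simp
qed simp

end

context system_of_arities
begin

lemma preserves_cotensors_cong:
  assumes "functor_eq T F G"
  shows "preserves_cotensors V T X F \<longleftrightarrow> preserves_cotensors V T X G"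
proof -
  have "x \<in> EOb T \<and> c \<in> EOb T" if "is_cotensor V T J x c k" for J x c k
    using that by (simp add: is_cotensor_def)
  then show ?thesis using assms unfolding preserves_cotensors_def functor_eq_def by metis
qed

end

text \<open>The inner factors are interchanged by \<open>sw\<close>, and the associators around this
  symmetry assemble to \<open>middle_four\<close>. This is the composition law of a functor on a
  tensor product of two categories.\<close>

lemma (in enriched) middle_four_cmp:
  assumes [simp]: "gel X a" "gel X b" "gel X c" "gel X d" "gel X b'" "gel X c'"
    and [simp]: "esrc a = etgt b" "esrc b = etgt c" "esrc c = etgt d" "etgt c' = esrc a" "esrc c' = etgt b'" "esrc b' = esrc c"
      "dm b' = dm b" "dm c' = dm c"
    and sw: "b \<star>[X] c = (c' \<star>[X] b') \<lhd> Swap V (dm b) (dm c)"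
  shows "(a \<star>[X] b) \<star>[X] (c \<star>[X] d)
    = ((a \<star>[X] c') \<star>[X] (b' \<star>[X] d)) \<lhd> middle_four V (dm a) (dm b) (dm c) (dm d)"
proof -
  let ?A = "dm a" and ?B = "dm b" and ?C = "dm c" and ?D = "dm d"
  have "(a \<star>[X] b) \<star>[X] (c \<star>[X] d) = (a \<star>[X] (b \<star>[X] (c \<star>[X] d))) \<lhd> Assoc V ?A ?B (?C \<otimes> ?D)"
    by (simp add: cmp_assoc)
  also have "b \<star>[X] (c \<star>[X] d) = ((b \<star>[X] c) \<star>[X] d) \<lhd> Assoc' ?B ?C ?D"
    by (rule cmp_assoc') simp_all
  also have "(b \<star>[X] c) \<star>[X] d = ((c' \<star>[X] b') \<star>[X] d) \<lhd> (Swap V ?B ?C \<odot> Ident V ?D)"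
    unfolding sw by (rule cmp_pre_left) simp_all
  also have "(c' \<star>[X] b') \<star>[X] d = (c' \<star>[X] (b' \<star>[X] d)) \<lhd> Assoc V ?C ?B ?D"
    using cmp_assoc[of c' b' d] by simp
  also have "a \<star>[X] ((c' \<star>[X] (b' \<star>[X] d)) \<lhd> Assoc V ?C ?B ?D \<lhd> (Swap V ?B ?C \<odot> Ident V ?D) \<lhd> Assoc' ?B ?C ?D)
     = (a \<star>[X] (c' \<star>[X] (b' \<star>[X] d))) \<lhd> (Ident V ?A \<odot> (Assoc V ?C ?B ?D \<cdot> ((Swap V ?B ?C \<odot> Ident V ?D) \<cdot> Assoc' ?B ?C ?D)))"
    by (simp add: cmp_pre_right)
  also have "a \<star>[X] (c' \<star>[X] (b' \<star>[X] d)) = ((a \<star>[X] c') \<star>[X] (b' \<star>[X] d)) \<lhd> Assoc' ?A ?C (?B \<otimes> ?D)"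
    using cmp_assoc'[of a c' "b' \<star>[X] d"] by simp
  finally show ?thesis by (simp add: middle_four_def)
qed

section \<open>The commutant of \<open>M\<close> and the bifold algebra\<close>

context central_setting
begin

abbreviation cM :: "'o \<Rightarrow> ('o, 'o, 'a) vfun" where "cM J \<equiv> cot_vfun V S J M"

lemma pow_fun_gen [simp]: "J \<in> Job V \<Longrightarrow> K \<in> Job V \<Longrightarrow> L \<in> Job V \<Longrightarrow> app (pow_fun L) (gen S J K) = pow_gen J K L"
proof -
  assume a [simp]: "J \<in> Job V" "K \<in> Job V" "L \<in> Job V"
  have "earr (pow_gen J K L) \<in> Arr V" using gelD(3)[OF pow_gen_simps(1)] a by blast
  then show ?thesis by (intro elem.expand) (simp add: app_def)
qed

lemma M_preserves: "preserves_cotensors V T S M"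
  by (rule preserves_cotensors_from_structure[OF thy S.X M.A.F]) (simp add: structure_el_cotens_S)

lemma cM_pair: "J \<in> Job V \<Longrightarrow> K \<in> Job V \<Longrightarrow> functor_pair V \<kappa> T S (cM J) (cM K)"
  using M.cot_vfun_functor by unfold_locales

lemma fam_pow_gen: "L \<in> Job V \<Longrightarrow> J \<in> Job V \<Longrightarrow> K \<in> Job V \<Longrightarrow> fam (cM J) (cM K) (\<lambda>L. earr (pow_gen J K L)) L = pow_gen J K L"
  by (intro elem.expand) simp

text \<open>The ends that define the commutant of \<open>M\<close> are the hom-objects of \<open>U\<close>. So they exist in
  \<open>\<V>\<close>, and no limits in \<open>\<V>\<close> or \<open>\<V>'\<close> have to be formed.\<close>

lemma pow_gen_end:
  assumes J [simp]: "J \<in> Job V" "K \<in> Job V"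
  shows "is_hom_end V (Vob V) T S (cM J) (cM K) (EHom S J K, \<lambda>L. earr (pow_gen J K L))"
proof -
  interpret functor_pair V \<kappa> T S "cM J" "cM K" by (rule cM_pair[OF J])
  let ?\<pi> = "\<lambda>L. earr (pow_gen J K L)"
  have n: "vnatural V T S (cM J) (cM K) (EHom S J K) ?\<pi>"
  proof (rule vnaturalI_gen)
    show "gel S (fam (cM J) (cM K) ?\<pi> x) \<and> dm (fam (cM J) (cM K) ?\<pi> x) = EHom S J K" if "x \<in> EOb T" for x
      using that by (simp add: fam_pow_gen)
    show "fam (cM J) (cM K) ?\<pi> y \<star>[S] app (cM J) (gen T x y)
      = (app (cM K) (gen T x y) \<star>[S] fam (cM J) (cM K) ?\<pi> x) \<lhd> Swap V (EHom S J K) (EHom T x y)"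
      if "x \<in> EOb T" "y \<in> EOb T" for x y
      using that pow_fun_natural[of "gen S J K" "gen T x y"] by (simp add: fam_pow_gen M.app_cot_vfun)
  qed simp
  \<comment> \<open>The projection at \<open>I\<close> is an identity, so the component of a family
    at \<open>I\<close> is the only candidate for its factorization.\<close>
  have pU: "?\<pi> (Unit V) = Ident V (EHom S J K)"
    using pow_fun_Unit[of "gen S J K"] by simp
  have [simp]: "?\<pi> L \<in> Arr V" "Dom V (?\<pi> L) = EHom S J K" if "L \<in> Job V" for L
    using gelD(3)[OF pow_gen_simps(1)[OF J that]] that by simp_all
  have "\<exists>!h. h \<in> hom V W (EHom S J K) \<and> (\<forall>x \<in> EOb T. ?\<pi> x \<cdot> h = \<alpha> x)"
    if W: "W \<in> Vob V" and \<alpha>: "vnatural V T S (cM J) (cM K) W \<alpha>" for W \<alpha>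
  proof (intro ex_ex1I exI conjI ballI)
    have h: "\<alpha> (Unit V) \<in> hom V W (EHom S J K)"
    proof -
      have "\<forall>x \<in> EOb T. \<alpha> x \<in> hom V W (EHom S (FO (cM J) x) (FO (cM K) x))"
        using \<alpha> unfolding vnatural_def by blast
      from bspec[OF this, of "Unit V"] show ?thesis by simp
    qed
    then show "\<alpha> (Unit V) \<in> hom V W (EHom S J K)" .
    have [simp]: "\<alpha> (Unit V) \<in> Arr V" "Dom V (\<alpha> (Unit V)) = W" "Cod V (\<alpha> (Unit V)) = EHom S J K"
      using h by (simp_all add: hom_def)
    fix L assume "L \<in> EOb T"
    then have L [simp]: "L \<in> Job V" by simp
    have c: "cotens S (app (cM K) (structure_el T L))"
      by (simp add: M.app_cot_vfun S.cotf_preserves structure_el_cotens_S)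
    have "vnatural V T S (cM J) (cM K) W (\<lambda>L. ?\<pi> L \<cdot> \<alpha> (Unit V))"
      using vnatural_pre[OF n, of "\<alpha> (Unit V)"] by simp
    from vnatural_determined[OF this \<alpha> structure_el_gel_T(1)[OF L] c]
    show "?\<pi> L \<cdot> \<alpha> (Unit V) = \<alpha> L" by (simp add: pU)
  next
    fix h h' assume "h \<in> hom V W (EHom S J K) \<and> (\<forall>x \<in> EOb T. ?\<pi> x \<cdot> h = \<alpha> x)"
      "h' \<in> hom V W (EHom S J K) \<and> (\<forall>x \<in> EOb T. ?\<pi> x \<cdot> h' = \<alpha> x)"
    then have "h \<in> Arr V" "h' \<in> Arr V" "Cod V h = EHom S J K" "Cod V h' = EHom S J K" "?\<pi> (Unit V) \<cdot> h = ?\<pi> (Unit V) \<cdot> h'"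
      by (simp_all add: hom_def)
    then show "h = h'" by (simp add: pU)
  qed
  then show ?thesis using n by (simp add: is_hom_end_def)
qed

lemma commutant_M: "commutant_setting V \<kappa> T S M"
  by unfold_locales (use pow_gen_end thy in blast)+

text \<open>\<open>pow_gen_end\<close> makes \<open>U(J,K)\<close> an end, but the commutant uses
  the end selected by \<open>hom_end\<close>. So the factorization \<open>P'\<close> is the lift of
  the family \<open>pow_gen\<close> to the selected end, and its laws are checked on the projections
  of that end.\<close>

lemma M_central: "central V T U M"
proof -
  interpret CM: commutant_setting V \<kappa> T S M by (rule commutant_M)
  have R: "commutant_theory V T S M = CM.R" ..
  have pow_gen [simp]: "earr (pow_gen J K L) \<in> Arr V" "Cod V (earr (pow_gen J K L)) = EHom S (Cot S J L) (Cot S K L)"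
    if "J \<in> Job V" "K \<in> Job V" "L \<in> Job V" for J K L
    using gelD(3,4)[OF pow_gen_simps(1)[OF that]] that by simp_all
  have pn: "vnatural V T S (cM J) (cM K) (EHom S J K) (\<lambda>L. earr (pow_gen J K L))" if "J \<in> Job V" "K \<in> Job V" for J K
    using pow_gen_end[OF that] by (simp add: is_hom_end_def)
  define P' :: "('o, 'o, 'a) vfun" where "P' = \<lparr>FO = (\<lambda>J. J),
    FH = (\<lambda>J K. nat_lift V T S (cM J) (cM K) (EHom S J K) (\<lambda>L. earr (pow_gen J K L)))\<rparr>"
  have P' [simp]: "FH P' J K \<in> Arr V" "Dom V (FH P' J K) = EHom S J K" "Cod V (FH P' J K) = CM.N J K"
    if "J \<in> Job V" "K \<in> Job V" for J K
    using CM.nat_lift_spec(1-3)[OF that _ pn[OF that]] that by (simp_all add: P'_def)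
  have prP: "CM.pr J K L \<cdot> FH P' J K = earr (pow_gen J K L)" if "J \<in> Job V" "K \<in> Job V" "L \<in> Job V" for J K L
    using CM.nat_lift_spec(4)[OF that(1,2) _ pn[OF that(1,2)] that(3)] that by (simp add: P'_def)
  have prP': "CM.pr J K L \<cdot> (FH P' J K \<cdot> h) = earr (pow_gen J K L) \<cdot> h"
    if "J \<in> Job V" "K \<in> Job V" "L \<in> Job V" "h \<in> Arr V" "Cod V h = EHom S J K" for J K L h
    using comp_extend[OF prP[OF that(1-3)], of h] that by simp
  have FO_P' [simp]: "FO P' J = J" for J by (simp add: P'_def)
  have pow_gen_comp: "earr (pow_gen J H L) \<cdot> EComp S J K H
      = EComp S (Cot S J L) (Cot S K L) (Cot S H L) \<cdot> (earr (pow_gen K H L) \<odot> earr (pow_gen J K L))"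
    if "J \<in> Job V" "K \<in> Job V" "H \<in> Job V" "L \<in> Job V" for J K H L
    using pow_fun_functor[OF that(4)] that by (simp add: vfunctor_def)
  have pow_gen_id: "earr (pow_gen J J L) \<cdot> EId S J = EId S (Cot S J L)" if "J \<in> Job V" "L \<in> Job V" for J L
    using pow_fun_functor[OF that(2)] that by (simp add: vfunctor_def)
  note Rs [simp] = CM.EComp_R_spec(1-3) CM.EId_R_spec(1-3)
  have comp: "FH P' J H \<cdot> EComp S J K H = EComp CM.R J K H \<cdot> (FH P' K H \<odot> FH P' J K)"
    if [simp]: "J \<in> Job V" "K \<in> Job V" "H \<in> Job V" for J K H
  proof (rule CM.pr_joint_mono[of J H])
    fix L assume L [simp]: "L \<in> Job V"
    have "CM.pr J H L \<cdot> (EComp CM.R J K H \<cdot> (FH P' K H \<odot> FH P' J K))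
       = (EComp S (Cot S J (FO M L)) (Cot S K (FO M L)) (Cot S H (FO M L)) \<cdot> (CM.pr K H L \<odot> CM.pr J K L)) \<cdot> (FH P' K H \<odot> FH P' J K)"
      by (rule comp_extend[OF CM.EComp_R_spec(4)]) (simp_all del: CM.R_simps)
    also have "\<dots> = EComp S (Cot S J L) (Cot S K L) (Cot S H L) \<cdot> (earr (pow_gen K H L) \<odot> earr (pow_gen J K L))"
      by (simp add: prP)
    finally show "CM.pr J H L \<cdot> (FH P' J H \<cdot> EComp S J K H) = CM.pr J H L \<cdot> (EComp CM.R J K H \<cdot> (FH P' K H \<odot> FH P' J K))"
      by (simp add: prP' pow_gen_comp del: CM.R_simps)
  qed (simp_all del: CM.R_simps)
  have id: "FH P' J J \<cdot> EId S J = EId CM.R J" if [simp]: "J \<in> Job V" for J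
  proof (rule CM.pr_joint_mono[of J J])
    fix L assume L [simp]: "L \<in> Job V"
    show "CM.pr J J L \<cdot> (FH P' J J \<cdot> EId S J) = CM.pr J J L \<cdot> EId CM.R J"
      using CM.EId_R_spec(4)[of J L] by (simp add: prP' pow_gen_id del: CM.R_simps)
  qed (simp_all del: CM.R_simps)
  have f: "vfunctor V S CM.R P'"
    unfolding vfunctor_def using comp id by (simp add: hom_def del: CM.R_simps(3,4))
  \<comment> \<open>\<open>Tau_R\<close> asks for an equation at each \<open>L\<close>; it results
    from applying \<open>act L\<close> to both sides of \<open>structure_el_Tau\<close>.\<close>
  have tau: "Tau CM.R J K = FH P' J K \<cdot> Tau U J K" if J [simp]: "J \<in> Job V" "K \<in> Job V" for J K
  proof (rule CM.Tau_R)
    note t = structure_el_Tau[OF thU J]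
    have tS [simp]: "gel S (tau_el U J K)" "Dom V (Tau U J K) = IHom V K J" "Tau U J K \<in> Arr V" "Cod V (Tau U J K) = EHom S J K"
      using t Tau_simps[OF thU J] by (simp_all add: gel_theory_cvcat theory_cvcat_simps)
    have st: "structure_el U K \<star>[S] tau_el U J K = structure_el U J \<lhd> (Ev V K J \<cdot> Swap V K (IHom V K J))"
      using t(3) by (simp add: cmp_def theory_cvcat_simps)
    have ts [simp]: "esrc (tau_el U J K) = J" "etgt (tau_el U J K) = K" "earr (tau_el U J K) = Tau U J K"
      by (simp_all add: tau_el_def)
    show "FH P' J K \<cdot> Tau U J K \<in> Arr V" "Dom V (FH P' J K \<cdot> Tau U J K) = IHom V K J" "Cod V (FH P' J K \<cdot> Tau U J K) = CM.N J K"
      by simp_all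
    fix L assume L [simp]: "L \<in> Job V"
    have p: "CM.pr_el J K (FH P' J K \<cdot> Tau U J K) L = app (pow_fun L) (tau_el U J K)"
      by (simp add: CM.pr_el_def app_def prP')
    show "S.ctu K (FO M L) \<star>[S] CM.pr_el J K (FH P' J K \<cdot> Tau U J K) L = S.ctu J (FO M L) \<lhd> (Ev V K J \<cdot> Swap V K (IHom V K J))"
      using pow_fun_spec(3)[OF tS(1) L] by (simp add: p st act_pre act_structure_el)
  qed (use that in simp_all)
  have "theory_morphism V U CM.R P'"
    using f tau by (simp add: theory_morphism_def vfunctor_theory_cvcat functor_eq_def comp_vfun_def)
  moreover have "functor_eq U (comp_vfun V (commutant V T S M) P') (id_vfun V U)"
    unfolding functor_eq_def theory_EOb[OF thU]
  proof (intro conjI ballI)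
    fix J K assume J [simp]: "J \<in> Job V" "K \<in> Job V"
    show "FH (comp_vfun V (commutant V T S M) P') J K = FH (id_vfun V U) J K"
      using pow_fun_Unit[of "gen S J K"] by (simp add: comp_vfun_def commutant_def id_vfun_def prP) (simp add: theory_cvcat_simps)
  qed (simp_all add: comp_vfun_def commutant_def id_vfun_def)
  moreover have "theory_morphism V U U (id_vfun V U)"
  proof -
    have [simp]: "EHom U J K \<in> Obj V" if "J \<in> Job V" "K \<in> Job V" for J K
      using EHom_Vob(1)[OF that] Vob by (auto simp: theory_cvcat_simps)
    show ?thesis using vfunctor_id(1)[OF theory_enriched[OF thU]] Tau_simps[OF thU]
      by (simp add: theory_morphism_def functor_eq_def comp_vfun_def) (simp add: id_vfun_def)
  qed
  ultimately show ?thesis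
    using M_morphism unfolding central_def theory_morphisms_commute_def by blast
qed

text \<open>Arrows \<open>L \<rightarrow> L'\<close> of \<open>T\<close> and
  \<open>u : J \<rightarrow> K\<close> of \<open>U\<close> act as
  \<open>[J,L] \<rightarrow> [K,L] \<rightarrow> [K,L']\<close>, first by \<open>u\<close> and then
  through \<open>M\<close>; by \<open>pow_fun_natural\<close> the other order gives the same up to
  symmetry.\<close>

definition bifold :: "('o \<times> 'o, 'o, 'a) vfun" where
  "bifold = \<lparr>FO = (\<lambda>(L, J). Cot S J L), FH = (\<lambda>(L, J) (L', K).
     earr (app (cM K) (gen T L L') \<star>[S] pow_gen J K L))\<rparr>"

lemma FH_bifold [simp]: "FH bifold (L, J) (L', K) = earr (app (cM K) (gen T L L') \<star>[S] pow_gen J K L)"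
  and FO_bifold [simp]: "FO bifold (L, J) = Cot S J L"
  by (simp_all add: bifold_def)

lemma cM_simps [simp]:
  assumes "K \<in> Job V" "gel T t"
  shows "gel S (app (cM K) t)" "dm (app (cM K) t) = dm t"
  using S.cotf_spec(1,2)[OF assms(1) M.A.gel_app[OF assms(2)]] assms by (simp_all add: M.app_cot_vfun)

text \<open>\<open>FH bifold\<close> is given on universal elements; precomposition carries the
  formula to all pairs, which turns the functor laws into computations with elements.\<close>

lemma bifold_action:
  assumes t [simp]: "gel T t" and u [simp]: "gel S u"
  shows "earr (app (cM (etgt u)) t \<star>[S] app (pow_fun (esrc t)) u)
    = FH bifold (esrc t, esrc u) (etgt t, etgt u) \<cdot> (earr t \<odot> earr u)"
proof -
  have J [simp]: "esrc u \<in> Job V" "etgt u \<in> Job V" "earr u \<in> Arr V" "Cod V (earr u) = EHom S (esrc u) (etgt u)"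
    using gelD[OF u] by simp_all
  have L [simp]: "esrc t \<in> Job V" "etgt t \<in> Job V" "earr t \<in> Arr V" "Cod V (earr t) = EHom T (esrc t) (etgt t)"
    using gelD[OF t] by simp_all
  interpret K: enriched_functor V \<kappa> T S "cM (etgt u)" by unfold_locales (rule M.cot_vfun_functor, simp)
  interpret L: enriched_functor V \<kappa> S S "pow_fun (esrc t)" by unfold_locales (rule pow_fun_functor, simp)
  have "app (cM (etgt u)) (gen T (esrc t) (etgt t) \<lhd> earr t) \<star>[S] app (pow_fun (esrc t)) (gen S (esrc u) (etgt u) \<lhd> earr u)
    = (app (cM (etgt u)) (gen T (esrc t) (etgt t)) \<star>[S] pow_gen (esrc u) (etgt u) (esrc t)) \<lhd> (earr t \<odot> earr u)"
    by (simp add: K.app_pre L.app_pre S.cmp_pre_left S.cmp_pre_right)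
  then have "app (cM (etgt u)) t \<star>[S] app (pow_fun (esrc t)) u
    = (app (cM (etgt u)) (gen T (esrc t) (etgt t)) \<star>[S] pow_gen (esrc u) (etgt u) (esrc t)) \<lhd> (earr t \<odot> earr u)"
    by (simp add: gen_pre flip: A.X.gel_eq_gen)
  then show ?thesis by (simp add: pre_def)
qed

text \<open>For composition, an arrow \<open>[u,1]\<close> and an arrow \<open>[1,Mt]\<close> have
  to be interchanged. This is \<open>pow_fun_natural\<close>, and \<open>middle_four_cmp\<close>
  matches it with composition in the tensor product.\<close>

lemma bifold_functor: "vfunctor V (tensor_vcat V T U) S bifold"
proof -
  have ES: "EHom U = EHom S" "EComp U = EComp S" "EId U = EId S" "EOb U = Job V"
    by (simp_all add: theory_cvcat_simps theory_EOb[OF thU])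
  have ty: "FH bifold (L, J) (L', K) \<in> hom V (EHom T L L' \<otimes> EHom S J K) (EHom S (Cot S J L) (Cot S K L'))"
    if [simp]: "L \<in> Job V" "J \<in> Job V" "L' \<in> Job V" "K \<in> Job V" for L J L' K
    using gel_hom[of S "app (cM K) (gen T L L') \<star>[S] pow_gen J K L"] by simp
  have comp: "FH bifold (L, J) (L'', H) \<cdot> ((EComp T L L' L'' \<odot> EComp S J K H) \<cdot>
        middle_four V (EHom T L' L'') (EHom S K H) (EHom T L L') (EHom S J K))
      = EComp S (Cot S J L) (Cot S K L') (Cot S H L'') \<cdot> (FH bifold (L', K) (L'', H) \<odot> FH bifold (L, J) (L', K))"
    if [simp]: "L \<in> Job V" "L' \<in> Job V" "L'' \<in> Job V" "J \<in> Job V" "K \<in> Job V" "H \<in> Job V" for L L' L'' J K H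
  proof -
    let ?t = "gen T L L'" and ?t' = "gen T L' L''" and ?u = "gen S J K" and ?u' = "gen S K H"
    interpret H: enriched_functor V \<kappa> T S "cM H" by unfold_locales (rule M.cot_vfun_functor, simp)
    interpret L: enriched_functor V \<kappa> S S "pow_fun L" by unfold_locales (rule pow_fun_functor, simp)
    have sw: "pow_gen K H L' \<star>[S] app (cM K) ?t = (app (cM H) ?t \<star>[S] pow_gen K H L) \<lhd> Swap V (EHom S K H) (EHom T L L')"
      using pow_fun_natural[of ?u' ?t] by (simp add: M.app_cot_vfun)
    have "(app (cM H) ?t' \<star>[S] pow_gen K H L') \<star>[S] (app (cM K) ?t \<star>[S] pow_gen J K L)
      = ((app (cM H) ?t' \<star>[S] app (cM H) ?t) \<star>[S] (pow_gen K H L \<star>[S] pow_gen J K L)) \<lhd>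
          middle_four V (EHom T L' L'') (EHom S K H) (EHom T L L') (EHom S J K)"
      using S.middle_four_cmp[of "app (cM H) ?t'" "pow_gen K H L'" "app (cM K) ?t" "pow_gen J K L" "pow_gen K H L" "app (cM H) ?t"] sw
      by simp
    also have "(app (cM H) ?t' \<star>[S] app (cM H) ?t) \<star>[S] (pow_gen K H L \<star>[S] pow_gen J K L)
      = app (cM H) (?t' \<star>[T] ?t) \<star>[S] app (pow_fun L) (?u' \<star>[S] ?u)"
      by (simp add: H.app_cmp L.app_cmp)
    finally have e: "(app (cM H) ?t' \<star>[S] pow_gen K H L') \<star>[S] (app (cM K) ?t \<star>[S] pow_gen J K L)
      = (app (cM H) (?t' \<star>[T] ?t) \<star>[S] app (pow_fun L) (?u' \<star>[S] ?u)) \<lhd>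
          middle_four V (EHom T L' L'') (EHom S K H) (EHom T L L') (EHom S J K)" .
    have m4: "middle_four V (EHom T L' L'') (EHom S K H) (EHom T L L') (EHom S J K) \<in> Arr V"
      "Cod V (middle_four V (EHom T L' L'') (EHom S K H) (EHom T L L') (EHom S J K))
        = (EHom T L' L'' \<otimes> EHom T L L') \<otimes> (EHom S K H \<otimes> EHom S J K)"
      by (simp_all add: middle_four_def)
    have b: "FH bifold (L, J) (L'', H) \<in> Arr V" "Dom V (FH bifold (L, J) (L'', H)) = EHom T L L'' \<otimes> EHom S J H"
      using ty[of L J L'' H] by (simp_all add: hom_def)
    have ee: "earr (?t' \<star>[T] ?t) = EComp T L L' L''" "earr (?u' \<star>[S] ?u) = EComp S J K H"
      by (simp_all add: cmp_def)
    from arg_cong[OF e, of earr] bifold_action[of "?t' \<star>[T] ?t" "?u' \<star>[S] ?u"] m4 b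
    show ?thesis by (simp add: ee del: FH_bifold) (simp add: cmp_def pre_def)
  qed
  have id: "FH bifold (L, J) (L, J) \<cdot> ((EId T L \<odot> EId S J) \<cdot> Lun' (Unit V)) = EId S (Cot S J L)"
    if [simp]: "L \<in> Job V" "J \<in> Job V" for L J
  proof -
    interpret H: enriched_functor V \<kappa> T S "cM J" by unfold_locales (rule M.cot_vfun_functor, simp)
    interpret L: enriched_functor V \<kappa> S S "pow_fun L" by unfold_locales (rule pow_fun_functor, simp)
    have "app (cM J) (idel T L) \<star>[S] app (pow_fun L) (idel S J) = idel S (Cot S J L) \<lhd> Lun V (Unit V)"
      by (simp add: H.app_idel L.app_idel S.cmp_idel_left)
    then have "FH bifold (L, J) (L, J) \<cdot> (EId T L \<odot> EId S J) = EId S (Cot S J L) \<cdot> Lun V (Unit V)"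
      using bifold_action[of "idel T L" "idel S J"] by (simp add: pre_def)
    from comp_extend[OF this, of "Lun' (Unit V)"] ty[of L J L J] show ?thesis by (simp add: hom_def del: FH_bifold)
  qed
  show ?thesis
    unfolding vfunctor_def tensor_vcat_def
    using ty comp id by (auto simp add: ES simp del: FH_bifold)
qed

lemma partial_left_bifold: "K \<in> Job V \<Longrightarrow> functor_eq T (partial_left V T U bifold K) (cM K)"
  unfolding functor_eq_def theory_EOb_T
proof (intro conjI ballI)
  fix L L' assume [simp]: "K \<in> Job V" "L \<in> Job V" "L' \<in> Job V"
  let ?t = "gen T L L'"
  interpret H: enriched_functor V \<kappa> T S "cM K" by unfold_locales (rule M.cot_vfun_functor, simp)
  interpret L: enriched_functor V \<kappa> S S "pow_fun L" by unfold_locales (rule pow_fun_functor, simp)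
  have "app (cM K) ?t \<star>[S] app (pow_fun L) (idel S K) = app (cM K) ?t \<lhd> Run V (EHom T L L')"
    by (simp add: L.app_idel S.cmp_idel_right)
  then have e: "FH bifold (L, K) (L', K) \<cdot> (Ident V (EHom T L L') \<odot> EId S K) = FH (cM K) L L' \<cdot> Run V (EHom T L L')"
    using bifold_action[of ?t "idel S K"] by (simp add: pre_def app_def)
  have "FH bifold (L, K) (L', K) \<in> Arr V" "Dom V (FH bifold (L, K) (L', K)) = EHom T L L' \<otimes> EHom S K K"
    using gel_hom[of S "app (cM K) ?t \<star>[S] pow_gen K K L"] by (simp_all add: hom_def)
  moreover have "EId U = EId S" by (simp add: theory_cvcat_simps)
  ultimately show "FH (partial_left V T U bifold K) L L' = FH (cM K) L L'"
    using comp_extend[OF e, of "Run' (EHom T L L')"] by (simp add: partial_left_def del: FH_bifold)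
qed (simp add: partial_left_def)

lemma partial_right_bifold: "L \<in> Job V \<Longrightarrow> functor_eq U (partial_right V T U bifold L) (pow_fun L)"
  unfolding functor_eq_def theory_EOb[OF thU]
proof (intro conjI ballI)
  fix J K assume [simp]: "L \<in> Job V" "J \<in> Job V" "K \<in> Job V"
  let ?u = "gen S J K"
  interpret H: enriched_functor V \<kappa> T S "cM K" by unfold_locales (rule M.cot_vfun_functor, simp)
  have "app (cM K) (idel T L) \<star>[S] app (pow_fun L) ?u = pow_gen J K L \<lhd> Lun V (EHom S J K)"
    by (simp add: H.app_idel S.cmp_idel_left)
  then have e: "FH bifold (L, J) (L, K) \<cdot> (EId T L \<odot> Ident V (EHom S J K)) = earr (pow_gen J K L) \<cdot> Lun V (EHom S J K)"
    using bifold_action[of "idel T L" ?u] by (simp add: pre_def)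
  have "FH bifold (L, J) (L, K) \<in> Arr V" "Dom V (FH bifold (L, J) (L, K)) = EHom T L L \<otimes> EHom S J K"
    using gel_hom[of S "app (cM K) (gen T L L) \<star>[S] pow_gen J K L"] by (simp_all add: hom_def)
  moreover have "earr (pow_gen J K L) \<in> Arr V" using gelD(3)[OF pow_gen_simps(1)[of J K L]] by simp
  moreover have "EHom U = EHom S" by (simp add: theory_cvcat_simps)
  ultimately show "FH (partial_right V T U bifold L) J K = FH (pow_fun L) J K"
    using comp_extend[OF e, of "Lun' (EHom S J K)"]
    by (simp add: partial_right_def del: FH_bifold)
qed (simp add: partial_right_def)

text \<open>\<open>[K,M]\<close> preserves cotensors because \<open>M\<close> and
  \<open>[K,-]\<close> do. For \<open>[-,L]\<close> it is enough that projections go to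
  counits.\<close>

lemma bifold_is_bifold_algebra: "bifold_algebra V T U S bifold"
  unfolding bifold_algebra_def theory_EOb[OF thU] theory_EOb_T
proof (intro conjI ballI)
  fix K assume K: "K \<in> Job V"
  have "preserves_cotensors V T S (cM K)"
    using M.cot_vfun_algebra[OF M_preserves K] by (simp add: algebra_def)
  then show "preserves_cotensors V T S (partial_left V T U bifold K)"
    using preserves_cotensors_cong[OF partial_left_bifold[OF K]] by blast
next
  fix L assume L [simp]: "L \<in> Job V"
  have "preserves_cotensors V U S (pow_fun L)"
    by (rule preserves_cotensors_from_structure[OF thU S.X])
      (simp_all add: pow_fun_functor pow_fun_structure_el S.ctu_cotens flip: vfunctor_theory_cvcat)
  then show "preserves_cotensors V U S (partial_right V T U bifold L)"
    using preserves_cotensors_cong[OF partial_right_bifold[OF L]] by blast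
qed (rule bifold_functor)

text \<open>Designated cotensors satisfy \<open>[I,L] = L\<close>, so \<open>[I,M]\<close> is
  \<open>M\<close> itself and not only isomorphic to it.\<close>

lemma left_face_bifold: "functor_eq T (left_face V T U bifold) M"
proof -
  have "FH (cM (Unit V)) L L' = FH M L L'" if [simp]: "L \<in> Job V" "L' \<in> Job V" for L L'
    using arg_cong[OF M.app_cot_vfun_Unit[of "gen T L L'"], of earr]
    by (simp add: app_def M.cot_vfun_functor vfunctor_def)
      (use M.cot_vfun_functor[OF Job_unit] in \<open>simp add: vfunctor_def hom_def\<close>)
  then show ?thesis
    using partial_left_bifold[OF Job_unit] unfolding left_face_def functor_eq_def by (simp add: S.Cot_Unit)
qed

lemma right_face_bifold: "functor_eq U (right_face V T U bifold) (id_vfun V U)"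
proof -
  have "pow_gen J K (Unit V) = gen S J K" if [simp]: "J \<in> Job V" "K \<in> Job V" for J K
    using pow_fun_Unit[of "gen S J K"] by simp
  then show ?thesis
    using partial_right_bifold[OF Job_unit] unfolding right_face_def functor_eq_def
    by (simp add: theory_EOb[OF thU] id_vfun_def) (simp add: theory_cvcat_simps)
qed

end

theorem proposition14p2:
  fixes V :: "('o, 'a, 'm) base_scheme"
    and \<kappa> :: "'s itself"
    and C :: "('c, 'o, 'a, 'n) cvcat_scheme"
    and T U :: "('o, 'a) vtheory"
    and D :: "('o \<times> 'o, 'c, 'a) vfun"
  assumes "system_of_arities V \<kappa>"
    and "has_pullbacks (full_subcategory V (Vob V))"
    and "V_category V C" and "admissible V C"
    and "J_theory V T" and "J_theory V U"
    and "bifold_algebra V T U C D"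
    and "right_commutant V T U C D"
    and "commutative V C T (left_face V T U D)"
  shows "(\<exists>M. Alg_morphism V C (carrier V D) T (left_face V T U D) U (right_face V T U D) M \<and>
           (\<forall>M'. Alg_morphism V C (carrier V D) T (left_face V T U D) U (right_face V T U D) M'
              \<longrightarrow> functor_eq T M' M)) \<and>
         (\<forall>M. Alg_morphism V C (carrier V D) T (left_face V T U D) U (right_face V T U D) M \<longrightarrow>
            central V T U M \<and>
            (\<exists>E. bifold_algebra V T U (theory_cvcat V U) E \<and>
               functor_eq T (left_face V T U E) M \<and>
               functor_eq U (right_face V T U E) (id_vfun V U)))"
proof -
  interpret system_of_arities V \<kappa> by fact
  let ?A = "left_face V T U D" and ?B = "right_face V T U D"
  let ?R = "commutant_theory V T C ?A" and ?A' = "commutant V T C ?A"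
  have c: "FO ?A (Unit V) = carrier V D"
    by (simp add: left_face_def partial_left_def carrier_def)
  obtain P Q where PQ: "Alg_morphism V C (carrier V D) U ?B ?R ?A' P"
      "Alg_morphism V C (carrier V D) ?R ?A' U ?B Q" "functor_eq U (comp_vfun V Q P) (id_vfun V U)"
    using assms(8) unfolding right_commutant_def Alg_isomorphic_def by blast
  obtain N where N: "Alg_morphism V C (carrier V D) T ?A ?R ?A' N"
    using assms(9) unfolding commutative_def commutes_def c by blast
  have C: "enriched_category V C" "has_designated_cotensors V C"
    using assms(3,4) by (simp_all add: V_category_def admissible_def)
  have ex: "Alg_morphism V C (carrier V D) T ?A U ?B (comp_vfun V Q N)"
    by (rule Alg_morphism_comp[OF C(1) N PQ(2)])
  have A: "vfunctor V T C ?A" "preserves_cotensors V T C ?A"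
    using N by (simp_all add: Alg_morphism_iff)
  have th: "theory_enlarged V T" "homs_in_V V T" "homs_in_V V U"
    using assms(5,6) by (simp_all add: J_theory_def)
  interpret A: algebra_functor V \<kappa> T C ?A
    by unfold_locales (simp_all add: C A theory_enriched th)
  interpret right_commutant_setting V \<kappa> T C ?A U ?B P Q
  proof unfold_locales
    fix J K assume "J \<in> Job V" "K \<in> Job V"
    \<comment> \<open>Each \<open>[J,A]\<close> is again an algebra of the theory \<open>T\<close>,
      so admissibility supplies the end.\<close>
    then show "\<exists>e. is_hom_end V (Vob V) T C (cot_vfun V C J ?A) (cot_vfun V C K ?A) e"
      using assms(4,5) A.cot_vfun_algebra[OF A(2)] unfolding admissible_def by blast
  qed (use PQ th A in \<open>simp_all add: c Alg_morphism_iff\<close>)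
  have "central V T U M \<and>
            (\<exists>E. bifold_algebra V T U (theory_cvcat V U) E \<and>
               functor_eq T (left_face V T U E) M \<and>
               functor_eq U (right_face V T U E) (id_vfun V U))"
    if M: "Alg_morphism V C (carrier V D) T ?A U ?B M" for M
  proof -
    obtain f f' where f: "\<And>J. J \<in> Job V \<Longrightarrow> esrc (f J) = FO ?A J \<and> etgt (f J) = FO ?B J \<and> A.inverse_el (f J) (f' J)"
      "f (Unit V) = idel C (FO ?A (Unit V))"
      "\<And>t. gel T t \<Longrightarrow> lact C (f (etgt t)) (app ?A t) = ract C (app ?B (app M t)) (f (esrc t))"
      "\<And>t. gel T t \<Longrightarrow> lact C (f' (etgt t)) (app ?B (app M t)) = ract C (app ?A t) (f' (esrc t))"
      using Alg_morphism_iso[OF M[folded c]] by metis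
    interpret c: central_setting V \<kappa> T C ?A U ?B P Q M f f'
      by unfold_locales (use M f in \<open>auto simp: Alg_morphism_iff\<close>)
    show ?thesis using c.M_central c.bifold_is_bifold_algebra c.left_face_bifold c.right_face_bifold by blast
  qed
  then show ?thesis using ex Alg_morphism_unique[unfolded c] by blast
qed

end
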